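(* Let $N$ be a von Neumann algebra, $J\subseteq N$ a norm closed ideal and $\pi:N\to N/J$ the quotient map. Suppose that $p,q,r$ are three projections in $N$ with $$\|\pi(p)-\pi(q)\|<1/2,\qquad\|\pi(q)-\pi(r)\|<1/2,\qquad\|\pi(r)-\pi(p)\|<1/2.$$ Then, in $K_0(J)$, $$\mathrm{Ind}_{(r\text{-}q)}(rq)+\mathrm{Ind}_{(q\text{-}p)}(qp)=\mathrm{Ind}_{(r\text{-}p)}(rp).$$ Thus the spectral flow $\mathrm{sf}\{B_t\}\in K_0(J)$ of a norm continuous path $\{B_t\}_{t\in[0,1]}$ of self-adjoint $J$-Fredholm operators is independent of the partition chosen in its definition.
   Context: $N$ acts on a Hilbert space $H$. For $S\in N$, $N(S)$ is the projection onto $\ker S$; for projections $p,q\in N$, $p\cap q$ is the projection onto $\mathrm{Im}(p)\cap\mathrm{Im}(q)$. For projections $p,q\in N$, an operator $S\in qNp$ is $(q$-$p)$-Fredholm if there is $T\in pNq$ with $\pi(TS)=\pi(p)$ and $\pi(ST)=\pi(q)$. Then $N(S)\cap p$ and $N(S^* )\cap q$ lie in $J$ and $\mathrm{Ind}_{(q\text{-}p)}(S)=[N(S)\cap p]-[N(S^* )\cap q]\in K_0(J)$. If $\|\pi(p)-\pi(q)\|<1$ then $qp\in qNp$ is $(q$-$p)$-Fredholm. $T\in N$ is $J$-Fredholm if $\pi(T)$ is invertible in $N/J$. Let $\chi$ be the indicator function of $[0,\infty)$. For a norm continuous path $t\mapsto B_t$ of self-adjoint $J$-Fredholm operators, the path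 $t\mapsto\pi(\chi(B_t))$ is norm continuous; choose a partition $0=t_0<t_1<\dots<t_n=1$ with $\|\pi(\chi(B_t))-\pi(\chi(B_s))\|<1/2$ for all $t,s\in[t_{i-1},t_i]$, $i=1,\dots,n$, set $p_i=\chi(B_{t_i})$ and define $\mathrm{sf}\{B_t\}=\sum_{i=1}^n[(1-p_i)\cap p_{i-1}]-[(1-p_{i-1})\cap p_i]\in K_0(J)$. *)

theory Defs
  imports "HOL-Analysis.Analysis" "HOL-Algebra.QuotRing" "Jordan_Normal_Form.Matrix"
begin

section \<open>Complex Hilbert spaces and their bounded operators\<close>

class scaleC =
  fixes scaleC :: "complex \<Rightarrow> 'a \<Rightarrow> 'a"  (infixr "*\<^sub>C" 75)

class star =
  fixes star :: "'a \<Rightarrow> 'a"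

text \<open>The real inner product is the real part of the complex one, so the norm, topology and
  completeness are those of the underlying real Hilbert space. The complex inner product is
  antilinear in its first argument.\<close>

class hilbert_space = real_inner + complete_space + scaleC +
  fixes cinner :: "'a \<Rightarrow> 'a \<Rightarrow> complex"
  assumes scaleC_add_right: "c *\<^sub>C (x + y) = c *\<^sub>C x + c *\<^sub>C y"
    and scaleC_add_left: "(c + d) *\<^sub>C x = c *\<^sub>C x + d *\<^sub>C x"
    and scaleC_scaleC: "c *\<^sub>C d *\<^sub>C x = (c * d) *\<^sub>C x"
    and scaleR_eq_scaleC: "r *\<^sub>R x = complex_of_real r *\<^sub>C x"
    and cinner_commute: "cinner x y = cnj (cinner y x)"
    and cinner_add_right: "cinner x (y + z) = cinner x y + cinner x z"
    and cinner_scaleC_right: "cinner x (c *\<^sub>C y) = c * cinner x y"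
    and inner_eq_Re_cinner: "inner x y = Re (cinner x y)"

lemma cinner_scaleC_left: "cinner (c *\<^sub>C x) y = cnj c * cinner x y"
proof -
  have "cinner (c *\<^sub>C x) y = cnj (cinner y (c *\<^sub>C x))"
    by (rule cinner_commute)
  also have "\<dots> = cnj c * cnj (cinner y x)"
    by (simp add: cinner_scaleC_right)
  also have "cnj (cinner y x) = cinner x y"
    by (rule cinner_commute[symmetric])
  finally show ?thesis .
qed

lemma norm_scaleC: "norm (c *\<^sub>C x) = cmod c * norm (x :: 'a::hilbert_space)"
proof -
  have *: "(norm y)\<^sup>2 = Re (cinner y y)" for y :: 'a
    by (simp add: power2_norm_eq_inner inner_eq_Re_cinner)
  have "cinner (c *\<^sub>C x) (c *\<^sub>C x) = (c * cnj c) * cinner x x"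
    by (simp add: cinner_scaleC_left cinner_scaleC_right)
  also have "c * cnj c = complex_of_real ((cmod c)\<^sup>2)"
    by (rule complex_norm_square[symmetric])
  finally have "Re (cinner (c *\<^sub>C x) (c *\<^sub>C x)) = (cmod c)\<^sup>2 * Re (cinner x x)"
    by (simp only: Re_complex_of_real times_complex.sel Im_complex_of_real mult_zero_left diff_zero)
  then have "(norm (c *\<^sub>C x))\<^sup>2 = (cmod c * norm x)\<^sup>2"
    by (simp only: * power_mult_distrib)
  then show ?thesis
    by (rule power2_eq_imp_eq) simp_all
qed

lemma bounded_linear_scaleC: "bounded_linear (\<lambda>x :: 'a::hilbert_space. c *\<^sub>C x)"
  by (rule bounded_linear_intro[where K = "cmod c"])
    (simp_all add: scaleC_add_right scaleR_eq_scaleC scaleC_scaleC norm_scaleC mult.commute)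

typedef (overloaded) 'a bop =
  "{T :: 'a::hilbert_space \<Rightarrow>\<^sub>L 'a. \<forall>c x. blinfun_apply T (c *\<^sub>C x) = c *\<^sub>C blinfun_apply T x}"
  morphisms blinfun_of Bop
proof
  show "0 \<in> {T :: 'a \<Rightarrow>\<^sub>L 'a. \<forall>c x. blinfun_apply T (c *\<^sub>C x) = c *\<^sub>C blinfun_apply T x}"
    by (simp add: linear_0[OF bounded_linear.linear[OF bounded_linear_scaleC]])
qed

setup_lifting type_definition_bop

lift_definition bop_apply :: "'a::hilbert_space bop \<Rightarrow> 'a \<Rightarrow> 'a" is blinfun_apply .

instantiation bop :: (hilbert_space) real_normed_vector
begin

lift_definition zero_bop :: "'a bop" is 0
  by (simp add: linear_0[OF bounded_linear.linear[OF bounded_linear_scaleC]])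

lift_definition plus_bop :: "'a bop \<Rightarrow> 'a bop \<Rightarrow> 'a bop" is "(+)"
  by (simp add: blinfun.add_left scaleC_add_right)

lift_definition uminus_bop :: "'a bop \<Rightarrow> 'a bop" is uminus
  by (simp add: blinfun.minus_left linear_neg[OF bounded_linear.linear[OF bounded_linear_scaleC]])

lift_definition minus_bop :: "'a bop \<Rightarrow> 'a bop \<Rightarrow> 'a bop" is "(-)"
  by (simp add: blinfun.diff_left linear_diff[OF bounded_linear.linear[OF bounded_linear_scaleC]])

lift_definition scaleR_bop :: "real \<Rightarrow> 'a bop \<Rightarrow> 'a bop" is "scaleR"
  by (simp add: blinfun.scaleR_left scaleR_eq_scaleC scaleC_scaleC mult.commute)

lift_definition norm_bop :: "'a bop \<Rightarrow> real" is norm .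

definition dist_bop :: "'a bop \<Rightarrow> 'a bop \<Rightarrow> real"
  where "dist_bop S T = norm (S - T)"

definition uniformity_bop :: "('a bop \<times> 'a bop) filter"
  where "uniformity_bop = (INF e\<in>{0<..}. principal {(S, T). dist S T < e})"

definition open_bop :: "'a bop set \<Rightarrow> bool"
  where "open_bop U \<longleftrightarrow> (\<forall>S\<in>U. eventually (\<lambda>(S', T). S' = S \<longrightarrow> T \<in> U) uniformity)"

definition sgn_bop :: "'a bop \<Rightarrow> 'a bop"
  where "sgn_bop T = inverse (norm T) *\<^sub>R T"

instance
proof
  fix a b :: real and S T U :: "'a bop"
  show "dist S T = norm (S - T)"
    by (rule dist_bop_def)
  show "(uniformity :: ('a bop \<times> 'a bop) filter) =
      (INF e\<in>{0<..}. principal {(S, T). dist S T < e})"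
    by (rule uniformity_bop_def)
  show "open V \<longleftrightarrow> (\<forall>S\<in>V. \<forall>\<^sub>F (S', T) in uniformity. S' = S \<longrightarrow> T \<in> V)" for V :: "'a bop set"
    by (rule open_bop_def)
  show "sgn S = inverse (norm S) *\<^sub>R S"
    by (rule sgn_bop_def)
  show "S + T + U = S + (T + U)" by transfer (rule add.assoc)
  show "S + T = T + S" by transfer (rule add.commute)
  show "0 + S = S" by transfer simp
  show "- S + S = 0" by transfer simp
  show "S - T = S + - T" by transfer simp
  show "a *\<^sub>R (S + T) = a *\<^sub>R S + a *\<^sub>R T" by transfer (rule scaleR_add_right)
  show "(a + b) *\<^sub>R S = a *\<^sub>R S + b *\<^sub>R S" by transfer (rule scaleR_add_left)
  show "a *\<^sub>R b *\<^sub>R S = (a * b) *\<^sub>R S" by transfer simp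
  show "1 *\<^sub>R S = S" by transfer simp
  show "norm S = 0 \<longleftrightarrow> S = 0" by transfer simp
  show "norm (S + T) \<le> norm S + norm T" by transfer (rule norm_triangle_ineq)
  show "norm (a *\<^sub>R S) = \<bar>a\<bar> * norm S" by transfer simp
qed

end

instantiation bop :: (hilbert_space) real_normed_algebra
begin

lift_definition times_bop :: "'a bop \<Rightarrow> 'a bop \<Rightarrow> 'a bop" is "(o\<^sub>L)"
  by simp

instance
proof
  fix a :: real and S T U :: "'a bop"
  show "S * T * U = S * (T * U)" by transfer (simp add: blinfun_eqI)
  show "(S + T) * U = S * U + T * U" by transfer (simp add: blinfun_eqI blinfun.add_left)
  show "S * (T + U) = S * T + S * U"
    by transfer (simp add: blinfun_eqI blinfun.add_left blinfun.add_right)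
  show "a *\<^sub>R S * T = a *\<^sub>R (S * T)" by transfer (simp add: blinfun_eqI blinfun.scaleR_left)
  show "S * a *\<^sub>R T = a *\<^sub>R (S * T)"
    by transfer (simp add: blinfun_eqI blinfun.scaleR_left blinfun.scaleR_right)
  show "norm (S * T) \<le> norm S * norm T" by transfer (rule norm_blinfun_compose)
qed

end

instantiation bop :: (hilbert_space) monoid_mult
begin

lift_definition one_bop :: "'a bop" is id_blinfun
  by simp

instance
proof
  fix T :: "'a bop"
  show "1 * T = T" by transfer (simp add: blinfun_eqI)
  show "T * 1 = T" by transfer (simp add: blinfun_eqI)
qed

end

class complex_algebra = ring + scaleC +
  assumes scaleC_distrib_right: "c *\<^sub>C (x + y) = c *\<^sub>C x + c *\<^sub>C y"
    and scaleC_distrib_left: "(c + d) *\<^sub>C x = c *\<^sub>C x + d *\<^sub>C x"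
    and scaleC_assoc: "c *\<^sub>C d *\<^sub>C x = (c * d) *\<^sub>C x"
    and scaleC_unit: "1 *\<^sub>C x = x"
    and mult_scaleC_left: "(c *\<^sub>C x) * y = c *\<^sub>C (x * y)"
    and mult_scaleC_right: "x * (c *\<^sub>C y) = c *\<^sub>C (x * y)"

instantiation bop :: (hilbert_space) complex_algebra
begin

lift_definition scaleC_bop :: "complex \<Rightarrow> 'a bop \<Rightarrow> 'a bop"
  is "\<lambda>c T. Blinfun ((*\<^sub>C) c) o\<^sub>L T"
  by (simp add: bounded_linear_Blinfun_apply bounded_linear_scaleC scaleC_scaleC mult.commute)

instance
proof -
  have [simp]: "blinfun_apply (Blinfun ((*\<^sub>C) c)) x = c *\<^sub>C x" for c and x :: 'a
    by (simp add: bounded_linear_Blinfun_apply bounded_linear_scaleC)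
  have [simp]: "1 *\<^sub>C x = x" for x :: 'a
    using scaleR_eq_scaleC[of 1 x] by simp
  show "OFCLASS('a bop, complex_algebra_class)"
  proof
    fix c d :: complex and S T :: "'a bop"
    show "c *\<^sub>C (S + T) = c *\<^sub>C S + c *\<^sub>C T"
      by transfer (rule blinfun_eqI, simp add: blinfun.add_left scaleC_add_right)
    show "(c + d) *\<^sub>C S = c *\<^sub>C S + d *\<^sub>C S"
      by transfer (rule blinfun_eqI, simp add: blinfun.add_left scaleC_add_left)
    show "c *\<^sub>C d *\<^sub>C S = (c * d) *\<^sub>C S"
      by transfer (rule blinfun_eqI, simp add: scaleC_scaleC)
    show "1 *\<^sub>C S = S" by transfer (rule blinfun_eqI, simp)
    show "(c *\<^sub>C S) * T = c *\<^sub>C (S * T)" by transfer (rule blinfun_eqI, simp)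
    show "S * (c *\<^sub>C T) = c *\<^sub>C (S * T)" by transfer (rule blinfun_eqI, simp)
  qed
qed

end

instantiation bop :: (hilbert_space) star
begin

definition star_bop :: "'a bop \<Rightarrow> 'a bop" where
  "star_bop T = (THE S. \<forall>x y. cinner (bop_apply T x) y = cinner x (bop_apply S y))"

instance ..

end

instantiation complex :: star
begin

definition star_complex :: "complex \<Rightarrow> complex" where
  "star_complex = cnj"

instance ..

end

instantiation mat :: (star) star
begin

definition star_mat :: "'a mat \<Rightarrow> 'a mat" where
  "star_mat M = mat (dim_col M) (dim_row M) (\<lambda>(i, j). star (M $$ (j, i)))"

instance ..

end

definition is_projection :: "'a::{times, star} \<Rightarrow> bool" where
  "is_projection p \<longleftrightarrow> p * p = p \<and> star p = p"

definition proj_onto :: "'a::hilbert_space set \<Rightarrow> 'a bop" where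
  "proj_onto M = (THE p. is_projection p \<and> range (bop_apply p) = M)"

definition null_proj :: "'a::hilbert_space bop \<Rightarrow> 'a bop" where
  "null_proj S = proj_onto {x. bop_apply S x = 0}"

definition proj_meet :: "'a::hilbert_space bop \<Rightarrow> 'a bop \<Rightarrow> 'a bop"  (infixl "\<sqinter>\<^sub>p" 70) where
  "p \<sqinter>\<^sub>p q = proj_onto (range (bop_apply p) \<inter> range (bop_apply q))"


section \<open>The spectral projection of the half-line\<close>

text \<open>\<^term>\<open>E\<close> is the compactly supported projection-valued Borel measure on the line with
  \<open>B = \<integral> \<lambda> dE(\<lambda>)\<close>; the scalar measure \<open>\<langle>x, E(\<cdot>) x\<rangle>\<close> equals \<open>\<parallel>E(\<cdot>) x\<parallel>\<^sup>2\<close>.\<close>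

definition is_spectral_measure :: "'a::hilbert_space bop \<Rightarrow> (real set \<Rightarrow> 'a bop) \<Rightarrow> bool" where
  "is_spectral_measure B E \<longleftrightarrow>
     (\<forall>S\<in>sets borel. is_projection (E S)) \<and>
     E UNIV = 1 \<and>
     (\<forall>S\<in>sets borel. \<forall>T\<in>sets borel. E (S \<inter> T) = E S * E T) \<and>
     (\<forall>A :: nat \<Rightarrow> real set. range A \<subseteq> sets borel \<longrightarrow> disjoint_family A \<longrightarrow>
        (\<forall>x. (\<lambda>n. bop_apply (E (A n)) x) sums bop_apply (E (\<Union>n. A n)) x)) \<and>
     (\<exists>M. E {-M..M} = 1) \<and>
     (\<forall>x. cinner x (bop_apply B x) = complex_of_real
        (integral\<^sup>L (measure_of UNIV (sets borel) (\<lambda>S. ennreal ((norm (bop_apply (E S) x))\<^sup>2)))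
           (\<lambda>l. l)))"

definition spectral_projection :: "'a::hilbert_space bop \<Rightarrow> real set \<Rightarrow> 'a bop" where
  "spectral_projection B S = (THE P. \<exists>E. is_spectral_measure B E \<and> P = E S)"

definition chi :: "'a::hilbert_space bop \<Rightarrow> 'a bop" where
  "chi B = spectral_projection B {0..}"


section \<open>Von Neumann algebras and quotients by norm closed ideals\<close>

definition commutant :: "'a::hilbert_space bop set \<Rightarrow> 'a bop set" where
  "commutant S = {T. \<forall>X\<in>S. T * X = X * T}"

definition von_neumann_algebra :: "'a::hilbert_space bop set \<Rightarrow> bool" where
  "von_neumann_algebra N \<longleftrightarrow> (\<forall>T\<in>N. star T \<in> N) \<and> commutant (commutant N) = N"

definition op_ring :: "'a::hilbert_space bop set \<Rightarrow> 'a bop ring" where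
  "op_ring N = \<lparr>carrier = N, monoid.mult = (*), one = 1, ring.zero = 0, add = (+)\<rparr>"

definition quot_map :: "'a::hilbert_space bop set \<Rightarrow> 'a bop set \<Rightarrow> 'a bop \<Rightarrow> 'a bop set" where
  "quot_map N J T = J +>\<^bsub>op_ring N\<^esub> T"

definition quot_norm :: "'a::hilbert_space bop set \<Rightarrow> real" where
  "quot_norm X = Inf (norm ` X)"

definition quot_dist ::
  "'a::hilbert_space bop set \<Rightarrow> 'a bop set \<Rightarrow> 'a bop \<Rightarrow> 'a bop \<Rightarrow> real" where
  "quot_dist N J S T =
     quot_norm (quot_map N J S \<ominus>\<^bsub>op_ring N Quot J\<^esub> quot_map N J T)"

definition J_fredholm :: "'a::hilbert_space bop set \<Rightarrow> 'a bop set \<Rightarrow> 'a bop \<Rightarrow> bool" where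
  "J_fredholm N J T \<longleftrightarrow> T \<in> N \<and> quot_map N J T \<in> Units (op_ring N Quot J)"

definition corner :: "'a::hilbert_space bop set \<Rightarrow> 'a bop \<Rightarrow> 'a bop \<Rightarrow> 'a bop set" where
  "corner N q p = {q * T * p |T. T \<in> N}"

definition fredholm ::
  "'a::hilbert_space bop set \<Rightarrow> 'a bop set \<Rightarrow> 'a bop \<Rightarrow> 'a bop \<Rightarrow> 'a bop \<Rightarrow> bool" where
  "fredholm N J q p S \<longleftrightarrow> S \<in> corner N q p \<and>
     (\<exists>T\<in>corner N p q. quot_map N J (T * S) = quot_map N J p \<and>
                       quot_map N J (S * T) = quot_map N J q)"


section \<open>The group K0 of an ideal\<close>

text \<open>The unitization with an adjoined unit: the pair \<open>Unitize a c\<close> stands for \<open>a + c 1\<close>, where \<open>1\<close>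
  is a new unit even if the given algebra already has one.\<close>

datatype 'b unitization = Unitize (alg_part: 'b) (scalar_part: complex)

instantiation unitization :: (complex_algebra) ring
begin

definition zero_unitization :: "'a unitization" where
  "zero_unitization = Unitize 0 0"

definition plus_unitization :: "'a unitization \<Rightarrow> 'a unitization \<Rightarrow> 'a unitization" where
  "plus_unitization x y = Unitize (alg_part x + alg_part y) (scalar_part x + scalar_part y)"

definition uminus_unitization :: "'a unitization \<Rightarrow> 'a unitization" where
  "uminus_unitization x = Unitize (- alg_part x) (- scalar_part x)"

definition minus_unitization :: "'a unitization \<Rightarrow> 'a unitization \<Rightarrow> 'a unitization" where
  "minus_unitization x y = Unitize (alg_part x - alg_part y) (scalar_part x - scalar_part y)"

definition times_unitization :: "'a unitization \<Rightarrow> 'a unitization \<Rightarrow> 'a unitization" where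
  "times_unitization x y =
     Unitize (alg_part x * alg_part y + scalar_part x *\<^sub>C alg_part y + scalar_part y *\<^sub>C alg_part x)
             (scalar_part x * scalar_part y)"

instance
  by standard
    (simp_all add: zero_unitization_def plus_unitization_def uminus_unitization_def
      minus_unitization_def times_unitization_def algebra_simps scaleC_distrib_right
      scaleC_distrib_left scaleC_assoc mult_scaleC_left mult_scaleC_right)

end

instantiation unitization :: (star) star
begin

definition star_unitization :: "'a unitization \<Rightarrow> 'a unitization" where
  "star_unitization x = Unitize (star (alg_part x)) (cnj (scalar_part x))"

instance ..

end

definition unitize :: "'b set \<Rightarrow> 'b unitization set" where
  "unitize J = {x. alg_part x \<in> J}"

definition mats_over :: "'b set \<Rightarrow> nat \<Rightarrow> nat \<Rightarrow> 'b mat set" where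
  "mats_over A m n = {M \<in> carrier_mat m n. elements_mat M \<subseteq> A}"

definition mat_projections :: "'b::{ring, star} set \<Rightarrow> 'b mat set" where
  "mat_projections A = {e. (\<exists>n. e \<in> mats_over A n n) \<and> is_projection e}"

definition mvn_equiv :: "'b::{ring, star} set \<Rightarrow> 'b mat \<Rightarrow> 'b mat \<Rightarrow> bool" where
  "mvn_equiv A e f \<longleftrightarrow>
     (\<exists>v\<in>mats_over A (dim_row f) (dim_row e). star v * v = e \<and> v * star v = f)"

definition mat_dsum :: "'b::zero mat \<Rightarrow> 'b mat \<Rightarrow> 'b mat"  (infixl "\<oplus>\<^sub>m" 65) where
  "e \<oplus>\<^sub>m f = four_block_mat e (0\<^sub>m (dim_row e) (dim_col f)) (0\<^sub>m (dim_row f) (dim_col e)) f"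

text \<open>A pair \<open>(e, f)\<close> stands for the formal difference \<open>[e] - [f]\<close>. The group is written
  multiplicatively, following the group theory of the library.\<close>

definition K00_rel :: "'b::{ring, star} set \<Rightarrow> (('b mat \<times> 'b mat) \<times> ('b mat \<times> 'b mat)) set" where
  "K00_rel A = {((e, f), (e', f')).
     e \<in> mat_projections A \<and> f \<in> mat_projections A \<and>
     e' \<in> mat_projections A \<and> f' \<in> mat_projections A \<and>
     (\<exists>g\<in>mat_projections A. mvn_equiv A (e \<oplus>\<^sub>m f' \<oplus>\<^sub>m g) (e' \<oplus>\<^sub>m f \<oplus>\<^sub>m g))}"

definition K00 :: "'b::{ring, star} set \<Rightarrow> ('b mat \<times> 'b mat) set monoid" where
  "K00 A = \<lparr>carrier = (mat_projections A \<times> mat_projections A) // K00_rel A,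
            monoid.mult = (\<lambda>X Y. \<Union>(e, f)\<in>X. \<Union>(e', f')\<in>Y. K00_rel A `` {(e \<oplus>\<^sub>m e', f \<oplus>\<^sub>m f')}),
            one = K00_rel A `` {(0\<^sub>m 0 0, 0\<^sub>m 0 0)}\<rparr>"

definition K00_map ::
  "'c::{ring, star} set \<Rightarrow> ('b \<Rightarrow> 'c) \<Rightarrow> ('b mat \<times> 'b mat) set \<Rightarrow> ('c mat \<times> 'c mat) set" where
  "K00_map A h X = (\<Union>(e, f)\<in>X. K00_rel A `` {(map_mat h e, map_mat h f)})"

definition K0 ::
  "'b::{complex_algebra, star} set \<Rightarrow> ('b unitization mat \<times> 'b unitization mat) set monoid" where
  "K0 J = (K00 (unitize J))
     \<lparr>carrier := kernel (K00 (unitize J)) (K00 (UNIV :: complex set)) (K00_map UNIV scalar_part)\<rparr>"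

definition K0_class ::
  "'b::{complex_algebra, star} set \<Rightarrow> 'b \<Rightarrow> ('b unitization mat \<times> 'b unitization mat) set" where
  "K0_class J p = K00_rel (unitize J) `` {(mat 1 1 (\<lambda>_. Unitize p 0), 0\<^sub>m 0 0)}"

definition K0_diff ::
  "'b::{complex_algebra, star} set \<Rightarrow> 'b \<Rightarrow> 'b \<Rightarrow> ('b unitization mat \<times> 'b unitization mat) set" where
  "K0_diff J p q = K0_class J p \<otimes>\<^bsub>K0 J\<^esub> inv\<^bsub>K0 J\<^esub> K0_class J q"


section \<open>Index and spectral flow\<close>

definition Ind ::
  "'a::hilbert_space bop set \<Rightarrow> 'a bop set \<Rightarrow> 'a bop \<Rightarrow> 'a bop \<Rightarrow> 'a bop \<Rightarrow>
     ('a bop unitization mat \<times> 'a bop unitization mat) set" where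
  "Ind N J q p S =
     (if fredholm N J q p S
      then K0_diff J (null_proj S \<sqinter>\<^sub>p p) (null_proj (star S) \<sqinter>\<^sub>p q)
      else undefined)"

definition fredholm_path ::
  "'a::hilbert_space bop set \<Rightarrow> 'a bop set \<Rightarrow> (real \<Rightarrow> 'a bop) \<Rightarrow> bool" where
  "fredholm_path N J B \<longleftrightarrow> continuous_on {0..1} B \<and>
     (\<forall>s\<in>{0..1}. star (B s) = B s \<and> J_fredholm N J (B s))"

definition sf_partition ::
  "'a::hilbert_space bop set \<Rightarrow> 'a bop set \<Rightarrow> (real \<Rightarrow> 'a bop) \<Rightarrow> nat \<Rightarrow> (nat \<Rightarrow> real) \<Rightarrow> bool" where
  "sf_partition N J B n t \<longleftrightarrow> t 0 = 0 \<and> t n = 1 \<and> (\<forall>i\<in>{1..n}. t (i - 1) < t i) \<and>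
     (\<forall>i\<in>{1..n}. \<forall>s\<in>{t (i - 1)..t i}. \<forall>s'\<in>{t (i - 1)..t i}.
        quot_dist N J (chi (B s)) (chi (B s')) < 1/2)"

definition sf ::
  "'a::hilbert_space bop set \<Rightarrow> (real \<Rightarrow> 'a bop) \<Rightarrow> nat \<Rightarrow> (nat \<Rightarrow> real) \<Rightarrow>
     ('a bop unitization mat \<times> 'a bop unitization mat) set" where
  "sf J B n t = (\<Otimes>\<^bsub>K0 J\<^esub>i\<in>{1..n}.
     K0_diff J ((1 - chi (B (t i))) \<sqinter>\<^sub>p chi (B (t (i - 1))))
               ((1 - chi (B (t (i - 1)))) \<sqinter>\<^sub>p chi (B (t i))))"

end

theory Submission
  imports Defs
begin

text \<open>Cut the range of \<open>p\<close> by a spectral projection in \<open>J\<close>, leaving \<open>p\<^sub>1 \<le> p\<close> with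
  \<open>\<parallel>(1 - q) p\<^sub>1\<parallel> < 1/2\<close> and \<open>\<parallel>(1 - r) p\<^sub>1\<parallel> < 1/2\<close> in norm, not only modulo \<open>J\<close>. Then \<open>q\<close> and \<open>r\<close> map
  the range of \<open>p\<^sub>1\<close> isomorphically onto closed subspaces with projections \<open>q\<^sub>1 \<le> q\<close> and \<open>r\<^sub>1 \<le> r\<close>; the
  differences \<open>q - q\<^sub>1\<close> and \<open>r - r\<^sub>1\<close> lie in \<open>J\<close>, and also \<open>r\<^sub>1 q\<^sub>1\<close> is invertible from \<open>q\<^sub>1\<close> to \<open>r\<^sub>1\<close>. For each
  of the three pairs a Schur complement and polar decomposition give
  \<open>Ind(q p) = [p - p\<^sub>1] - [q - q\<^sub>1]\<close>, and these expressions telescope.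

  The spectral flow is a sum of such indices. The spectral projection \<open>\<chi>(B)\<close> is the projection onto
  the kernel of \<open>|B| - B\<close>, by the spectral theorem; in particular it lies in \<open>N\<close>. Additivity of the
  index makes the partial sums along one partition into a function on \<open>[0, 1]\<close> whose increments over
  the cells of any other partition are again indices.\<close>

section \<open>Bounded operators and adjoints\<close>

text \<open>The hypotheses are bounds in \<open>N/J\<close>, while a Neumann series needs a bound in
  norm on an actual subspace; this forces the cut of \<open>p\<close>. The constant 1/2 is used
  where two near-identities are composed: the errors of \<open>q\<close> and \<open>r\<close> on the
  range of \<open>p1\<close> together stay below one, so \<open>r1 * q1\<close> is invertible
  without a second cut. An operator invertible modulo \<open>J\<close> may have a range that is not
  closed, so its kernel and cokernel cannot be compared through a bounded inverse on complements.
  Polar decomposition takes that place: it gives equivalent support projections inside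
  \<open>N\<close> whether or not ranges are closed. The classes live over the unitization of
  \<open>J\<close>, so every equivalence must be implemented by an element of \<open>J\<close>
  itself and not merely of \<open>N\<close>. Since \<open>chi\<close> is a definite description over
  all spectral measures, identifying it takes both the construction of one such measure and a proof
  that all of them agree on \<open>{0..}\<close>. Both rest on square roots and strong limits of
  powers, with no functional calculus.\<close>

notation bop_apply (infixr "\<cdot>" 75)

lemma bop_eqI: "(\<And>x. S \<cdot> x = T \<cdot> x) \<Longrightarrow> S = T"
  by transfer (rule blinfun_eqI)

lemma bop_apply_simps [simp]:
  "0 \<cdot> x = 0" "1 \<cdot> x = x" "(S + T) \<cdot> x = S \<cdot> x + T \<cdot> x" "(S - T) \<cdot> x = S \<cdot> x - T \<cdot> x"
  "(- T) \<cdot> x = - (T \<cdot> x)" "(a *\<^sub>R T) \<cdot> x = a *\<^sub>R (T \<cdot> x)" "(S * T) \<cdot> x = S \<cdot> T \<cdot> x"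
  by (transfer, simp add: blinfun.add_left blinfun.diff_left blinfun.minus_left blinfun.scaleR_left)+

lemma bop_apply_sum [simp]: "(\<Sum>i\<in>I. T i) \<cdot> x = (\<Sum>i\<in>I. T i \<cdot> x)"
  by (induction I rule: infinite_finite_induct) auto

lemma bounded_linear_bop: "bounded_linear (bop_apply T)"
  by transfer (rule blinfun.bounded_linear_right)

lemmas bop_linear = bounded_linear.linear[OF bounded_linear_bop]
lemmas bop_apply_right [simp] =
  linear_0[OF bop_linear] linear_add[OF bop_linear] linear_diff[OF bop_linear]
  linear_neg[OF bop_linear] linear_scale[OF bop_linear]

lemma bop_apply_scaleC: "T \<cdot> (c *\<^sub>C x) = c *\<^sub>C (T \<cdot> x)"
  by transfer simp

lemma tendsto_bop [tendsto_intros]: "(f \<longlongrightarrow> l) F \<Longrightarrow> ((\<lambda>n. T \<cdot> f n) \<longlongrightarrow> T \<cdot> l) F"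
  by (rule bounded_linear.tendsto[OF bounded_linear_bop])

lemma norm_bop_apply: "norm (T \<cdot> x) \<le> norm T * norm x"
  by transfer (rule norm_blinfun)

lemma norm_bop_le: "0 \<le> b \<Longrightarrow> (\<And>x. norm (T \<cdot> x) \<le> b * norm x) \<Longrightarrow> norm T \<le> b"
  by transfer (rule norm_blinfun_bound)

lemma bop_exists:
  fixes f :: "'a::hilbert_space \<Rightarrow> 'a"
  assumes "bounded_linear f" "\<And>c x. f (c *\<^sub>C x) = c *\<^sub>C f x"
  obtains T where "\<And>x. T \<cdot> x = f x"
proof
  show "Bop (Blinfun f) \<cdot> x = f x" for x
    using assms by (simp add: bop_apply.rep_eq Bop_inverse bounded_linear_Blinfun_apply)
qed

lemma norm_bop_one: "norm (1 :: 'a::hilbert_space bop) \<le> 1"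
  by (rule norm_bop_le) auto

lemma norm_bop_power: "norm (T ^ n) \<le> norm (T :: 'a::hilbert_space bop) ^ n"
proof (induction n)
  case (Suc n)
  have "norm (T ^ Suc n) \<le> norm T * norm (T ^ n)"
    by (simp add: norm_mult_ineq)
  also have "\<dots> \<le> norm T * norm T ^ n"
    using Suc by (simp add: mult_left_mono)
  finally show ?case by simp
qed (simp add: norm_bop_one)

instance hilbert_space \<subseteq> banach ..

text \<open>Complex linearity is preserved by pointwise limits, so the complex-linear operators are
  closed among the bounded real-linear ones and inherit their completeness.\<close>

instance bop :: (hilbert_space) banach
proof
  fix X :: "nat \<Rightarrow> 'a bop"
  assume X: "Cauchy X"
  have n: "norm (blinfun_of S - blinfun_of T) = norm (S - T)" for S T :: "'a bop"
    by (simp add: norm_bop.rep_eq minus_bop.rep_eq)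
  have "Cauchy (\<lambda>n. blinfun_of (X n))"
    using X unfolding Cauchy_def dist_norm n .
  then have "convergent (\<lambda>n. blinfun_of (X n))"
    by (rule Cauchy_convergent)
  then obtain L where L: "(\<lambda>n. blinfun_of (X n)) \<longlonglongrightarrow> L"
    by (auto simp: convergent_def)
  have pt: "(\<lambda>n. blinfun_apply (blinfun_of (X n)) x) \<longlonglongrightarrow> blinfun_apply L x" for x
    by (intro tendsto_intros L)
  have "blinfun_apply L (c *\<^sub>C x) = c *\<^sub>C blinfun_apply L x" for c x
  proof (rule LIMSEQ_unique)
    show "(\<lambda>n. blinfun_apply (blinfun_of (X n)) (c *\<^sub>C x)) \<longlonglongrightarrow> blinfun_apply L (c *\<^sub>C x)"
      by (rule pt)
    show "(\<lambda>n. blinfun_apply (blinfun_of (X n)) (c *\<^sub>C x)) \<longlonglongrightarrow> c *\<^sub>C blinfun_apply L x"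
      using bounded_linear.tendsto[OF bounded_linear_scaleC pt]
      by (simp add: bop_apply_scaleC flip: bop_apply.rep_eq)
  qed
  then have BL: "blinfun_of (Bop L) = L"
    by (simp add: Bop_inverse)
  have "(\<lambda>n. norm (blinfun_of (X n) - blinfun_of (Bop L))) \<longlonglongrightarrow> 0"
    unfolding BL by (intro tendsto_norm_zero LIM_zero L)
  then have "(\<lambda>n. norm (X n - Bop L)) \<longlonglongrightarrow> 0"
    unfolding n .
  then have "(\<lambda>n. X n - Bop L) \<longlonglongrightarrow> 0"
    by (rule tendsto_norm_zero_cancel)
  then have "X \<longlonglongrightarrow> Bop L"
    by (rule LIM_zero_cancel)
  then show "convergent X"
    by (auto simp: convergent_def)
qed

text \<open>The representing vector minimises \<open>g x = inner x x - 2 * f x\<close>. The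
  parallelogram identity behind \<open>mid\<close> makes a minimising sequence Cauchy, and at the
  minimum the variation along every \<open>x\<close> vanishes.\<close>

lemma riesz_representation:
  fixes f :: "'a::{real_inner, complete_space} \<Rightarrow> real"
  assumes "bounded_linear f"
  obtains z where "\<And>x. f x = inner z x"
proof -
  interpret bounded_linear f by fact
  obtain K where K: "\<And>x. norm (f x) \<le> norm x * K"
    using bounded by blast
  define g where "g x = inner x x - 2 * f x" for x
  have lower: "g x \<ge> - K\<^sup>2" for x
  proof -
    have "f x \<le> norm x * K"
      using K[of x] by simp
    then have "g x \<ge> (norm x)\<^sup>2 - 2 * (norm x * K)"
      by (simp add: g_def power2_norm_eq_inner)
    also have "(norm x)\<^sup>2 - 2 * (norm x * K) = (norm x - K)\<^sup>2 - K\<^sup>2"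
      by (simp add: power2_diff)
    finally show ?thesis
      by (smt (verit) zero_le_power2)
  qed
  define m where "m = Inf (range g)"
  have bdd: "bdd_below (range g)"
    using lower by (intro bdd_belowI2[of UNIV "- K\<^sup>2"]) auto
  have m: "m \<le> g x" for x
    unfolding m_def by (intro cInf_lower bdd) auto
  have "\<exists>x. g x < m + 1 / real (Suc n)" for n
  proof -
    have "Inf (range g) < m + 1 / real (Suc n)"
      by (simp add: m_def)
    then show ?thesis
      by (subst (asm) cInf_less_iff) (use bdd in auto)
  qed
  then obtain X where X: "\<And>n. g (X n) < m + 1 / real (Suc n)"
    by metis
  have mid: "(norm (x - y))\<^sup>2 \<le> 2 * (g x - m) + 2 * (g y - m)" for x y
  proof -
    have "(norm (x - y))\<^sup>2 = 2 * g x + 2 * g y - 4 * g ((1/2) *\<^sub>R (x + y))"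
      unfolding g_def power2_norm_eq_inner
      by (simp add: add scaleR inner_add_left inner_add_right inner_diff_left inner_diff_right
          inner_commute[of y x] field_simps)
    moreover have "4 * m \<le> 4 * g ((1/2) *\<^sub>R (x + y))"
      using m by simp
    ultimately show ?thesis
      by (simp add: right_diff_distrib)
  qed
  have "Cauchy X"
  proof (rule metric_CauchyI)
    fix e :: real assume e: "e > 0"
    obtain M where M: "inverse (real (Suc M)) < e\<^sup>2 / 4"
      using reals_Archimedean[of "e\<^sup>2 / 4"] e by auto
    have gM: "g (X k) - m < e\<^sup>2 / 4" if "k \<ge> M" for k
    proof -
      have "1 / real (Suc k) \<le> inverse (real (Suc M))"
        using that by (simp add: field_simps)
      then show ?thesis
        using X[of k] M by linarith
    qed
    show "\<exists>M. \<forall>m\<ge>M. \<forall>n\<ge>M. dist (X m) (X n) < e"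
    proof (intro exI allI impI)
      fix i j assume ij: "i \<ge> M" "j \<ge> M"
      have "(norm (X i - X j))\<^sup>2 < e\<^sup>2"
        using mid[of "X i" "X j"] gM[OF ij(1)] gM[OF ij(2)] by simp
      then show "dist (X i) (X j) < e"
        using e by (simp add: dist_norm power_less_imp_less_base)
    qed
  qed
  then obtain z where z: "X \<longlonglongrightarrow> z"
    using Cauchy_convergent by (auto simp: convergent_def)
  have "(\<lambda>n. g (X n)) \<longlonglongrightarrow> g z"
    unfolding g_def by (intro tendsto_intros z tendsto)
  moreover have "(\<lambda>n. m + 1 / real (Suc n)) \<longlonglongrightarrow> m + 0"
    by (intro tendsto_intros LIMSEQ_Suc[OF lim_1_over_n])
  ultimately have gz: "g z \<le> m"
    using LIMSEQ_le[of "\<lambda>n. g (X n)" "g z" "\<lambda>n. m + 1 / real (Suc n)" "m + 0"] X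
    by (auto intro: less_imp_le)
  have "f x = inner z x" for x
  proof (rule ccontr)
    assume ne: "f x \<noteq> inner z x"
    \<comment> \<open>\<open>t\<close> is a near-optimal step along \<open>x\<close>. The
      \<open>+ 1\<close> in \<open>n\<close> avoids a division by zero and still leaves a strict
      decrease of \<open>g\<close> whenever \<open>d\<close> is nonzero.\<close>
    define d n t where "d = inner z x - f x" and "n = inner x x + 1" and "t = - d / n"
    have n: "n > 0" "n \<ge> 1"
      by (auto simp: n_def add_nonneg_pos)
    have "g (z + t *\<^sub>R x) = g z + 2 * t * d + t\<^sup>2 * (n - 1)"
      by (simp add: g_def d_def n_def add scaleR inner_add_left inner_add_right
          inner_commute[of x z] power2_eq_square algebra_simps)
    then have "0 \<le> 2 * t * d + t\<^sup>2 * (n - 1)"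
      using gz m[of "z + t *\<^sub>R x"] by linarith
    also have "2 * t * d + t\<^sup>2 * (n - 1) = - (d\<^sup>2 * (n + 1) / n\<^sup>2)"
      using n by (simp add: t_def field_simps power2_eq_square)
    finally have "d\<^sup>2 * (n + 1) / n\<^sup>2 \<le> 0"
      by simp
    moreover have "d\<^sup>2 * (n + 1) / n\<^sup>2 > 0"
      using ne n by (simp add: d_def)
    ultimately show False by simp
  qed
  then show ?thesis
    using that by blast
qed

section \<open>Adjoints\<close>

lemma inner_scaleC_right: "inner x (c *\<^sub>C y) = inner (cnj c *\<^sub>C x) (y :: 'a::hilbert_space)"
  by (simp add: inner_eq_Re_cinner cinner_scaleC_left cinner_scaleC_right)

text \<open>The complex inner product is recovered from the real one, so that adjoints, projections
  and limits can be treated with \<open>inner\<close> alone.\<close>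

lemma cinner_eq_Complex: "cinner x y = Complex (inner x y) (inner (\<i> *\<^sub>C x) y)"
  by (simp add: complex_eq_iff inner_eq_Re_cinner cinner_scaleC_left)

lemma cinner_eqI:
  assumes "\<And>x y. inner (T \<cdot> x) y = inner x (S \<cdot> y)"
  shows "cinner (T \<cdot> x) y = cinner x (S \<cdot> y)"
  using assms by (simp add: cinner_eq_Complex flip: bop_apply_scaleC)

lemma inner_eq_rightI:
  assumes "\<And>x. inner x y = inner x z"
  shows "y = z"
proof -
  have "inner (y - z) (y - z) = 0"
    using assms[of "y - z"] by (simp add: inner_diff_right)
  then show "y = z" by simp
qed

text \<open>Riesz represents the functional \<open>inner (T \<cdot> x) y\<close> of \<open>x\<close>
  for each fixed \<open>y\<close>. The bound on \<open>s\<close> comes from inserting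
  \<open>s x\<close> as test vector and cancelling one factor \<open>norm (s x)\<close>.\<close>

lemma adjoint_exists:
  fixes T :: "'a::hilbert_space bop"
  obtains S where "\<And>x y. inner (T \<cdot> x) y = inner x (S \<cdot> y)"
proof -
  have "\<exists>z. \<forall>x. inner (T \<cdot> x) y = inner x z" for y
  proof -
    have "bounded_linear (\<lambda>x. inner (T \<cdot> x) y)"
      using bounded_linear_compose[OF bounded_linear_inner_left bounded_linear_bop] .
    then show ?thesis
      by (metis riesz_representation inner_commute)
  qed
  then obtain s where s: "\<And>x y. inner (T \<cdot> x) y = inner x (s y)"
    by metis
  have "bounded_linear s"
  proof (rule bounded_linear_intro[where K = "norm T"])
    show "s (x + y) = s x + s y" for x y
      by (rule inner_eq_rightI) (simp add: inner_add_right flip: s)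
    show "s (r *\<^sub>R x) = r *\<^sub>R s x" for r x
      by (rule inner_eq_rightI) (simp flip: s)
    fix x
    have "norm (s x) * norm (s x) = inner (T \<cdot> s x) x"
      by (simp add: s power2_norm_eq_inner[symmetric] power2_eq_square)
    also have "\<dots> \<le> norm (T \<cdot> s x) * norm x"
      by (rule norm_cauchy_schwarz)
    also have "\<dots> \<le> norm T * norm (s x) * norm x"
      by (intro mult_right_mono norm_bop_apply) simp
    finally have "norm (s x) * norm (s x) \<le> norm (s x) * (norm x * norm T)"
      by (simp add: algebra_simps)
    then show "norm (s x) \<le> norm x * norm T"
      by (cases "s x = 0") auto
  qed
  moreover have "s (c *\<^sub>C y) = c *\<^sub>C s y" for c y
    by (rule inner_eq_rightI) (simp add: inner_scaleC_right bop_apply_scaleC[symmetric] flip: s)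
  ultimately obtain S where "\<And>x. S \<cdot> x = s x"
    using bop_exists by blast
  then show ?thesis
    using s that by metis
qed

lemma star_eqI:
  assumes "\<And>x y. inner (T \<cdot> x) y = inner x (S \<cdot> y)"
  shows "star T = S"
  unfolding star_bop_def
proof (rule the_equality)
  show "\<forall>x y. cinner (T \<cdot> x) y = cinner x (S \<cdot> y)"
    using cinner_eqI[OF assms] by blast
  fix R assume "\<forall>x y. cinner (T \<cdot> x) y = cinner x (R \<cdot> y)"
  then have "inner x (R \<cdot> y) = inner x (S \<cdot> y)" for x y
    unfolding assms[symmetric] by (simp add: inner_eq_Re_cinner)
  then show "R = S"
    by (rule bop_eqI[OF inner_eq_rightI])
qed

lemma inner_star: "inner (T \<cdot> x) y = inner x (star T \<cdot> y)"
proof -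
  obtain S where "\<And>x y. inner (T \<cdot> x) y = inner x (S \<cdot> y)"
    using adjoint_exists[of T] by blast
  then show ?thesis
    using star_eqI[of T S] by simp
qed

lemma inner_star': "inner x (T \<cdot> y) = inner (star T \<cdot> x) y"
  using inner_star[of T y x] by (simp add: inner_commute)

lemma star_star [simp]: "star (star T) = (T :: 'a::hilbert_space bop)"
  by (rule star_eqI) (rule inner_star'[symmetric])

lemma star_simps [simp]:
  fixes S T :: "'a::hilbert_space bop"
  shows "star (S * T) = star T * star S" "star (S + T) = star S + star T"
    "star (S - T) = star S - star T" "star (- T) = - star T" "star (0 :: 'a bop) = 0"
    "star (1 :: 'a bop) = 1" "star (a *\<^sub>R T) = a *\<^sub>R star T"
  by (rule star_eqI; simp add: inner_star inner_add_left inner_add_right inner_diff_left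
      inner_diff_right)+

lemma star_power [simp]: "star ((T :: 'a::hilbert_space bop) ^ n) = star T ^ n"
  by (induction n) (simp_all add: power_commutes)

lemma star_sum [simp]: "star (\<Sum>i\<in>I. T i :: 'a::hilbert_space bop) = (\<Sum>i\<in>I. star (T i))"
  by (induction I rule: infinite_finite_induct) auto

lemma norm_star: "norm (star T) = norm (T :: 'a::hilbert_space bop)"
proof -
  have *: "norm (star T) \<le> norm T" for T :: "'a bop"
  proof (rule norm_bop_le)
    fix x
    have "norm (star T \<cdot> x) * norm (star T \<cdot> x) = inner (T \<cdot> star T \<cdot> x) x"
      by (simp add: inner_star power2_norm_eq_inner[symmetric] power2_eq_square)
    also have "\<dots> \<le> norm (T \<cdot> star T \<cdot> x) * norm x"
      by (rule norm_cauchy_schwarz)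
    also have "\<dots> \<le> norm T * norm (star T \<cdot> x) * norm x"
      by (intro mult_right_mono norm_bop_apply) simp
    finally have "norm (star T \<cdot> x) * norm (star T \<cdot> x) \<le> norm (star T \<cdot> x) * (norm T * norm x)"
      by (simp add: algebra_simps)
    then show "norm (star T \<cdot> x) \<le> norm T * norm x"
      by (cases "star T \<cdot> x = 0") auto
  qed simp
  show ?thesis
    using *[of T] *[of "star T"] by simp
qed

lemma norm_star_mult: "(norm (T \<cdot> x))\<^sup>2 = inner x ((star T * T) \<cdot> x)"
  by (simp add: power2_norm_eq_inner inner_star)

text \<open>Strong limits stay inside the operator type. The uniform bound is a hypothesis instead
  of being drawn from the uniform boundedness principle, because the sequences in question come with
  explicit bounds.\<close>

lemma bop_pointwise_limit:
  fixes T :: "nat \<Rightarrow> 'a::hilbert_space bop"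
  assumes conv: "\<And>x. convergent (\<lambda>n. T n \<cdot> x)" and bd: "\<And>n x. norm (T n \<cdot> x) \<le> K * norm x"
  obtains L where "\<And>x. (\<lambda>n. T n \<cdot> x) \<longlonglongrightarrow> L \<cdot> x"
proof -
  define l where "l x = lim (\<lambda>n. T n \<cdot> x)" for x
  have l: "(\<lambda>n. T n \<cdot> x) \<longlonglongrightarrow> l x" for x
    using conv[of x] by (simp add: l_def convergent_LIMSEQ_iff)
  have "bounded_linear l"
  proof (rule bounded_linear_intro[where K = K])
    show "l (x + y) = l x + l y" for x y
      using tendsto_add[OF l[of x] l[of y]] l[of "x + y"] by (simp add: LIMSEQ_unique)
    show "l (r *\<^sub>R x) = r *\<^sub>R l x" for r x
      using tendsto_scaleR[OF tendsto_const[of r] l[of x]] l[of "r *\<^sub>R x"] by (simp add: LIMSEQ_unique)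
    show "norm (l x) \<le> norm x * K" for x
      using tendsto_norm[OF l[of x]] bd[of _ x]
      by (intro LIMSEQ_le_const2[of "\<lambda>n. norm (T n \<cdot> x)"]) (auto simp: mult.commute)
  qed
  moreover have "l (c *\<^sub>C x) = c *\<^sub>C l x" for c x
    using bounded_linear.tendsto[OF bounded_linear_scaleC l[of x], of c] l[of "c *\<^sub>C x"]
    by (simp add: bop_apply_scaleC LIMSEQ_unique)
  ultimately obtain L where "\<And>x. L \<cdot> x = l x"
    using bop_exists by blast
  with l that show ?thesis by metis
qed

lemma tendsto_bop_apply:
  assumes "T \<longlonglongrightarrow> L"
  shows "(\<lambda>n. T n \<cdot> x) \<longlonglongrightarrow> L \<cdot> x"
proof -
  have "(\<lambda>n. norm (T n - L) * norm x) \<longlonglongrightarrow> 0 * norm x"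
    using assms by (intro tendsto_intros) (simp add: LIM_zero tendsto_norm_zero)
  then have lim: "(\<lambda>n. norm (T n - L) * norm x) \<longlonglongrightarrow> 0"
    by simp
  have "(\<lambda>n. T n \<cdot> x - L \<cdot> x) \<longlonglongrightarrow> 0"
    by (rule Lim_null_comparison[OF always_eventually lim])
      (simp add: norm_bop_apply flip: bop_apply_simps(4))
  then show ?thesis
    by (rule LIM_zero_cancel)
qed

section \<open>Commutants\<close>

text \<open>Algebraic closure and closure under strong limits hold for the commutant of any set,
  self-adjoint or not. Taking \<open>N = commutant {T}\<close> then turns a statement of membership
  into the statement that something commutes with \<open>T\<close>.\<close>

definition is_commutant :: "'a::hilbert_space bop set \<Rightarrow> bool" where
  "is_commutant N \<longleftrightarrow> (\<exists>X. N = commutant X)"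

lemma von_neumann_is_commutant: "von_neumann_algebra N \<Longrightarrow> is_commutant N"
  unfolding is_commutant_def von_neumann_algebra_def by metis

lemma is_commutant_commutant [simp]: "is_commutant (commutant X)"
  unfolding is_commutant_def by blast

lemma von_neumann_star: "von_neumann_algebra N \<Longrightarrow> T \<in> N \<Longrightarrow> star T \<in> N"
  unfolding von_neumann_algebra_def by blast

context
  fixes N :: "'a::hilbert_space bop set"
  assumes N: "is_commutant N"
begin

lemma commutant_zero: "0 \<in> N"
  using N by (auto simp: is_commutant_def commutant_def)

lemma commutant_one: "1 \<in> N"
  using N by (auto simp: is_commutant_def commutant_def)

lemma commutant_add: "S \<in> N \<Longrightarrow> T \<in> N \<Longrightarrow> S + T \<in> N"
  using N by (auto simp: is_commutant_def commutant_def algebra_simps)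

lemma commutant_diff: "S \<in> N \<Longrightarrow> T \<in> N \<Longrightarrow> S - T \<in> N"
  using N by (auto simp: is_commutant_def commutant_def algebra_simps)

lemma commutant_uminus: "T \<in> N \<Longrightarrow> - T \<in> N"
  using N by (auto simp: is_commutant_def commutant_def)

lemma commutant_scaleR: "T \<in> N \<Longrightarrow> a *\<^sub>R T \<in> N"
  using N by (auto simp: is_commutant_def commutant_def)

lemma commutant_mult: "S \<in> N \<Longrightarrow> T \<in> N \<Longrightarrow> S * T \<in> N"
proof -
  assume "S \<in> N" "T \<in> N"
  moreover obtain X where "N = commutant X"
    using N by (auto simp: is_commutant_def)
  ultimately show "S * T \<in> N"
    by (simp add: commutant_def mult.assoc) (simp flip: mult.assoc)
qed

lemma commutant_power: "T \<in> N \<Longrightarrow> T ^ n \<in> N"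
  by (induction n) (auto intro: commutant_one commutant_mult)

lemma commutant_sum: "(\<And>i. i \<in> I \<Longrightarrow> T i \<in> N) \<Longrightarrow> (\<Sum>i\<in>I. T i) \<in> N"
  by (induction I rule: infinite_finite_induct) (auto intro: commutant_zero commutant_add)

text \<open>Left and right multiplication by a fixed operator are both strongly continuous, so
  commuting survives strong limits.\<close>

lemma commutant_limit:
  assumes T: "\<And>n. T n \<in> N" and L: "\<And>x. (\<lambda>n. T n \<cdot> x) \<longlonglongrightarrow> L \<cdot> x"
  shows "L \<in> N"
proof -
  obtain X where X: "N = commutant X"
    using N by (auto simp: is_commutant_def)
  have "L * Y = Y * L" if "Y \<in> X" for Y
  proof (rule bop_eqI)
    fix x
    have "T n * Y = Y * T n" for n
      using T that by (auto simp: X commutant_def)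
    then have "T n \<cdot> Y \<cdot> x = Y \<cdot> T n \<cdot> x" for n
      by (simp flip: bop_apply_simps)
    then show "(L * Y) \<cdot> x = (Y * L) \<cdot> x"
      using LIMSEQ_unique[OF L[of "Y \<cdot> x"]] tendsto_bop[OF L[of x], of Y] by simp
  qed
  then show ?thesis
    by (auto simp: X commutant_def)
qed

text \<open>The geometric series converges in norm and its partial sums lie in \<open>N\<close>, so
  the inverse is found inside \<open>N\<close>.\<close>

lemma neumann_inverse:
  assumes D: "D \<in> N" "norm D < 1"
  obtains R where "R \<in> N" "R * (1 - D) = 1" "(1 - D) * R = 1"
proof -
  have "summable (\<lambda>k. norm (D ^ k))"
    by (rule summable_comparison_test'[OF summable_geometric[of "norm D"]])
      (use D norm_bop_power in auto)
  then have "summable (\<lambda>k. D ^ k)"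
    by (rule summable_norm_cancel)
  then obtain R where R: "(\<lambda>n. \<Sum>k<n. D ^ k) \<longlonglongrightarrow> R"
    by (auto simp: summable_def sums_def)
  have zero: "(\<lambda>n. D ^ n) \<longlonglongrightarrow> 0"
    by (rule Lim_null_comparison[OF _ LIMSEQ_power_zero[of "norm D"]])
      (use D norm_bop_power in \<open>auto intro: always_eventually\<close>)
  have r: "(\<Sum>k<n. D ^ k) * (1 - D) = 1 - D ^ n" for n
    by (induction n) (simp_all add: distrib_right, simp add: right_diff_distrib power_commutes)
  have l: "(1 - D) * (\<Sum>k<n. D ^ k) = 1 - D ^ n" for n
    by (induction n) (simp_all add: distrib_left, simp add: left_diff_distrib)
  have one: "(\<lambda>n. 1 - D ^ n) \<longlonglongrightarrow> 1 - 0"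
    by (intro tendsto_intros zero)
  show ?thesis
  proof
    show "R \<in> N"
      by (rule commutant_limit[OF _ tendsto_bop_apply[OF R]])
        (auto intro: commutant_sum commutant_power D)
    show "R * (1 - D) = 1"
      using LIMSEQ_unique[OF tendsto_mult[OF R tendsto_const[of "1 - D"]]] one by (simp add: r)
    show "(1 - D) * R = 1"
      using LIMSEQ_unique[OF tendsto_mult[OF tendsto_const[of "1 - D"] R]] one by (simp add: l)
  qed
qed

end

section \<open>Projections and positive operators\<close>

lemma projection_apply: "is_projection p \<Longrightarrow> p \<cdot> p \<cdot> x = p \<cdot> x"
  by (simp add: is_projection_def flip: bop_apply_simps(7))

lemma projection_inner: "is_projection p \<Longrightarrow> inner (p \<cdot> x) y = inner x (p \<cdot> y)"
  by (simp add: is_projection_def inner_star)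

lemma projection_norm_sq: "is_projection p \<Longrightarrow> inner x (p \<cdot> x) = (norm (p \<cdot> x))\<^sup>2"
  by (simp add: power2_norm_eq_inner projection_inner projection_apply)

lemma projection_compl: "is_projection (p :: 'a::hilbert_space bop) \<Longrightarrow> is_projection (1 - p)"
  by (simp add: is_projection_def algebra_simps)

lemma projection_pythagoras:
  assumes p: "is_projection p"
  shows "(norm x)\<^sup>2 = (norm (p \<cdot> x))\<^sup>2 + (norm (x - p \<cdot> x))\<^sup>2"
proof -
  have "(norm x)\<^sup>2 = inner x (p \<cdot> x) + inner x ((1 - p) \<cdot> x)"
    by (simp add: power2_norm_eq_inner inner_diff_right)
  also have "\<dots> = (norm (p \<cdot> x))\<^sup>2 + (norm ((1 - p) \<cdot> x))\<^sup>2"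
    by (simp only: projection_norm_sq[OF p] projection_norm_sq[OF projection_compl[OF p]])
  finally show ?thesis
    by simp
qed

lemma projection_norm_le: "is_projection p \<Longrightarrow> norm (p \<cdot> x) \<le> norm x"
  using projection_pythagoras[of p x] by (simp add: power2_le_imp_le)

lemma norm_projection: "is_projection (p :: 'a::hilbert_space bop) \<Longrightarrow> norm p \<le> 1"
  by (rule norm_bop_le) (auto simp: projection_norm_le)

lemma projection_range: "is_projection p \<Longrightarrow> range (bop_apply p) = {x. p \<cdot> x = x}"
  by (auto simp: projection_apply image_iff dest: sym)

lemma projection_zero: "is_projection (0 :: 'a::hilbert_space bop)"
  and projection_one: "is_projection (1 :: 'a::hilbert_space bop)"
  by (auto simp: is_projection_def)

lemma projection_add:
  fixes p q :: "'a::hilbert_space bop"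
  assumes "is_projection p" "is_projection q" "p * q = 0"
  shows "is_projection (p + q)"
proof -
  have "q * p = star (p * q)"
    using assms(1,2) by (simp add: is_projection_def)
  then have "q * p = 0"
    unfolding assms(3) by simp
  then show ?thesis
    using assms by (simp add: is_projection_def algebra_simps)
qed

section \<open>Self-adjoint and positive operators\<close>

lemma selfadjoint_inner: "star A = A \<Longrightarrow> inner (A \<cdot> x) y = inner x (A \<cdot> y)"
  by (simp add: inner_star)

text \<open>Polarisation: evaluating at \<open>x + y\<close> isolates the cross term, which
  self-adjointness makes symmetric.\<close>

lemma selfadjoint_eqI:
  assumes A: "star A = A" and B: "star B = B"
    and eq: "\<And>x. inner x (A \<cdot> x) = inner x (B \<cdot> x)"
  shows "A = B"
proof (rule bop_eqI, rule inner_eq_rightI)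
  fix x y
  have s: "inner y (A \<cdot> x) = inner x (A \<cdot> y)" "inner y (B \<cdot> x) = inner x (B \<cdot> y)"
    using selfadjoint_inner[OF A, of y x] selfadjoint_inner[OF B, of y x] by (simp_all add: inner_commute)
  show "inner y (A \<cdot> x) = inner y (B \<cdot> x)"
    using eq[of "x + y"] eq[of x] eq[of y] s by (simp add: inner_add_left inner_add_right)
qed

lemma projection_eqI_range:
  assumes p: "is_projection p" and q: "is_projection q"
    and r: "range (bop_apply p) = range (bop_apply q)"
  shows "p = (q :: 'a::hilbert_space bop)"
proof -
  have "q * p = p"
    using r projection_range[OF q] by (intro bop_eqI) auto
  moreover have "p * q = q"
    using r projection_range[OF p] by (intro bop_eqI) auto
  then have "star (p * q) = star q"
    by simp
  then have "q * p = q"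
    using p q by (simp add: is_projection_def)
  ultimately show ?thesis by simp
qed

lemma proj_onto_eqI: "is_projection p \<Longrightarrow> range (bop_apply p) = M \<Longrightarrow> proj_onto M = p"
  unfolding proj_onto_def by (rule the_equality) (simp, metis projection_eqI_range)

text \<open>\<open>inner\<close> is only the real part of the complex inner product, and
  multiplication by the imaginary unit has a form with real part zero. Self-adjointness therefore
  does not follow from the inequality and is a clause of its own.\<close>

definition positive_op :: "'a::hilbert_space bop \<Rightarrow> bool" where
  "positive_op A \<longleftrightarrow> star A = A \<and> (\<forall>x. 0 \<le> inner x (A \<cdot> x))"

lemma positive_selfadjoint: "positive_op A \<Longrightarrow> star A = A"
  by (simp add: positive_op_def)

lemma positive_inner: "positive_op A \<Longrightarrow> 0 \<le> inner x (A \<cdot> x)"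
  by (simp add: positive_op_def)

lemma positive_star_mult: "positive_op (star T * T)"
  by (simp add: positive_op_def flip: inner_star)

lemma positive_conj: "positive_op A \<Longrightarrow> positive_op (star T * A * T)"
  by (simp add: positive_op_def mult.assoc flip: inner_star)

lemma positive_add: "positive_op A \<Longrightarrow> positive_op B \<Longrightarrow> positive_op (A + B)"
  by (simp add: positive_op_def inner_add_right)

lemma positive_scaleR: "positive_op A \<Longrightarrow> 0 \<le> c \<Longrightarrow> positive_op (c *\<^sub>R A)"
  by (simp add: positive_op_def)

text \<open>Splitting the power in half leaves a conjugate: \<open>C ^ k * A * C ^ k\<close> for an
  even exponent and \<open>C ^ k * (C * A) * C ^ k\<close> for an odd one, where positivity of
  \<open>C * A\<close> enters.\<close>

lemma positive_power_mult:
  assumes C: "star C = C" and A: "positive_op A" "positive_op (C * A)" and comm: "C * A = A * C"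
  shows "positive_op (C ^ n * A)"
proof -
  have c: "C ^ k * A = A * C ^ k" for k
    by (induction k) (simp_all add: mult.assoc, simp add: comm flip: mult.assoc)
  have e: "positive_op (star (C ^ k) * X * C ^ k)" if "positive_op X" for X k
    using that by (rule positive_conj)
  show ?thesis
  proof (cases "even n")
    case True
    then obtain k where "n = k + k"
      by (metis evenE mult_2)
    then have "C ^ n * A = star (C ^ k) * A * C ^ k"
      by (simp add: C power_add mult.assoc, simp add: c)
    then show ?thesis
      using e A by simp
  next
    case False
    then obtain k where "n = k + Suc k"
      by (metis oddE mult_2 add_Suc_right Suc_eq_plus1)
    then have "C ^ n * A = star (C ^ k) * (C * A) * C ^ k"
      by (simp add: C power_add mult.assoc del: add_Suc_right, simp add: c)
    then show ?thesis
      using e A by simp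
  qed
qed

section \<open>Strong limits of powers\<close>

context
  fixes C :: "'a::hilbert_space bop"
  assumes C: "positive_op C" and C1: "positive_op (1 - C)"
begin

lemma contraction_power_step: "positive_op (C ^ n * (1 - C))"
proof (rule positive_power_mult)
  \<comment> \<open>Positivity of the product without square roots: \<open>C\<close> and
    \<open>1 - C\<close> add up to \<open>1\<close>, so the product is a sum of two conjugates of
    positive operators.\<close>
  have "C * (1 - C) = star C * (1 - C) * C + star (1 - C) * C * (1 - C)"
    using positive_selfadjoint[OF C] by (simp add: algebra_simps)
  then show "positive_op (C * (1 - C))"
    using positive_add[OF positive_conj[OF C1, of C] positive_conj[OF C, of "1 - C"]] by simp
qed (use positive_selfadjoint[OF C] C1 in \<open>auto simp: algebra_simps\<close>)

lemma contraction_power_step2: "positive_op (C ^ n * ((1 - C) * (1 - C)))"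
proof (rule positive_power_mult)
  have "C * ((1 - C) * (1 - C)) = star (1 - C) * C * (1 - C)"
    using positive_selfadjoint[OF C] by (simp add: algebra_simps)
  then show "positive_op (C * ((1 - C) * (1 - C)))"
    using positive_conj[OF C, of "1 - C"] by simp
  show "positive_op ((1 - C) * (1 - C))"
    using positive_star_mult[of "1 - C"] positive_selfadjoint[OF C1] by simp
qed (use positive_selfadjoint[OF C] in \<open>auto simp: algebra_simps\<close>)

lemma contraction_form_decreasing: "inner x (C ^ Suc n \<cdot> x) \<le> inner x (C ^ n \<cdot> x)"
  using positive_inner[OF contraction_power_step, of x n]
  by (simp add: right_diff_distrib power_commutes inner_diff_right flip: bop_apply_simps(7))

lemma contraction_form_nonneg: "0 \<le> inner x (C ^ n \<cdot> x)"
proof -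
  have "positive_op (C ^ n * 1)"
    by (rule positive_power_mult) (use C in \<open>auto simp: positive_op_def\<close>)
  then show ?thesis
    using positive_inner by auto
qed

text \<open>The numbers \<open>d k\<close> decrease and are the successive differences of a
  nonnegative sequence, so \<open>n + 1\<close> copies of the last are at most a telescoping sum.
  This is the rate of order \<open>1 / n\<close> behind the self-adjointness of closed
  ideals.\<close>

lemma contraction_form_gap: "real (Suc n) * inner x ((C ^ n * (1 - C)) \<cdot> x) \<le> (norm x)\<^sup>2"
proof -
  define d where "d n = inner x ((C ^ n * (1 - C)) \<cdot> x)" for n
  have [simp]: "C ^ n * (C * C) = C * (C * C ^ n)" for n
    by (metis mult.assoc power_commutes)
  have "d (Suc n) \<le> d n" for n
    using positive_inner[OF contraction_power_step2, of x n]
    by (simp add: d_def right_diff_distrib left_diff_distrib power_commutes inner_diff_right mult.assoc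
        flip: bop_apply_simps(7))
  then have dec: "d n \<le> d k" if "k \<le> n" for k
    using that by (rule lift_Suc_antimono_le)
  have "real (Suc n) * d n = (\<Sum>k\<le>n. d n)"
    by simp
  also have "\<dots> \<le> (\<Sum>k\<le>n. d k)"
    by (intro sum_mono dec) auto
  also have "\<dots> = (\<Sum>k\<le>n. inner x (C ^ k \<cdot> x) - inner x (C ^ Suc k \<cdot> x))"
    by (simp add: d_def right_diff_distrib power_commutes inner_diff_right flip: bop_apply_simps(7))
  also have "\<dots> = inner x x - inner x (C ^ Suc n \<cdot> x)"
    by (subst sum_telescope) simp
  also have "\<dots> \<le> (norm x)\<^sup>2"
    using contraction_form_nonneg[of x "Suc n"] by (simp add: power2_norm_eq_inner)
  finally show ?thesis
    by (simp add: d_def)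
qed

lemma contraction_power_inner: "inner (C ^ m \<cdot> x) (C ^ n \<cdot> x) = inner x (C ^ (m + n) \<cdot> x)"
  using positive_selfadjoint[OF C] by (simp add: inner_star power_add)

lemma contraction_power_norm: "norm (C ^ n \<cdot> x) \<le> norm x"
proof (rule power2_le_imp_le)
  have "inner x (C ^ (n + n) \<cdot> x) \<le> inner x (C ^ 0 \<cdot> x)"
    using lift_Suc_antimono_le[of "\<lambda>n. inner x (C ^ n \<cdot> x)" 0 "n + n"] contraction_form_decreasing
    by blast
  then show "(norm (C ^ n \<cdot> x))\<^sup>2 \<le> (norm x)\<^sup>2"
    by (simp add: power2_norm_eq_inner contraction_power_inner)
qed simp

lemma contraction_norm: "norm C \<le> 1"
  using contraction_power_norm[of 1] by (intro norm_bop_le) auto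

text \<open>Inner products of two powers depend only on the sum of the exponents, so the distances
  are governed by the monotone bounded scalar sequence \<open>a\<close>.\<close>

lemma contraction_power_convergent: "convergent (\<lambda>n. C ^ n \<cdot> x)"
proof -
  define a where "a n = inner x (C ^ n \<cdot> x)" for n
  have "decseq a"
    using contraction_form_decreasing unfolding a_def by (intro decseq_SucI)
  then obtain l where l: "a \<longlonglongrightarrow> l"
    using decseq_convergent[of a 0] contraction_form_nonneg unfolding a_def by metis
  have nrm: "(norm (C ^ m \<cdot> x - C ^ n \<cdot> x))\<^sup>2 = (a (m + m) - a (m + n)) + (a (n + n) - a (m + n))" for m n
    by (simp add: power2_norm_eq_inner inner_diff_left inner_diff_right contraction_power_inner a_def
        add.commute)
  have "Cauchy (\<lambda>n. C ^ n \<cdot> x)"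
  proof (rule metric_CauchyI)
    fix e :: real assume e: "e > 0"
    then have "e\<^sup>2 / 4 > 0"
      by simp
    then obtain M where M: "\<And>n. n \<ge> M \<Longrightarrow> \<bar>a n - l\<bar> < e\<^sup>2 / 4"
      using LIMSEQ_D[OF l, of "e\<^sup>2 / 4"] by (auto simp: real_norm_def)
    show "\<exists>M. \<forall>m\<ge>M. \<forall>n\<ge>M. dist (C ^ m \<cdot> x) (C ^ n \<cdot> x) < e"
    proof (intro exI allI impI)
      fix m n assume "m \<ge> M" "n \<ge> M"
      then have "(norm (C ^ m \<cdot> x - C ^ n \<cdot> x))\<^sup>2 < e\<^sup>2"
        unfolding nrm using M[of "m + m"] M[of "m + n"] M[of "n + n"] by linarith
      then show "dist (C ^ m \<cdot> x) (C ^ n \<cdot> x) < e"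
        using e by (simp add: dist_norm power_less_imp_less_base)
    qed
  qed
  then show ?thesis
    by (rule Cauchy_convergent)
qed

text \<open>A substitute for functional calculus: kernel projections are obtained as strong limits
  of powers, which makes their membership in \<open>N\<close> a matter of
  \<open>commutant_limit\<close>.\<close>

lemma contraction_power_limit:
  obtains Q where "is_projection Q" "range (bop_apply Q) = {x. C \<cdot> x = x}"
    "\<And>x. (\<lambda>n. C ^ n \<cdot> x) \<longlonglongrightarrow> Q \<cdot> x"
proof -
  obtain Q where Q: "\<And>x. (\<lambda>n. C ^ n \<cdot> x) \<longlonglongrightarrow> Q \<cdot> x"
    using bop_pointwise_limit[of "\<lambda>n. C ^ n" 1] contraction_power_convergent contraction_power_norm
    by auto
  have sa: "star Q = Q"
  proof (rule star_eqI)
    fix x y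
    have "(\<lambda>n. inner (C ^ n \<cdot> x) y) \<longlonglongrightarrow> inner (Q \<cdot> x) y"
      by (intro tendsto_intros Q)
    moreover have "(\<lambda>n. inner x (C ^ n \<cdot> y)) \<longlonglongrightarrow> inner x (Q \<cdot> y)"
      by (intro tendsto_intros Q)
    ultimately show "inner (Q \<cdot> x) y = inner x (Q \<cdot> y)"
      using positive_selfadjoint[OF C] by (simp add: inner_star LIMSEQ_unique)
  qed
  have CQ: "C \<cdot> Q \<cdot> x = Q \<cdot> x" for x
    using LIMSEQ_unique[OF tendsto_bop[OF Q[of x], of C]] LIMSEQ_Suc[OF Q[of x]] by simp
  have fixed: "Q \<cdot> x = x" if "C \<cdot> x = x" for x
  proof -
    have "C ^ n \<cdot> x = x" for n
      using that by (induction n) auto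
    then show ?thesis
      using Q[of x] by (simp add: LIMSEQ_const_iff)
  qed
  show ?thesis
  proof
    show "is_projection Q"
      unfolding is_projection_def using sa CQ fixed by (auto intro: bop_eqI)
    show "range (bop_apply Q) = {x. C \<cdot> x = x}"
      using CQ fixed by (auto simp: image_iff) metis
  qed (rule Q)
qed

end

text \<open>This brings any positive operator into the range where powers of
  \<open>1 - c *\<^sub>R A\<close> converge. The recurring choice
  \<open>c = 1 / (norm A + 1)\<close> satisfies the bound and is also defined for
  \<open>A = 0\<close>.\<close>

lemma positive_one_minus_scaled:
  assumes A: "positive_op A" and c: "0 \<le> c" "c * norm A \<le> 1"
  shows "positive_op (1 - c *\<^sub>R A)"
proof -
  have "c * inner x (A \<cdot> x) \<le> inner x x" for x
  proof -
    have "inner x (A \<cdot> x) \<le> norm x * norm (A \<cdot> x)"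
      by (rule norm_cauchy_schwarz)
    also have "\<dots> \<le> norm x * (norm A * norm x)"
      by (intro mult_left_mono norm_bop_apply) simp
    finally have "c * inner x (A \<cdot> x) \<le> c * (norm A * (norm x)\<^sup>2)"
      using c by (intro mult_left_mono) (auto simp: power2_eq_square algebra_simps)
    also have "\<dots> \<le> 1 * (norm x)\<^sup>2"
      unfolding mult.assoc[symmetric] using c by (intro mult_right_mono) auto
    finally show ?thesis
      by (simp add: power2_norm_eq_inner)
  qed
  then show ?thesis
    using A by (simp add: positive_op_def inner_diff_right)
qed

section \<open>Null projections and meets\<close>

lemma star_mult_kernel: "(star A * A) \<cdot> x = 0 \<longleftrightarrow> A \<cdot> x = 0"
  using norm_star_mult[of A x] by auto

text \<open>The vectors fixed by \<open>C = 1 - c *\<^sub>R (star A * A)\<close> form the kernel of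
  \<open>star A * A\<close>, which is the kernel of \<open>A\<close>. The powers of \<open>C\<close>
  lie in \<open>N\<close> and converge strongly to the projection onto it.\<close>

lemma null_proj:
  fixes A :: "'a::hilbert_space bop"
  shows null_proj_projection: "is_projection (null_proj A)"
    and null_proj_range: "range (bop_apply (null_proj A)) = {x. A \<cdot> x = 0}"
    and null_proj_commutant: "is_commutant N \<Longrightarrow> A \<in> N \<Longrightarrow> star A \<in> N \<Longrightarrow> null_proj A \<in> N"
proof -
  define c where "c = 1 / (norm (star A * A) + 1)"
  have c: "c > 0" "c * norm (star A * A) \<le> 1"
    by (auto simp: c_def field_simps add_pos_nonneg)
  define C where "C = 1 - c *\<^sub>R (star A * A)"
  have "positive_op C" "positive_op (1 - C)"
    unfolding C_def using c positive_star_mult[of A]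
    by (auto intro: positive_one_minus_scaled positive_scaleR)
  then obtain Q where Q: "is_projection Q" "range (bop_apply Q) = {x. C \<cdot> x = x}"
    and lim: "\<And>x. (\<lambda>n. C ^ n \<cdot> x) \<longlonglongrightarrow> Q \<cdot> x"
    using contraction_power_limit by blast
  have "{x. C \<cdot> x = x} = {x. A \<cdot> x = 0}"
    using c star_mult_kernel[of A] by (auto simp: C_def)
  then have eq: "null_proj A = Q"
    unfolding null_proj_def using Q by (intro proj_onto_eqI) auto
  show "is_projection (null_proj A)" "range (bop_apply (null_proj A)) = {x. A \<cdot> x = 0}"
    using Q \<open>{x. C \<cdot> x = x} = {x. A \<cdot> x = 0}\<close> by (auto simp: eq)
  assume N: "is_commutant N" "A \<in> N" "star A \<in> N"
  then have "C \<in> N"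
    unfolding C_def
    by (intro commutant_diff commutant_one commutant_scaleR commutant_mult) auto
  then show "null_proj A \<in> N"
    unfolding eq by (intro commutant_limit[OF N(1) _ lim] commutant_power[OF N(1)])
qed

lemma null_proj_fixed_iff: "null_proj A \<cdot> x = x \<longleftrightarrow> A \<cdot> x = 0"
  using null_proj_range[of A] projection_range[OF null_proj_projection[of A]] by auto

lemma null_proj_apply [simp]: "A \<cdot> null_proj A \<cdot> x = 0"
  using null_proj_range[of A] by auto

text \<open>Paired with \<open>x\<close>, the two complements contribute squared norms, which add up
  to zero only if both vanish.\<close>

lemma projection_compl_add_kernel:
  assumes p: "is_projection p" and q: "is_projection q"
  shows "((1 - p) + (1 - q)) \<cdot> x = 0 \<longleftrightarrow> p \<cdot> x = x \<and> q \<cdot> x = x"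
proof
  assume "((1 - p) + (1 - q)) \<cdot> x = 0"
  then have "inner x (((1 - p) + (1 - q)) \<cdot> x) = 0"
    by simp
  then have "inner x ((1 - p) \<cdot> x) + inner x ((1 - q) \<cdot> x) = 0"
    by (simp only: bop_apply_simps(3) inner_add_right)
  then have "(norm ((1 - p) \<cdot> x))\<^sup>2 + (norm ((1 - q) \<cdot> x))\<^sup>2 = 0"
    by (simp only: projection_norm_sq[OF projection_compl[OF p]] projection_norm_sq[OF projection_compl[OF q]])
  then show "p \<cdot> x = x \<and> q \<cdot> x = x"
    by (simp add: add_nonneg_eq_0_iff)
qed auto

text \<open>An intersection of ranges becomes a kernel, so existence of the meet and its membership
  in \<open>N\<close> are inherited from \<open>null_proj\<close>.\<close>

lemma proj_meet_eq_null_proj: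
  assumes "is_projection p" "is_projection q"
  shows "p \<sqinter>\<^sub>p q = null_proj ((1 - p) + (1 - q))"
  unfolding proj_meet_def null_proj_def projection_compl_add_kernel[OF assms]
  using assms by (auto simp: projection_range intro!: arg_cong[where f = proj_onto])

lemma proj_meet:
  assumes "is_projection p" "is_projection q"
  shows proj_meet_projection: "is_projection (p \<sqinter>\<^sub>p q)"
    and proj_meet_range: "range (bop_apply (p \<sqinter>\<^sub>p q)) = {x. p \<cdot> x = x \<and> q \<cdot> x = x}"
    and proj_meet_commutant: "is_commutant N \<Longrightarrow> p \<in> N \<Longrightarrow> q \<in> N \<Longrightarrow> p \<sqinter>\<^sub>p q \<in> N"
proof -
  show "is_projection (p \<sqinter>\<^sub>p q)"
    by (simp add: proj_meet_eq_null_proj assms null_proj_projection)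
  show "range (bop_apply (p \<sqinter>\<^sub>p q)) = {x. p \<cdot> x = x \<and> q \<cdot> x = x}"
    by (simp only: proj_meet_eq_null_proj assms null_proj_range projection_compl_add_kernel[OF assms])
  assume "is_commutant N" "p \<in> N" "q \<in> N"
  then show "p \<sqinter>\<^sub>p q \<in> N"
    unfolding proj_meet_eq_null_proj[OF assms] using assms
    by (intro null_proj_commutant)
      (auto simp: is_projection_def intro!: commutant_add commutant_diff commutant_one)
qed

lemma proj_meet_fixed_iff:
  assumes "is_projection p" "is_projection q"
  shows "(p \<sqinter>\<^sub>p q) \<cdot> x = x \<longleftrightarrow> p \<cdot> x = x \<and> q \<cdot> x = x"
  using proj_meet_range[OF assms] projection_range[OF proj_meet_projection[OF assms]] by auto

section \<open>Square roots and polar decomposition\<close>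

lemma tendsto_star:
  assumes "X \<longlonglongrightarrow> L"
  shows "(\<lambda>n. star (X n)) \<longlonglongrightarrow> star (L :: 'a::hilbert_space bop)"
proof -
  have "bounded_linear (star :: 'a bop \<Rightarrow> 'a bop)"
    by (rule bounded_linear_intro[where K = 1]) (simp_all add: norm_star)
  then show ?thesis
    using assms by (rule bounded_linear.tendsto)
qed

text \<open>The iteration \<open>Y \<mapsto> (B + Y\<^sup>2) / 2\<close> for \<open>1 - (1 - B)\<^sup>1\<^sup>/\<^sup>2\<close> is dominated by the scalar
  iteration \<open>y \<mapsto> (1 + y\<^sup>2) / 2\<close>, which increases to \<open>1\<close>.\<close>

lemma sqrt_one_minus_exists:
  fixes B :: "'a::hilbert_space bop"
  assumes sa: "star B = B" and nB: "norm B \<le> 1"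
  obtains Y where "star Y = Y" "norm Y \<le> 1" "(1 - Y) * (1 - Y) = 1 - B"
    "\<And>N. is_commutant N \<Longrightarrow> B \<in> N \<Longrightarrow> Y \<in> N"
proof -
  define Y where "Y = rec_nat (0 :: 'a bop) (\<lambda>_ Z. (1/2) *\<^sub>R (B + Z * Z))"
  define y where "y = rec_nat (0 :: real) (\<lambda>_ z. (1 + z * z) / 2)"
  have Y0: "Y 0 = 0" and YS: "Y (Suc n) = (1/2) *\<^sub>R (B + Y n * Y n)" for n
    by (simp_all add: Y_def)
  have y0: "y 0 = 0" and yS: "y (Suc n) = (1 + y n * y n) / 2" for n
    by (simp_all add: y_def)
  have y01: "0 \<le> y n \<and> y n \<le> 1" for n
  proof (induction n)
    case (Suc n)
    then have "y n * y n \<le> 1"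
      by (simp add: mult_le_one)
    with Suc show ?case
      by (simp add: yS)
  qed (simp add: y0)
  have yinc: "y n \<le> y (Suc n)" for n
    using zero_le_square[of "1 - y n"] by (simp add: yS algebra_simps)
  have YN: "Y n \<in> N" if "is_commutant N" "B \<in> N" for N n
    by (induction n)
      (simp_all add: Y0 YS that commutant_zero commutant_scaleR commutant_add commutant_mult)
  have Ysa: "star (Y n) = Y n" for n
    by (induction n) (simp_all add: Y0 YS sa)
  have nY: "norm (Y n) \<le> y n" for n
  proof (induction n)
    case (Suc n)
    have "norm (Y (Suc n)) \<le> (norm B + norm (Y n) * norm (Y n)) / 2"
      using norm_triangle_ineq[of B "Y n * Y n"] norm_mult_ineq[of "Y n" "Y n"] by (simp add: YS)
    also have "\<dots> \<le> (1 + y n * y n) / 2"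
      using nB Suc y01[of n] by (intro divide_right_mono add_mono mult_mono) auto
    finally show ?case
      by (simp add: yS)
  qed (simp add: Y0 y0)
  have BC: "Y n * B = B * Y n" for n
  proof (induction n)
    case (Suc n)
    have "Y n * Y n * B = B * (Y n * Y n)"
      by (simp add: mult.assoc Suc) (simp add: Suc flip: mult.assoc)
    then show ?case
      by (simp add: YS distrib_left distrib_right)
  qed (simp add: Y0)
  have comm: "Y n * Y (Suc n) = Y (Suc n) * Y n" for n
    by (simp add: YS algebra_simps BC)
  \<comment> \<open>Consecutive iterates commute, so the difference of squares factors and each
    factor is dominated by its scalar counterpart. The scalar increments telescope, which gives
    summability.\<close>
  have step: "norm (Y (Suc n) - Y n) \<le> y (Suc n) - y n" for n
  proof (induction n)
    case 0
    show ?case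
      using nB by (simp add: Y0 YS y0 yS)
  next
    case (Suc n)
    have eq: "Y (Suc (Suc n)) - Y (Suc n) = (1/2) *\<^sub>R ((Y (Suc n) - Y n) * (Y (Suc n) + Y n))"
    proof -
      have "Y (Suc (Suc n)) - Y (Suc n) = (1/2) *\<^sub>R (Y (Suc n) * Y (Suc n) - Y n * Y n)"
        by (subst YS, subst (3) YS) (simp add: scaleR_diff_right scaleR_add_right)
      then show ?thesis
        using comm[of n] by (simp add: algebra_simps)
    qed
    have "norm (Y (Suc (Suc n)) - Y (Suc n))
        \<le> (1/2) * (norm (Y (Suc n) - Y n) * norm (Y (Suc n) + Y n))"
      unfolding eq using norm_mult_ineq[of "Y (Suc n) - Y n" "Y (Suc n) + Y n"] by simp
    also have "\<dots> \<le> (1/2) * ((y (Suc n) - y n) * (y (Suc n) + y n))"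
      using Suc y01[of n] y01[of "Suc n"] nY[of n] nY[of "Suc n"] yinc[of n]
      by (intro mult_left_mono mult_mono order_trans[OF norm_triangle_ineq] add_mono) auto
    also have "\<dots> = y (Suc (Suc n)) - y (Suc n)"
      by (subst yS, subst (4) yS) (simp add: field_simps)
    finally show ?case .
  qed
  have "convergent y"
    using y01 yinc by (intro Bseq_monoseq_convergent BseqI'[of _ 1]) (auto simp: monoseq_Suc)
  then obtain l where "y \<longlonglongrightarrow> l"
    by (auto simp: convergent_def)
  then have "(\<lambda>n. y n - y 0) \<longlonglongrightarrow> l - y 0"
    by (intro tendsto_intros)
  then have "summable (\<lambda>n. y (Suc n) - y n)"
    unfolding summable_def sums_def by (auto simp: sum_lessThan_telescope)
  then have "summable (\<lambda>n. norm (Y (Suc n) - Y n))"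
    by (rule summable_comparison_test'[where N = 0]) (simp add: step)
  then have "summable (\<lambda>n. Y (Suc n) - Y n)"
    by (rule summable_norm_cancel)
  then obtain L where L: "Y \<longlonglongrightarrow> L"
    unfolding summable_def sums_def by (auto simp: sum_lessThan_telescope Y0)
  show ?thesis
  proof
    show "star L = L"
    proof (rule LIMSEQ_unique)
      show "Y \<longlonglongrightarrow> star L"
        using tendsto_star[OF L] by (simp add: Ysa)
    qed (rule L)
    show "norm L \<le> 1"
    proof (rule LIMSEQ_le_const2[OF tendsto_norm[OF L]])
      have "norm (Y n) \<le> 1" for n
        using nY[of n] y01[of n] by linarith
      then show "\<exists>k. \<forall>n\<ge>k. norm (Y n) \<le> 1"
        by blast
    qed
    show "L \<in> N" if "is_commutant N" "B \<in> N" for N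
      using YN[OF that] by (rule commutant_limit[OF that(1) _ tendsto_bop_apply[OF L]])
    have "(\<lambda>n. Y (Suc n)) \<longlonglongrightarrow> (1/2) *\<^sub>R (B + L * L)"
      unfolding YS by (intro tendsto_intros L)
    then have "L = (1/2) *\<^sub>R (B + L * L)"
      by (rule LIMSEQ_unique[OF LIMSEQ_Suc[OF L]])
    then have "2 *\<^sub>R L = 2 *\<^sub>R ((1/2) *\<^sub>R (B + L * L))"
      by (rule arg_cong)
    then have LL: "L + L = B + L * L"
      by (simp add: scaleR_2)
    have "(1 - L) * (1 - L) = 1 - (L + L) + L * L"
      by (simp add: algebra_simps)
    then show "(1 - L) * (1 - L) = 1 - B"
      by (simp add: LL)
  qed
qed

text \<open>With \<open>B = 1 - c *\<^sub>R A\<close> the root is \<open>1 - Y\<close> divided by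
  the square root of \<open>c\<close>, and it is positive because \<open>norm Y \<le> 1\<close>. The
  quantifier over commutants stands inside so that one root serves every \<open>N\<close>.\<close>

lemma sqrt_op_exists:
  fixes A :: "'a::hilbert_space bop"
  assumes A: "positive_op A"
  shows "\<exists>H. positive_op H \<and> H * H = A \<and> (\<forall>N. is_commutant N \<longrightarrow> A \<in> N \<longrightarrow> H \<in> N)"
proof -
  define c where "c = 1 / (norm A + 1)"
  have c: "c > 0" "c * norm A \<le> 1"
    by (auto simp: c_def field_simps add_pos_nonneg)
  define B where "B = 1 - c *\<^sub>R A"
  have "positive_op B" "positive_op (1 - B)"
    unfolding B_def using c A by (auto intro: positive_one_minus_scaled positive_scaleR)
  then have "star B = B" "norm B \<le> 1"
    using positive_selfadjoint contraction_norm by auto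
  then obtain Y where Y: "star Y = Y" "norm Y \<le> 1" "(1 - Y) * (1 - Y) = 1 - B"
    and YN: "\<And>N. is_commutant N \<Longrightarrow> B \<in> N \<Longrightarrow> Y \<in> N"
    using sqrt_one_minus_exists by blast
  define H where "H = sqrt (1 / c) *\<^sub>R (1 - Y)"
  have "inner x (Y \<cdot> x) \<le> inner x x" for x
  proof -
    have "inner x (Y \<cdot> x) \<le> norm x * norm (Y \<cdot> x)"
      by (rule norm_cauchy_schwarz)
    also have "norm (Y \<cdot> x) \<le> norm x"
      using norm_bop_apply[of Y x] Y(2) mult_right_mono[of "norm Y" 1 "norm x"] by simp
    finally show ?thesis
      by (simp add: mult_left_mono power2_norm_eq_inner[symmetric] power2_eq_square)
  qed
  then have "positive_op (1 - Y)"
    using Y by (simp add: positive_op_def inner_diff_right)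
  then have "positive_op H"
    unfolding H_def using c by (intro positive_scaleR) auto
  moreover have "H * H = A"
  proof -
    have "H * H = (sqrt (1 / c) * sqrt (1 / c)) *\<^sub>R ((1 - Y) * (1 - Y))"
      by (simp only: H_def mult_scaleR_left mult_scaleR_right scaleR_scaleR)
    also have "sqrt (1 / c) * sqrt (1 / c) = 1 / c"
      using c by simp
    finally show ?thesis
      using c by (simp add: Y(3) B_def)
  qed
  moreover have "H \<in> N" if "is_commutant N" "A \<in> N" for N
    unfolding H_def using that
    by (intro commutant_scaleR commutant_diff commutant_one YN)
      (auto simp: B_def intro!: commutant_scaleR commutant_diff commutant_one)
  ultimately show ?thesis
    by (intro exI[of _ H]) simp
qed

text \<open>The modulus of \<open>T\<close>. The clause on commutants, built into the choice, stands
  in for the uniqueness of the positive root: it gives commutation with everything that commutes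
  with \<open>star T * T\<close>.\<close>

definition abs_op :: "'a::hilbert_space bop \<Rightarrow> 'a bop" where
  "abs_op T = (SOME H. positive_op H \<and> H * H = star T * T \<and>
     (\<forall>N. is_commutant N \<longrightarrow> star T * T \<in> N \<longrightarrow> H \<in> N))"

lemma abs_op:
  shows abs_op_positive: "positive_op (abs_op T)"
    and abs_op_square: "abs_op T * abs_op T = star T * T"
    and abs_op_commutant: "is_commutant N \<Longrightarrow> star T * T \<in> N \<Longrightarrow> abs_op T \<in> N"
proof -
  note * = someI_ex[OF sqrt_op_exists[OF positive_star_mult[of T]], folded abs_op_def]
  show "positive_op (abs_op T)"
    using * by (rule conjunct1)
  show "abs_op T * abs_op T = star T * T"
    using *[THEN conjunct2] by (rule conjunct1)
  show "abs_op T \<in> N" if "is_commutant N" "star T * T \<in> N"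
    using *[THEN conjunct2, THEN conjunct2] that by simp
qed

lemma norm_abs_op: "norm (abs_op T \<cdot> x) = norm (T \<cdot> x)"
proof -
  have "(norm (abs_op T \<cdot> x))\<^sup>2 = (norm (T \<cdot> x))\<^sup>2"
    unfolding norm_star_mult positive_selfadjoint[OF abs_op_positive] abs_op_square ..
  then show ?thesis
    by simp
qed

text \<open>With \<open>A = H * H\<close> the form is the squared norm of
  \<open>H \<cdot> x\<close>, so it vanishes only together with that vector.\<close>

lemma positive_form_zero:
  assumes A: "positive_op A" and x: "inner x (A \<cdot> x) = 0"
  shows "A \<cdot> x = 0"
proof -
  obtain H where H: "positive_op H" "H * H = A"
    using sqrt_op_exists[OF A] by blast
  then have "(norm (H \<cdot> x))\<^sup>2 = inner x (A \<cdot> x)"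
    unfolding norm_star_mult by (simp only: positive_selfadjoint)
  then have "H \<cdot> x = 0"
    using x by simp
  moreover have "A \<cdot> x = H \<cdot> H \<cdot> x"
    unfolding H(2)[symmetric] by simp
  ultimately show ?thesis
    by simp
qed

text \<open>The partial isometry is the strong limit of \<open>A (1 + C + \<dots> + C\<^sup>n\<^sup>-\<^sup>1) c\<close> with \<open>C = 1 - c |A|\<close>.\<close>

lemma polar_decomposition:
  fixes A :: "'a::hilbert_space bop"
  assumes N: "is_commutant N" and AN: "A \<in> N" "star A \<in> N"
  obtains V where "V \<in> N" "star V * V = 1 - null_proj A" "V * star V = 1 - null_proj (star A)"
proof -
  define H where "H = abs_op A"
  have H: "positive_op H" "H \<in> N"
    unfolding H_def using AN by (auto intro: abs_op_positive abs_op_commutant commutant_mult N)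
  define c where "c = 1 / (norm H + 1)"
  have c: "c > 0" "c * norm H \<le> 1"
    by (auto simp: c_def field_simps add_pos_nonneg)
  define C where "C = 1 - c *\<^sub>R H"
  have C: "positive_op C" "positive_op (1 - C)"
    unfolding C_def using c H by (auto intro: positive_one_minus_scaled positive_scaleR)
  obtain Q where Q: "is_projection Q" "range (bop_apply Q) = {x. C \<cdot> x = x}"
    and lim: "\<And>x. (\<lambda>n. C ^ n \<cdot> x) \<longlonglongrightarrow> Q \<cdot> x"
    using contraction_power_limit[OF C] by blast
  have "{x. C \<cdot> x = x} = {x. A \<cdot> x = 0}"
    using c norm_abs_op[of A] by (auto simp: C_def H_def) (metis norm_eq_zero)+
  then have Qeq: "null_proj A = Q"
    unfolding null_proj_def using Q by (intro proj_onto_eqI) auto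
  define X where "X n = c *\<^sub>R (\<Sum>k<n. C ^ k)" for n
  have cH: "c *\<^sub>R H = 1 - C"
    by (simp add: C_def)
  \<comment> \<open>The \<open>X n\<close> are approximate inverses of \<open>H\<close>: the product
    telescopes to \<open>1 - C ^ n\<close>, which converges strongly to \<open>1 - Q\<close> even if
    \<open>H\<close> has no bounded inverse on the range of \<open>1 - Q\<close>.\<close>
  have HX: "H * X n = 1 - C ^ n" for n
  proof -
    have "H * X n = (1 - C) * (\<Sum>k<n. C ^ k)"
      by (simp add: X_def flip: cH)
    also have "\<dots> = 1 - C ^ n"
      by (induction n) (simp_all add: distrib_left, simp add: left_diff_distrib)
    finally show ?thesis .
  qed
  have XH: "X n * H = 1 - C ^ n" for n
  proof -
    have "X n * H = (\<Sum>k<n. C ^ k) * (1 - C)"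
      by (simp add: X_def flip: cH)
    also have "\<dots> = 1 - C ^ n"
      by (induction n) (simp_all add: distrib_right, simp add: right_diff_distrib power_commutes)
    finally show ?thesis .
  qed
  have nAX: "norm (A \<cdot> X n \<cdot> x) = norm (x - C ^ n \<cdot> x)" for n x
    using norm_abs_op[of A "X n \<cdot> x"] HX[of n, THEN arg_cong[where f = "\<lambda>T. T \<cdot> x"]] by (simp add: H_def)
  have conv: "convergent (\<lambda>n. (A * X n) \<cdot> x)" for x
  proof (rule Cauchy_convergent, rule metric_CauchyI)
    fix e :: real assume e: "e > 0"
    have "Cauchy (\<lambda>n. C ^ n \<cdot> x)"
      using lim[of x] by (rule LIMSEQ_imp_Cauchy)
    then obtain M where M: "\<And>m n. m \<ge> M \<Longrightarrow> n \<ge> M \<Longrightarrow> dist (C ^ m \<cdot> x) (C ^ n \<cdot> x) < e"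
      using e unfolding Cauchy_def by blast
    have "dist ((A * X m) \<cdot> x) ((A * X n) \<cdot> x) = dist (C ^ n \<cdot> x) (C ^ m \<cdot> x)" for m n
    proof -
      have "dist ((A * X m) \<cdot> x) ((A * X n) \<cdot> x) = norm (A \<cdot> (X m \<cdot> x - X n \<cdot> x))"
        by (simp add: dist_norm)
      also have "\<dots> = norm (H \<cdot> (X m \<cdot> x - X n \<cdot> x))"
        by (simp only: H_def norm_abs_op)
      also have "\<dots> = norm ((H * X m) \<cdot> x - (H * X n) \<cdot> x)"
        by simp
      also have "\<dots> = dist (C ^ n \<cdot> x) (C ^ m \<cdot> x)"
        by (simp only: HX) (simp add: dist_norm)
      finally show ?thesis .
    qed
    with M show "\<exists>M. \<forall>m\<ge>M. \<forall>n\<ge>M. dist ((A * X m) \<cdot> x) ((A * X n) \<cdot> x) < e"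
      by auto
  qed
  have "norm ((A * X n) \<cdot> x) \<le> 2 * norm x" for n x
    using nAX[of n x] norm_triangle_ineq4[of x "C ^ n \<cdot> x"] contraction_power_norm[OF C, of n x] by simp
  then obtain V where V: "\<And>x. (\<lambda>n. (A * X n) \<cdot> x) \<longlonglongrightarrow> V \<cdot> x"
    using bop_pointwise_limit[OF conv] by blast
  have CN: "C \<in> N"
    unfolding C_def using H N by (auto intro: commutant_diff commutant_one commutant_scaleR)
  have VN: "V \<in> N"
    using commutant_limit[OF N _ V] AN CN N
    by (auto simp: X_def intro!: commutant_mult commutant_scaleR commutant_sum commutant_power)
  have nV: "norm (V \<cdot> x) = norm (x - Q \<cdot> x)" for x
  proof (rule LIMSEQ_unique)
    show "(\<lambda>n. norm ((A * X n) \<cdot> x)) \<longlonglongrightarrow> norm (V \<cdot> x)"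
      by (intro tendsto_intros V)
    show "(\<lambda>n. norm ((A * X n) \<cdot> x)) \<longlonglongrightarrow> norm (x - Q \<cdot> x)"
      by (simp add: nAX) (intro tendsto_intros lim)
  qed
  have Q1: "is_projection (1 - Q)"
    using Q(1) by (rule projection_compl)
  have VV: "star V * V = 1 - Q"
  proof (rule selfadjoint_eqI)
    show "star (1 - Q) = 1 - Q"
      using Q1 by (simp add: is_projection_def)
    show "inner x ((star V * V) \<cdot> x) = inner x ((1 - Q) \<cdot> x)" for x
      unfolding norm_star_mult[symmetric] projection_norm_sq[OF Q1] by (simp add: nV)
  qed simp
  \<comment> \<open>The factorisation of \<open>A\<close> through its modulus is used for the final
    projection: it shows that \<open>star A\<close> vanishes wherever \<open>star V\<close> does,
    and the limit formula for \<open>V\<close> gives the converse.\<close>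
  have VH: "V * H = A"
  proof (rule bop_eqI)
    fix x
    have "(A * X n) \<cdot> H \<cdot> x = A \<cdot> (x - C ^ n \<cdot> x)" for n
      using XH[of n, THEN arg_cong[where f = "\<lambda>T. T \<cdot> x"]] by simp
    moreover have "(\<lambda>n. A \<cdot> (x - C ^ n \<cdot> x)) \<longlonglongrightarrow> A \<cdot> (x - Q \<cdot> x)"
      by (intro tendsto_intros lim)
    moreover have "A \<cdot> Q \<cdot> x = 0"
      unfolding Qeq[symmetric] by simp
    ultimately show "(V * H) \<cdot> x = A \<cdot> x"
      using LIMSEQ_unique[OF V[of "H \<cdot> x"]] by simp
  qed
  have VQ: "V * (1 - Q) = V"
  proof (rule bop_eqI)
    fix x
    have "norm (V \<cdot> Q \<cdot> x) = 0"
      unfolding nV using projection_apply[OF Q(1)] by simp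
    then show "(V * (1 - Q)) \<cdot> x = V \<cdot> x"
      by simp
  qed
  have ker: "star V \<cdot> x = 0 \<longleftrightarrow> star A \<cdot> x = 0" for x
  proof
    assume "star V \<cdot> x = 0"
    moreover have "star A = H * star V"
      using VH[THEN arg_cong[where f = star]] positive_selfadjoint[OF H(1)] by simp
    ultimately show "star A \<cdot> x = 0"
      by simp
  next
    assume *: "star A \<cdot> x = 0"
    have "inner y (star V \<cdot> x) = inner y 0" for y
    proof -
      have "(\<lambda>n. inner ((A * X n) \<cdot> y) x) \<longlonglongrightarrow> inner (V \<cdot> y) x"
        by (intro tendsto_intros V)
      moreover have "inner ((A * X n) \<cdot> y) x = 0" for n
        using inner_star[of A "X n \<cdot> y" x] * by simp
      ultimately have "inner (V \<cdot> y) x = 0"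
        by (simp add: LIMSEQ_const_iff)
      then show ?thesis
        by (simp add: inner_star)
    qed
    then show "star V \<cdot> x = 0"
      by (rule inner_eq_rightI)
  qed
  have "V * star V * (V * star V) = V * (star V * V) * star V"
    by (simp add: mult.assoc)
  also have "\<dots> = V * star V"
    by (simp add: VV VQ)
  finally have "is_projection (V * star V)"
    by (simp add: is_projection_def)
  then have P: "is_projection (1 - V * star V)"
    by (rule projection_compl)
  have "range (bop_apply (1 - V * star V)) = {x. star A \<cdot> x = 0}"
    unfolding projection_range[OF P] ker[symmetric]
    using star_mult_kernel[of "star V"] by simp
  then have "null_proj (star A) = 1 - V * star V"
    unfolding null_proj_def using P by (intro proj_onto_eqI)
  then show ?thesis
    using that[OF VN] VV Qeq by simp
qed

section \<open>The projection onto the nonnegative part\<close>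

text \<open>\<open>abs_op B - B\<close> is twice the negative part of \<open>B\<close>. Its kernel
  contains that of \<open>B\<close>, in agreement with the half-line \<open>{0..}\<close> being
  closed at zero.\<close>

definition nonneg_proj :: "'a::hilbert_space bop \<Rightarrow> 'a bop" where
  "nonneg_proj B = null_proj (abs_op B - B)"

lemma nonneg_proj_projection: "is_projection (nonneg_proj B)"
  unfolding nonneg_proj_def by (rule null_proj_projection)

context
  fixes B :: "'a::hilbert_space bop"
  assumes B: "star B = B"
begin

lemma nonneg_proj_commutant:
  assumes N: "is_commutant N" and BN: "B \<in> N"
  shows "nonneg_proj B \<in> N"
proof -
  have "abs_op B - B \<in> N"
    using assms B by (auto intro!: commutant_diff abs_op_commutant commutant_mult)
  moreover have "star (abs_op B - B) = abs_op B - B"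
    using B positive_selfadjoint[OF abs_op_positive] by simp
  ultimately show ?thesis
    unfolding nonneg_proj_def by (intro null_proj_commutant N) auto
qed

text \<open>If \<open>T\<close> commutes with \<open>B\<close>, then \<open>B\<close> lies in the
  commutant of \<open>{T}\<close>, and hence so does the projection.\<close>

lemma nonneg_proj_commute:
  assumes "T * B = B * T"
  shows "nonneg_proj B * T = T * nonneg_proj B"
  using nonneg_proj_commutant[OF is_commutant_commutant[of "{T}"]] assms by (auto simp: commutant_def)

lemma nonneg_proj_form:
  assumes "nonneg_proj B \<cdot> x = x"
  shows "0 \<le> inner x (B \<cdot> x)"
proof -
  have "B \<cdot> x = abs_op B \<cdot> x"
    using assms unfolding nonneg_proj_def null_proj_fixed_iff by simp
  then show ?thesis
    using positive_inner[OF abs_op_positive] by simp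
qed

text \<open>With \<open>K\<close> the modulus, \<open>(K - B) * (K + B) = 0\<close>, so
  \<open>K + B\<close> maps into the range of the projection. A vector killed by the projection then
  has form minus \<open>inner x (K \<cdot> x)\<close>, which is nonzero because
  \<open>K \<cdot> x = 0\<close> would put \<open>x\<close> into that range.\<close>

lemma nonneg_proj_form_compl:
  assumes Px: "nonneg_proj B \<cdot> x = 0" and x: "x \<noteq> 0"
  shows "inner x (B \<cdot> x) < 0"
proof -
  define K where "K = abs_op B"
  have K: "positive_op K" "K * K = B * B"
    using abs_op_positive[of B] abs_op_square[of B] B by (auto simp: K_def)
  have KB: "K * B = B * K"
    using abs_op_commutant[OF is_commutant_commutant[of "{B}"], of B] B by (simp add: K_def commutant_def mult.assoc)
  have "nonneg_proj B \<cdot> (K + B) \<cdot> x = (K + B) \<cdot> x"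
    unfolding nonneg_proj_def null_proj_fixed_iff K_def[symmetric]
    using K(2) KB by (simp add: algebra_simps flip: bop_apply_simps(7))
  then have "inner ((K + B) \<cdot> x) x = inner ((K + B) \<cdot> x) (nonneg_proj B \<cdot> x)"
    using projection_inner[OF nonneg_proj_projection] by metis
  then have "inner x ((K + B) \<cdot> x) = 0"
    using Px by (simp add: inner_commute)
  then have sum: "inner x (K \<cdot> x) + inner x (B \<cdot> x) = 0"
    by (simp add: inner_add_right)
  have "inner x (K \<cdot> x) \<noteq> 0"
  proof
    assume "inner x (K \<cdot> x) = 0"
    then have Kx: "K \<cdot> x = 0"
      using positive_form_zero[OF K(1)] by blast
    then have "B \<cdot> x = 0"
      using norm_abs_op[of B x] by (simp add: K_def)
    then have "nonneg_proj B \<cdot> x = x"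
      unfolding nonneg_proj_def null_proj_fixed_iff using Kx by (simp add: K_def)
    then show False
      using Px x by simp
  qed
  then show ?thesis
    using sum positive_inner[OF K(1), of x] by linarith
qed

text \<open>As the projections commute, a nonzero value of \<open>R * (1 - P)\<close> or
  \<open>P * (1 - R)\<close> lies in the range of one and the kernel of the other, where the form
  would be both nonnegative and negative. The criterion uses only the form of \<open>B\<close>,
  which is what a spectral measure gives access to.\<close>

lemma nonneg_proj_unique:
  assumes P: "is_projection P" and comm: "P * B = B * P"
    and nonneg: "\<And>x. P \<cdot> x = x \<Longrightarrow> 0 \<le> inner x (B \<cdot> x)"
    and neg: "\<And>x. P \<cdot> x = 0 \<Longrightarrow> x \<noteq> 0 \<Longrightarrow> inner x (B \<cdot> x) < 0"
  shows "P = nonneg_proj B"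
proof -
  define R where "R = nonneg_proj B"
  have R: "is_projection R"
    unfolding R_def by (rule nonneg_proj_projection)
  have c: "R * P = P * R"
    unfolding R_def by (rule nonneg_proj_commute) (rule comm)
  have "(R * (1 - P)) \<cdot> x = 0" for x
  proof (rule ccontr)
    define z where "z = (R * (1 - P)) \<cdot> x"
    assume "(R * (1 - P)) \<cdot> x \<noteq> 0"
    moreover have "P * (R * (1 - P)) = 0"
      using c P by (simp add: is_projection_def algebra_simps) (metis c mult.assoc)
    then have "P \<cdot> z = 0"
      unfolding z_def by (metis bop_apply_simps(1,7))
    moreover have "R \<cdot> z = z"
      unfolding z_def using projection_apply[OF R] by simp
    ultimately show False
      using nonneg_proj_form[of z] neg[of z] by (auto simp: R_def z_def)
  qed
  then have 1: "R * (1 - P) = 0"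
    by (intro bop_eqI) simp
  have "(P * (1 - R)) \<cdot> x = 0" for x
  proof (rule ccontr)
    define z where "z = (P * (1 - R)) \<cdot> x"
    assume "(P * (1 - R)) \<cdot> x \<noteq> 0"
    moreover have "R * (P * (1 - R)) = 0"
      using c R by (simp add: is_projection_def algebra_simps) (metis c mult.assoc)
    then have "R \<cdot> z = 0"
      unfolding z_def by (metis bop_apply_simps(1,7))
    moreover have "P \<cdot> z = z"
      unfolding z_def using projection_apply[OF P] by simp
    ultimately show False
      using nonneg_proj_form_compl[of z] nonneg[of z] by (auto simp: R_def z_def)
  qed
  then have "P * (1 - R) = 0"
    by (intro bop_eqI) simp
  with 1 c show ?thesis
    by (simp add: R_def algebra_simps)
qed

end

section \<open>The spectral theorem\<close>

text \<open>The squared norms of \<open>T n \<cdot> x\<close> increase and are bounded, and by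
  Pythagoras their differences are the squared norms of the differences of the vectors.\<close>

lemma monotone_projections_limit:
  fixes T :: "nat \<Rightarrow> 'a::hilbert_space bop"
  assumes T: "\<And>n. is_projection (T n)" and mono: "\<And>m n. m \<le> n \<Longrightarrow> T n * T m = T m"
  obtains L where "is_projection L" "\<And>x. (\<lambda>n. T n \<cdot> x) \<longlonglongrightarrow> L \<cdot> x"
proof -
  have mono': "T m * T n = T m" if "m \<le> n" for m n
  proof -
    have "T m * T n = star (T n * T m)"
      using T by (simp add: is_projection_def)
    also have "\<dots> = T m"
      unfolding mono[OF that] using T by (simp add: is_projection_def)
    finally show ?thesis .
  qed
  have diff: "(norm (T n \<cdot> x - T m \<cdot> x))\<^sup>2 = (norm (T n \<cdot> x))\<^sup>2 - (norm (T m \<cdot> x))\<^sup>2" if "m \<le> n" for m n x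
  proof -
    have "T m \<cdot> T n \<cdot> x = T m \<cdot> x"
      using mono'[OF that] by (simp flip: bop_apply_simps(7))
    then show ?thesis
      using projection_pythagoras[OF T[of m], of "T n \<cdot> x"] by simp
  qed
  have conv: "convergent (\<lambda>n. T n \<cdot> x)" for x
  proof (rule Cauchy_convergent)
    define a where "a n = (norm (T n \<cdot> x))\<^sup>2" for n
    have inc: "a m \<le> a n" if "m \<le> n" for m n
      using diff[OF that, of x] zero_le_power2[of "norm (T n \<cdot> x - T m \<cdot> x)"]
      unfolding a_def by linarith
    have bd: "a n \<le> (norm x)\<^sup>2" for n
      unfolding a_def by (intro power_mono projection_norm_le T) simp
    have "incseq a"
      using inc by (simp add: incseq_def)
    then obtain l where l: "a \<longlonglongrightarrow> l"
      by (rule incseq_convergent[where B = "(norm x)\<^sup>2"]) (auto simp: bd)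
    show "Cauchy (\<lambda>n. T n \<cdot> x)"
    proof (rule CauchyI')
      fix e :: real assume e: "e > 0"
      then have "e\<^sup>2 / 2 > 0"
        by simp
      then obtain M where M: "\<And>n. n \<ge> M \<Longrightarrow> \<bar>a n - l\<bar> < e\<^sup>2 / 2"
        using LIMSEQ_D[OF l, of "e\<^sup>2 / 2"] by (auto simp: real_norm_def)
      show "\<exists>M. \<forall>m\<ge>M. \<forall>n>m. dist (T m \<cdot> x) (T n \<cdot> x) < e"
      proof (intro exI allI impI)
        fix m n assume mn: "m \<ge> M" "n > m"
        then have "a n - a m < e\<^sup>2"
          using M[of m] M[of n] by linarith
        then have "(norm (T n \<cdot> x - T m \<cdot> x))\<^sup>2 < e\<^sup>2"
          using diff[of m n x] mn by (simp add: a_def)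
        then show "dist (T m \<cdot> x) (T n \<cdot> x) < e"
          using e by (simp add: dist_norm norm_minus_commute power_less_imp_less_base)
      qed
    qed
  qed
  obtain L where L: "\<And>x. (\<lambda>n. T n \<cdot> x) \<longlonglongrightarrow> L \<cdot> x"
    using bop_pointwise_limit[OF conv, of 1] projection_norm_le[OF T] by auto
  have "star L = L"
  proof (rule star_eqI, rule LIMSEQ_unique)
    fix x y
    show "(\<lambda>n. inner (T n \<cdot> x) y) \<longlonglongrightarrow> inner (L \<cdot> x) y"
      by (intro tendsto_intros L)
    show "(\<lambda>n. inner (T n \<cdot> x) y) \<longlonglongrightarrow> inner x (L \<cdot> y)"
      unfolding projection_inner[OF T] by (intro tendsto_intros L)
  qed
  moreover have "L * L = L"
  proof (rule bop_eqI)
    fix x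
    have "L \<cdot> T m \<cdot> x = T m \<cdot> x" for m
    proof (rule LIMSEQ_unique[OF L])
      have "T n \<cdot> T m \<cdot> x = T m \<cdot> x" if "n \<ge> m" for n
        using mono[OF that] by (simp flip: bop_apply_simps(7))
      then show "(\<lambda>n. T n \<cdot> T m \<cdot> x) \<longlonglongrightarrow> T m \<cdot> x"
        by (intro tendsto_eventually eventually_sequentiallyI[of m])
    qed
    then have "(\<lambda>m. T m \<cdot> x) \<longlonglongrightarrow> L \<cdot> L \<cdot> x"
      using tendsto_bop[OF L[of x], of L] by simp
    then have "L \<cdot> L \<cdot> x = L \<cdot> x"
      by (rule LIMSEQ_unique[OF _ L[of x]])
    then show "(L * L) \<cdot> x = L \<cdot> x"
      by simp
  qed
  ultimately show ?thesis
    using that L by (simp add: is_projection_def)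
qed

text \<open>The partial sums satisfy \<open>T m * T n = T (min m n)\<close> and so form an
  increasing chain of projections. The summation of squared norms is what makes scalar measures
  countably additive.\<close>

lemma orthogonal_projections_sum:
  fixes Q :: "nat \<Rightarrow> 'a::hilbert_space bop"
  assumes Q: "\<And>n. is_projection (Q n)" and orth: "\<And>m n. m \<noteq> n \<Longrightarrow> Q m * Q n = 0"
  obtains L where "is_projection L" "\<And>x. (\<lambda>n. Q n \<cdot> x) sums (L \<cdot> x)"
    "\<And>x. (\<lambda>n. (norm (Q n \<cdot> x))\<^sup>2) sums (norm (L \<cdot> x))\<^sup>2"
proof -
  define T where "T n = (\<Sum>k<n. Q k)" for n
  have QT: "Q m * T n = (if m < n then Q m else 0)" for m n
  proof -
    have "Q m * T n = (\<Sum>k<n. if k = m then Q m else 0)"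
      unfolding T_def sum_distrib_left
      using Q orth by (intro sum.cong) (auto simp: is_projection_def)
    then show ?thesis by simp
  qed
  have TT: "T m * T n = T (min m n)" for m n
  proof -
    have "T m * T n = (\<Sum>k<m. if k < n then Q k else 0)"
      by (subst T_def) (simp add: sum_distrib_right QT)
    also have "\<dots> = (\<Sum>k\<in>{..<m} \<inter> {k. k < n}. Q k)"
      by (subst sum.inter_restrict) auto
    also have "{..<m} \<inter> {k. k < n} = {..<min m n}"
      by auto
    finally show ?thesis
      by (simp add: T_def)
  qed
  have T: "is_projection (T n)" for n
    using Q by (simp add: is_projection_def TT) (simp add: T_def)
  have mono: "T n * T m = T m" if "m \<le> n" for m n
    using that by (simp add: TT min_absorb2)
  obtain L where L: "is_projection L" "\<And>x. (\<lambda>n. T n \<cdot> x) \<longlonglongrightarrow> L \<cdot> x"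
    by (rule monotone_projections_limit[of T, OF T]) (erule mono, rule that)
  have norm_T: "(norm (T n \<cdot> x))\<^sup>2 = (\<Sum>k<n. (norm (Q k \<cdot> x))\<^sup>2)" for n x
    unfolding projection_norm_sq[OF T, symmetric] projection_norm_sq[OF Q, symmetric]
    by (simp add: T_def inner_sum_right)
  show ?thesis
  proof
    show "(\<lambda>n. Q n \<cdot> x) sums (L \<cdot> x)" for x
      using L(2)[of x] by (simp add: sums_def T_def)
    show "(\<lambda>n. (norm (Q n \<cdot> x))\<^sup>2) sums (norm (L \<cdot> x))\<^sup>2" for x
      unfolding sums_def norm_T[symmetric] by (intro tendsto_intros L)
  qed (rule L)
qed

subsection \<open>Uniqueness of the spectral projection\<close>

context
  fixes B :: "'a::hilbert_space bop" and E :: "real set \<Rightarrow> 'a bop"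
  assumes E: "is_spectral_measure B E" and B: "star B = B"
begin

definition scalar_measure :: "'a \<Rightarrow> real measure" where
  "scalar_measure x = measure_of UNIV (sets borel) (\<lambda>S. ennreal ((norm (E S \<cdot> x))\<^sup>2))"

lemma spectral_proj: "S \<in> sets borel \<Longrightarrow> is_projection (E S)"
  using E by (simp add: is_spectral_measure_def)

lemma spectral_UNIV: "E UNIV = 1"
  using E by (simp add: is_spectral_measure_def)

lemma spectral_Int: "S \<in> sets borel \<Longrightarrow> T \<in> sets borel \<Longrightarrow> E (S \<inter> T) = E S * E T"
  using E by (simp add: is_spectral_measure_def)

lemma spectral_sums:
  "range A \<subseteq> sets borel \<Longrightarrow> disjoint_family A \<Longrightarrow>
    (\<lambda>n. E (A n) \<cdot> x) sums (E (\<Union>n. A n) \<cdot> x)" for A :: "nat \<Rightarrow> real set"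
  using E by (simp add: is_spectral_measure_def)

lemma spectral_form: "inner x (B \<cdot> x) = integral\<^sup>L (scalar_measure x) (\<lambda>l. l)"
  using E by (simp add: is_spectral_measure_def scalar_measure_def inner_eq_Re_cinner)

lemma spectral_empty: "E {} = 0"
proof (rule bop_eqI)
  fix x
  have "(\<lambda>n. E {} \<cdot> x) sums (E (\<Union>n::nat. {}) \<cdot> x)"
    by (rule spectral_sums) (auto simp: disjoint_family_on_def)
  then have "(\<lambda>n::nat. E {} \<cdot> x) \<longlonglongrightarrow> 0"
    by (rule summable_LIMSEQ_zero[OF sums_summable])
  then show "E {} \<cdot> x = 0 \<cdot> x"
    by (simp add: LIMSEQ_const_iff)
qed

text \<open>Disjoint sets have orthogonal projections, so the strong additivity demanded of
  \<open>E\<close> passes to squared norms.\<close>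

lemma spectral_norm_sums:
  assumes A: "range A \<subseteq> sets borel" "disjoint_family (A :: nat \<Rightarrow> real set)"
  shows "(\<lambda>n. (norm (E (A n) \<cdot> x))\<^sup>2) sums (norm (E (\<Union>n. A n) \<cdot> x))\<^sup>2"
proof -
  have orth: "E (A m) * E (A n) = 0" if "m \<noteq> n" for m n
    using spectral_Int[of "A m" "A n"] A that spectral_empty
    by (auto simp: disjoint_family_on_def)
  have proj: "is_projection (E (A n))" for n
    using spectral_proj A(1) by auto
  obtain L where L1: "\<And>x. (\<lambda>n. E (A n) \<cdot> x) sums (L \<cdot> x)"
    and L2: "\<And>x. (\<lambda>n. (norm (E (A n) \<cdot> x))\<^sup>2) sums (norm (L \<cdot> x))\<^sup>2"
    by (rule orthogonal_projections_sum[of "\<lambda>n. E (A n)", OF proj]) (erule orth, rule that)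
  have "L \<cdot> x = E (\<Union>n. A n) \<cdot> x"
    by (rule sums_unique2[OF L1 spectral_sums[OF A]])
  with L2[of x] show ?thesis by simp
qed

lemma sets_scalar_measure [simp, measurable_cong]: "sets (scalar_measure x) = sets borel"
  using sets.sigma_sets_eq[of borel] by (simp add: scalar_measure_def sets_measure_of_conv)

lemma space_scalar_measure [simp]: "space (scalar_measure x) = UNIV"
  by (simp add: scalar_measure_def space_measure_of_conv)

text \<open>\<open>measure_of\<close> yields the zero measure unless its argument is countably
  additive; only after this check does the integral in \<open>is_spectral_measure\<close> refer to
  the intended measure.\<close>

lemma emeasure_scalar_measure:
  assumes "S \<in> sets borel"
  shows "emeasure (scalar_measure x) S = ennreal ((norm (E S \<cdot> x))\<^sup>2)"
  unfolding scalar_measure_def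
proof (rule emeasure_measure_of_sigma)
  show "sigma_algebra UNIV (sets (borel :: real measure))"
    using sets.sigma_algebra_axioms[of "borel :: real measure"] by simp
  show "positive (sets borel) (\<lambda>S. ennreal ((norm (E S \<cdot> x))\<^sup>2))"
    by (simp add: positive_def spectral_empty)
  show "countably_additive (sets borel) (\<lambda>S. ennreal ((norm (E S \<cdot> x))\<^sup>2))"
    unfolding countably_additive_def
    by (intro allI impI suminf_ennreal_eq spectral_norm_sums) auto
qed (rule assms)

lemma finite_scalar_measure: "finite_measure (scalar_measure x)"
  by (rule finite_measureI) (simp add: emeasure_scalar_measure)

lemma scalar_measure_AE:
  assumes S: "S \<in> sets borel" and x: "E S \<cdot> x = x"
  shows "AE l in scalar_measure x. l \<in> S"
proof (rule AE_I)
  have "E (- S) \<cdot> x = E (- S) \<cdot> E S \<cdot> x"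
    by (simp add: x)
  also have "\<dots> = E (- S \<inter> S) \<cdot> x"
    using spectral_Int[of "- S" S] S by simp
  also have "\<dots> = 0"
    by (simp add: spectral_empty)
  finally show "emeasure (scalar_measure x) (- S) = 0"
    using S by (simp add: emeasure_scalar_measure)
qed (use S in auto)

lemma integrable_scalar_measure: "integrable (scalar_measure x) (\<lambda>l. l)"
proof -
  obtain M where M: "E {-M..M} = 1"
    using E by (auto simp: is_spectral_measure_def)
  have "AE l in scalar_measure x. l \<in> {-M..M}"
    by (rule scalar_measure_AE) (auto simp: M)
  then have "AE l in scalar_measure x. norm l \<le> M"
    by eventually_elim auto
  then show ?thesis
    by (rule finite_measure.integrable_const_bound[OF finite_scalar_measure]) simp
qed

text \<open>Only the quadratic form of \<open>B\<close> is known. The scalar measure of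
  \<open>E R \<cdot> z\<close> is that of \<open>z\<close> restricted to \<open>R\<close>, so the
  form splits over \<open>S\<close> and its complement, and this removes the off-diagonal blocks of
  \<open>B\<close>.\<close>

lemma spectral_commute:
  assumes S: "S \<in> sets borel"
  shows "E S * B = B * E S"
proof -
  let ?P = "E S"
  have P: "is_projection ?P"
    using S by (rule spectral_proj)
  have compl: "E (- S) = 1 - ?P"
  proof (rule bop_eqI)
    fix x
    have "(\<lambda>n. E (binaryset S (- S) n) \<cdot> x) sums (E (\<Union>n. binaryset S (- S) n) \<cdot> x)"
      using S by (intro spectral_sums) (auto simp: range_binaryset_eq disjoint_family_on_def binaryset_def)
    then have "(\<lambda>n. E (binaryset S (- S) n) \<cdot> x) sums x"
      by (simp add: UN_binaryset_eq spectral_UNIV)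
    moreover have "(\<lambda>n. E (binaryset S (- S) n) \<cdot> x) sums (\<Sum>n<2. E (binaryset S (- S) n) \<cdot> x)"
      by (rule sums_finite) (auto simp: binaryset_def spectral_empty)
    ultimately have "x = (\<Sum>n<2. E (binaryset S (- S) n) \<cdot> x)"
      by (rule sums_unique2)
    then have "x = ?P \<cdot> x + E (- S) \<cdot> x"
      by (simp add: numeral_2_eq_2 binaryset_def)
    then have "x - ?P \<cdot> x = ?P \<cdot> x + E (- S) \<cdot> x - ?P \<cdot> x"
      by (rule arg_cong)
    then show "E (- S) \<cdot> x = (1 - ?P) \<cdot> x"
      by simp
  qed
  have restrict: "integral\<^sup>L (scalar_measure (E R \<cdot> z)) (\<lambda>l. l)
      = integral\<^sup>L (scalar_measure z) (\<lambda>l. indicator R l * l)" if R: "R \<in> sets borel" for R z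
  proof -
    have "scalar_measure (E R \<cdot> z) = density (scalar_measure z) (\<lambda>l. ennreal (indicator R l))"
    proof (rule measure_eqI)
      fix T assume "T \<in> sets (scalar_measure (E R \<cdot> z))"
      then have T: "T \<in> sets borel" by simp
      have "emeasure (density (scalar_measure z) (\<lambda>l. ennreal (indicator R l))) T
          = (\<integral>\<^sup>+ l. ennreal (indicator R l) * indicator T l \<partial>scalar_measure z)"
        using R T by (intro emeasure_density) auto
      also have "\<dots> = (\<integral>\<^sup>+ l. indicator (T \<inter> R) l \<partial>scalar_measure z)"
        by (intro nn_integral_cong) (auto split: split_indicator)
      also have "\<dots> = emeasure (scalar_measure z) (T \<inter> R)"
        using R T by (intro nn_integral_indicator) auto
      also have "\<dots> = emeasure (scalar_measure (E R \<cdot> z)) T"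
        using R T by (simp add: emeasure_scalar_measure spectral_Int)
      finally show "emeasure (scalar_measure (E R \<cdot> z)) T
          = emeasure (density (scalar_measure z) (\<lambda>l. ennreal (indicator R l))) T" ..
    qed simp
    then show ?thesis
      using R by (simp add: integral_density)
  qed
  have int: "integrable (scalar_measure z) (\<lambda>l. indicator R l * l)" if "R \<in> sets borel" for R z
    using integrable_real_mult_indicator[OF _ integrable_scalar_measure[of z], of R] that
    by (simp add: mult.commute)
  have split: "inner z (B \<cdot> z) = inner (?P \<cdot> z) (B \<cdot> ?P \<cdot> z) + inner ((1 - ?P) \<cdot> z) (B \<cdot> (1 - ?P) \<cdot> z)" for z
  proof -
    have "integral\<^sup>L (scalar_measure z) (\<lambda>l. l)
        = integral\<^sup>L (scalar_measure z) (\<lambda>l. indicator S l * l + indicator (- S) l * l)"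
      by (intro Bochner_Integration.integral_cong) (auto split: split_indicator)
    also have "\<dots> = integral\<^sup>L (scalar_measure z) (\<lambda>l. indicator S l * l)
        + integral\<^sup>L (scalar_measure z) (\<lambda>l. indicator (- S) l * l)"
      using S by (intro Bochner_Integration.integral_add int) auto
    finally show ?thesis
      unfolding spectral_form compl[symmetric] using S by (simp add: restrict)
  qed
  \<comment> \<open>At the vector \<open>z\<close> below, the splitting leaves two cross terms with
    sum zero, and self-adjointness makes them equal.\<close>
  have cross: "inner ((1 - ?P) \<cdot> u) (B \<cdot> ?P \<cdot> v) = 0" for u v
  proof -
    define z where "z = ?P \<cdot> v + (1 - ?P) \<cdot> u"
    have z: "?P \<cdot> z = ?P \<cdot> v" "(1 - ?P) \<cdot> z = (1 - ?P) \<cdot> u"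
      using projection_apply[OF P] by (auto simp: z_def)
    have "inner (?P \<cdot> v) (B \<cdot> (1 - ?P) \<cdot> u) = inner ((1 - ?P) \<cdot> u) (B \<cdot> ?P \<cdot> v)"
      using selfadjoint_inner[OF B, of "?P \<cdot> v" "(1 - ?P) \<cdot> u"] by (simp add: inner_commute del: bop_apply_simps)
    then show ?thesis
      using split[of z] unfolding z unfolding z_def
      by (simp add: inner_add_left inner_add_right del: bop_apply_simps)
  qed
  have "(1 - ?P) * (B * ?P) = 0"
  proof (rule bop_eqI, rule inner_eq_rightI)
    fix v u
    show "inner u (((1 - ?P) * (B * ?P)) \<cdot> v) = inner u (0 \<cdot> v)"
      using cross[of u v] projection_inner[OF projection_compl[OF P], of u "B \<cdot> ?P \<cdot> v"]
      by (simp only: bop_apply_simps(1,7) inner_zero_right)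
  qed
  then have BP: "B * ?P = ?P * B * ?P"
    by (simp add: left_diff_distrib mult.assoc)
  then have "star (B * ?P) = star (?P * B * ?P)"
    by simp
  then have "?P * B = ?P * B * ?P"
    using P B by (simp add: is_projection_def mult.assoc)
  with BP show ?thesis
    by simp
qed

text \<open>On the range of \<open>E {0..}\<close> the scalar measure lives on nonnegative numbers.
  On its kernel it lives on negative ones and has positive total mass, so the integral is strictly
  negative. These are the two form conditions of \<open>nonneg_proj_unique\<close>.\<close>

lemma spectral_projection_nonneg: "E {0..} = nonneg_proj B"
proof (rule nonneg_proj_unique[OF B])
  show "is_projection (E {0..})"
    by (rule spectral_proj) simp
  show "E {0..} * B = B * E {0..}"
    by (rule spectral_commute) simp
  fix x
  show "0 \<le> inner x (B \<cdot> x)" if "E {0..} \<cdot> x = x"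
    unfolding spectral_form
    by (rule integral_nonneg_AE) (use scalar_measure_AE[OF _ that] in auto)
  show "inner x (B \<cdot> x) < 0" if 0: "E {0..} \<cdot> x = 0" and x: "x \<noteq> 0"
  proof -
    have null: "emeasure (scalar_measure x) {0..} = 0"
      using 0 by (simp add: emeasure_scalar_measure)
    then have neg: "AE l in scalar_measure x. l < 0"
      by (intro AE_I[of _ _ "{0..}"]) auto
    have int: "integrable (scalar_measure x) (\<lambda>l. - l)"
      using integrable_scalar_measure by simp
    have "integral\<^sup>L (scalar_measure x) (\<lambda>l. - l) \<ge> 0"
      by (rule integral_nonneg_AE) (use neg in auto)
    moreover have "integral\<^sup>L (scalar_measure x) (\<lambda>l. - l) \<noteq> 0"
    proof
      assume "integral\<^sup>L (scalar_measure x) (\<lambda>l. - l) = 0"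
      then have "AE l in scalar_measure x. - l = 0"
        using neg by (subst (asm) integral_nonneg_eq_0_iff_AE[OF int]) auto
      with neg have "AE l in scalar_measure x. False"
        by eventually_elim auto
      then have "emeasure (scalar_measure x) UNIV = 0"
        using AE_iff_measurable[of UNIV "scalar_measure x" "\<lambda>_. False"] by simp
      then show False
        using x by (simp add: emeasure_scalar_measure spectral_UNIV)
    qed
    ultimately show ?thesis
      unfolding spectral_form by simp
  qed
qed

end

subsection \<open>Existence of the spectral measure\<close>

text \<open>A function with increments of second order is constant: subdivision into equal steps
  gains the factor \<open>1 / real (Suc n)\<close>, while the increments of \<open>F\<close>
  telescope. This replaces Riemann sums when the form of \<open>B\<close> is compared with an
  integral.\<close>

lemma eq_if_increment_le:
  fixes g F :: "real \<Rightarrow> real"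
  assumes inc: "\<And>a b. a \<le> b \<Longrightarrow> \<bar>g b - g a\<bar> \<le> (b - a) * (F b - F a)" and ab: "a \<le> b"
  shows "g a = g b"
proof -
  have le: "\<bar>g b - g a\<bar> \<le> (b - a) / real (Suc n) * (F b - F a)" for n
  proof -
    define h where "h = (b - a) / real (Suc n)"
    have h: "h \<ge> 0"
      using ab by (simp add: h_def)
    have "\<bar>g (a + real k * h) - g a\<bar> \<le> h * (F (a + real k * h) - F a)" for k
    proof (induction k)
      case (Suc k)
      let ?x = "a + real k * h" and ?y = "a + real (Suc k) * h"
      have "\<bar>g ?y - g ?x\<bar> \<le> h * (F ?y - F ?x)"
        using inc[of ?x ?y] h by (simp add: algebra_simps)
      then have "\<bar>g ?y - g a\<bar> \<le> h * (F ?y - F ?x) + h * (F ?x - F a)"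
        using Suc by linarith
      then show ?case
        by (simp only: right_diff_distrib)
    qed simp
    from this[of "Suc n"] show ?thesis
      by (simp add: h_def)
  qed
  have "(\<lambda>n. (b - a) * (F b - F a) / real (Suc n)) \<longlonglongrightarrow> 0"
    by (rule LIMSEQ_Suc[OF lim_const_over_n])
  then have "\<bar>g b - g a\<bar> \<le> 0"
    by (rule LIMSEQ_le_const) (use le in \<open>auto simp: field_simps\<close>)
  then show ?thesis
    by simp
qed

context
  fixes B :: "'a::hilbert_space bop"
  assumes B: "star B = B"
begin

text \<open>The spectral projection of \<open>B\<close> for \<open>{..l}\<close>, the part on which
  \<open>l *\<^sub>R 1 - B\<close> is nonnegative.\<close>

definition spectral_family :: "real \<Rightarrow> 'a bop" where
  "spectral_family l = nonneg_proj (l *\<^sub>R 1 - B)"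

lemma shifted_selfadjoint: "star (l *\<^sub>R 1 - B) = l *\<^sub>R 1 - B"
  by (simp add: B)

lemma family_projection: "is_projection (spectral_family l)"
  unfolding spectral_family_def by (rule nonneg_proj_projection)

lemma family_commute:
  assumes "T * B = B * T"
  shows "spectral_family l * T = T * spectral_family l"
  unfolding spectral_family_def
  by (rule nonneg_proj_commute[OF shifted_selfadjoint]) (simp add: algebra_simps assms)

lemma family_commute_B: "spectral_family l * B = B * spectral_family l"
  by (rule family_commute) simp

lemma family_commute_family: "spectral_family l * spectral_family m = spectral_family m * spectral_family l"
  by (rule family_commute) (rule family_commute_B)

lemma family_form_le: "spectral_family l \<cdot> x = x \<Longrightarrow> inner x (B \<cdot> x) \<le> l * (norm x)\<^sup>2"
  using nonneg_proj_form[OF shifted_selfadjoint, of l x]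
  by (simp add: spectral_family_def inner_diff_right power2_norm_eq_inner)

lemma family_form_gt: "spectral_family l \<cdot> x = 0 \<Longrightarrow> x \<noteq> 0 \<Longrightarrow> l * (norm x)\<^sup>2 < inner x (B \<cdot> x)"
  using nonneg_proj_form_compl[OF shifted_selfadjoint, of l x]
  by (simp add: spectral_family_def inner_diff_right power2_norm_eq_inner)

lemma family_form_ge: "spectral_family l \<cdot> x = 0 \<Longrightarrow> l * (norm x)\<^sup>2 \<le> inner x (B \<cdot> x)"
  using family_form_gt[of l x] by (cases "x = 0") auto

text \<open>A nonzero vector fixed by the projection at \<open>l\<close> and killed by the one at
  \<open>m\<close> would have form at most \<open>l\<close> and greater than \<open>m\<close> times
  its squared norm.\<close>

lemma family_mono:
  assumes "l \<le> m"
  shows "spectral_family m * spectral_family l = spectral_family l"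
proof (rule bop_eqI)
  fix x
  define z where "z = spectral_family l \<cdot> x - spectral_family m \<cdot> spectral_family l \<cdot> x"
  have "spectral_family l \<cdot> spectral_family m \<cdot> spectral_family l \<cdot> x
      = spectral_family m \<cdot> spectral_family l \<cdot> spectral_family l \<cdot> x"
    using family_commute_family[of l m, THEN arg_cong[where f = "\<lambda>T. T \<cdot> spectral_family l \<cdot> x"]] by simp
  then have 1: "spectral_family l \<cdot> z = z"
    by (simp add: z_def projection_apply[OF family_projection])
  have 2: "spectral_family m \<cdot> z = 0"
    by (simp add: z_def projection_apply[OF family_projection])
  have "z = 0"
  proof (rule ccontr)
    assume "z \<noteq> 0"
    then have "m * (norm z)\<^sup>2 < l * (norm z)\<^sup>2"
      using family_form_le[OF 1] family_form_gt[OF 2] by linarith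
    then show False
      using assms by (simp add: mult_less_cancel_right)
  qed
  then show "(spectral_family m * spectral_family l) \<cdot> x = spectral_family l \<cdot> x"
    by (simp add: z_def)
qed

lemma family_mono': "l \<le> m \<Longrightarrow> spectral_family l * spectral_family m = spectral_family l"
  using family_mono[of l m] family_commute_family[of l m] by simp

lemma form_bounds: "\<bar>inner x (B \<cdot> x)\<bar> \<le> norm B * (norm x)\<^sup>2"
proof -
  have "\<bar>inner x (B \<cdot> x)\<bar> \<le> norm x * norm (B \<cdot> x)"
    by (rule Cauchy_Schwarz_ineq2)
  also have "\<dots> \<le> norm x * (norm B * norm x)"
    by (intro mult_left_mono norm_bop_apply) simp
  finally show ?thesis
    by (simp add: power2_eq_square algebra_simps)
qed

lemma family_eq_1: "norm B \<le> l \<Longrightarrow> spectral_family l = 1"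
proof (rule bop_eqI, rule ccontr)
  fix x
  assume l: "norm B \<le> l" and ne: "spectral_family l \<cdot> x \<noteq> 1 \<cdot> x"
  define z where "z = x - spectral_family l \<cdot> x"
  have "spectral_family l \<cdot> z = 0" "z \<noteq> 0"
    using ne by (auto simp: z_def projection_apply[OF family_projection])
  then have "l * (norm z)\<^sup>2 < norm B * (norm z)\<^sup>2"
    using family_form_gt[of l z] form_bounds[of z] by linarith
  then show False
    using l by (simp add: mult_less_cancel_right)
qed

text \<open>Strictness matters: if \<open>- norm B\<close> is an eigenvalue, the projection at
  \<open>l = - norm B\<close> contains its eigenvectors.\<close>

lemma family_eq_0: "l < - norm B \<Longrightarrow> spectral_family l = 0"
proof (rule bop_eqI, rule ccontr)
  fix x
  assume l: "l < - norm B" and ne: "spectral_family l \<cdot> x \<noteq> 0 \<cdot> x"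
  define z where "z = spectral_family l \<cdot> x"
  have z: "spectral_family l \<cdot> z = z" "z \<noteq> 0"
    using ne by (auto simp: z_def projection_apply[OF family_projection])
  then have "- norm B * (norm z)\<^sup>2 \<le> l * (norm z)\<^sup>2"
    using family_form_le[OF z(1)] form_bounds[of z] by simp
  moreover have "l * (norm z)\<^sup>2 < - norm B * (norm z)\<^sup>2"
    using z(2) by (intro mult_strict_right_mono l) simp
  ultimately show False
    by simp
qed

definition family_distr :: "'a \<Rightarrow> real \<Rightarrow> real" where
  "family_distr x l = (norm (spectral_family l \<cdot> x))\<^sup>2"

lemma family_diff_norm:
  assumes "l \<le> m"
  shows "(norm (spectral_family m \<cdot> x - spectral_family l \<cdot> x))\<^sup>2 = family_distr x m - family_distr x l"
proof -
  have "spectral_family l \<cdot> spectral_family m \<cdot> x = spectral_family l \<cdot> x"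
    using family_mono'[OF assms] by (simp flip: bop_apply_simps(7))
  then show ?thesis
    using projection_pythagoras[OF family_projection[of l], of "spectral_family m \<cdot> x"]
    by (simp add: family_distr_def)
qed

lemma family_distr_mono: "l \<le> m \<Longrightarrow> family_distr x l \<le> family_distr x m"
  using family_diff_norm[of l m x] zero_le_power2[of "norm (spectral_family m \<cdot> x - spectral_family l \<cdot> x)"]
  by linarith

text \<open>The limit \<open>z\<close> exists because the complements increase. Its difference
  \<open>y\<close> from the value at \<open>a\<close> is killed by the projection at
  \<open>a\<close>, so a nonzero \<open>y\<close> would have form above \<open>a\<close> times its
  squared norm; but \<open>y\<close> is fixed by the projection at every \<open>b > a\<close>, which
  forbids this.\<close>

lemma family_right_limit: "(\<lambda>n. spectral_family (a + 1 / real (Suc n)) \<cdot> x) \<longlonglongrightarrow> spectral_family a \<cdot> x"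
proof -
  define T where "T n = 1 - spectral_family (a + 1 / real (Suc n))" for n
  have T: "is_projection (T n)" for n
    unfolding T_def by (intro projection_compl family_projection)
  have mono: "T n * T m = T m" if "m \<le> n" for m n
  proof -
    have "a + 1 / real (Suc n) \<le> a + 1 / real (Suc m)"
      using that by (simp add: field_simps)
    then show ?thesis
      unfolding T_def using family_mono' by (simp add: algebra_simps)
  qed
  obtain L where L: "\<And>x. (\<lambda>n. T n \<cdot> x) \<longlonglongrightarrow> L \<cdot> x"
    by (rule monotone_projections_limit[of T, OF T]) (erule mono, rule that)
  define z where "z = x - L \<cdot> x"
  have z: "(\<lambda>n. spectral_family (a + 1 / real (Suc n)) \<cdot> x) \<longlonglongrightarrow> z"
    using tendsto_diff[OF tendsto_const[of x] L[of x]] by (simp add: T_def z_def)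
  define y where "y = z - spectral_family a \<cdot> x"
  have "spectral_family a \<cdot> y = 0"
  proof -
    have "spectral_family a \<cdot> spectral_family (a + 1 / real (Suc n)) \<cdot> x = spectral_family a \<cdot> x" for n
      using family_mono'[of a "a + 1 / real (Suc n)"] by (simp flip: bop_apply_simps(7))
    then have "(\<lambda>n::nat. spectral_family a \<cdot> x) \<longlonglongrightarrow> spectral_family a \<cdot> z"
      using tendsto_bop[OF z, of "spectral_family a"] by simp
    then have "spectral_family a \<cdot> x = spectral_family a \<cdot> z"
      by (simp add: LIMSEQ_const_iff)
    then show ?thesis
      by (simp add: y_def projection_apply[OF family_projection])
  qed
  moreover have le: "inner y (B \<cdot> y) \<le> b * (norm y)\<^sup>2" if "b > a" for b
  proof (rule family_form_le)
    have "spectral_family b \<cdot> z = z"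
    proof (rule LIMSEQ_unique[OF tendsto_bop[OF z]])
      obtain M where M: "inverse (real (Suc M)) < b - a"
        using reals_Archimedean[of "b - a"] \<open>b > a\<close> by auto
      have "spectral_family b \<cdot> spectral_family (a + 1 / real (Suc n)) \<cdot> x
          = spectral_family (a + 1 / real (Suc n)) \<cdot> x" if "n \<ge> M" for n
      proof -
        have "1 / real (Suc n) \<le> inverse (real (Suc M))"
          using that by (simp add: field_simps)
        then have "a + 1 / real (Suc n) \<le> b"
          using M by linarith
        from family_mono[OF this] show ?thesis
          by (simp flip: bop_apply_simps(7))
      qed
      then have "eventually (\<lambda>n. spectral_family (a + 1 / real (Suc n)) \<cdot> x
          = spectral_family b \<cdot> spectral_family (a + 1 / real (Suc n)) \<cdot> x) sequentially"
        by (intro eventually_sequentiallyI[of M]) simp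
      then show "(\<lambda>n. spectral_family b \<cdot> spectral_family (a + 1 / real (Suc n)) \<cdot> x) \<longlonglongrightarrow> z"
        by (rule Lim_transform_eventually[OF z])
    qed
    then show "spectral_family b \<cdot> y = y"
      using family_mono[of a b] that by (simp add: y_def flip: bop_apply_simps(7))
  qed
  have "inner y (B \<cdot> y) \<le> a * (norm y)\<^sup>2"
  proof (rule LIMSEQ_le_const)
    show "(\<lambda>n. (a + 1 / real (Suc n)) * (norm y)\<^sup>2) \<longlonglongrightarrow> a * (norm y)\<^sup>2"
      using tendsto_mult[OF tendsto_add[OF tendsto_const LIMSEQ_Suc[OF lim_1_over_n]] tendsto_const, of a "(norm y)\<^sup>2"]
      by simp
    show "\<exists>N. \<forall>n\<ge>N. inner y (B \<cdot> y) \<le> (a + 1 / real (Suc n)) * (norm y)\<^sup>2"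
      by (intro exI allI impI le) simp
  qed
  ultimately have "y = 0"
    using family_form_gt[of a y] by fastforce
  with z show ?thesis
    by (simp add: y_def)
qed

lemma family_distr_right_continuous: "continuous (at_right a) (family_distr x)"
  unfolding continuous_within
proof (rule tendstoI)
  fix e :: real assume e: "e > 0"
  have "(\<lambda>n. family_distr x (a + 1 / real (Suc n))) \<longlonglongrightarrow> family_distr x a"
    unfolding family_distr_def by (intro tendsto_intros family_right_limit)
  then have "eventually (\<lambda>n. dist (family_distr x (a + 1 / real (Suc n))) (family_distr x a) < e) sequentially"
    using e by (rule tendstoD)
  then obtain n where n: "dist (family_distr x (a + 1 / real (Suc n))) (family_distr x a) < e"
    by (auto simp: eventually_sequentially)
  show "eventually (\<lambda>b. dist (family_distr x b) (family_distr x a) < e) (at_right a)"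
  proof (rule eventually_at_rightI[of a "a + 1 / real (Suc n)"])
    fix b assume "b \<in> {a<..<a + 1 / real (Suc n)}"
    then have "family_distr x a \<le> family_distr x b" "family_distr x b \<le> family_distr x (a + 1 / real (Suc n))"
      by (auto intro: family_distr_mono)
    with n show "dist (family_distr x b) (family_distr x a) < e"
      by (auto simp: dist_real_def)
  qed simp
qed

section \<open>Scalar measures of the spectral family\<close>

definition family_measure :: "'a \<Rightarrow> real measure" where
  "family_measure x = interval_measure (family_distr x)"

lemma family_measure_sets [simp, measurable_cong]: "sets (family_measure x) = sets borel"
  by (simp add: family_measure_def)

lemma family_measure_space [simp]: "space (family_measure x) = UNIV"
  by (simp add: family_measure_def)

lemma family_measure_Ioc:
  "a \<le> b \<Longrightarrow> emeasure (family_measure x) {a<..b} = ennreal (family_distr x b - family_distr x a)"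
  unfolding family_measure_def
  by (rule emeasure_interval_measure_Ioc) (auto intro: family_distr_mono family_distr_right_continuous)

lemma family_distr_0: "l < - norm B \<Longrightarrow> family_distr x l = 0"
  by (simp add: family_distr_def family_eq_0)

lemma family_distr_1: "norm B \<le> l \<Longrightarrow> family_distr x l = (norm x)\<^sup>2"
  by (simp add: family_distr_def family_eq_1)

lemma family_measure_Iic: "emeasure (family_measure x) {..a} = ennreal (family_distr x a)"
proof (rule LIMSEQ_unique)
  \<comment> \<open>The left ends start below both \<open>a\<close> and \<open>- norm B\<close>,
    where the distribution function is zero, so each half-open interval already carries the full
    mass \<open>family_distr x a\<close>.\<close>
  define L where "L n = min a (- norm B) - 1 - real n" for n
  have "(\<lambda>n. emeasure (family_measure x) {L n<..a}) \<longlonglongrightarrow> emeasure (family_measure x) (\<Union>n. {L n<..a})"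
    by (rule Lim_emeasure_incseq) (auto simp: incseq_def L_def)
  moreover have "(\<Union>n. {L n<..a}) = {..a}"
  proof safe
    fix t assume "t \<le> a"
    obtain n :: nat where "min a (- norm B) - 1 - t < real n"
      using reals_Archimedean2 by blast
    then show "t \<in> (\<Union>n. {L n<..a})"
      using \<open>t \<le> a\<close> by (auto simp: L_def intro!: exI[of _ n])
  qed auto
  ultimately show "(\<lambda>n. emeasure (family_measure x) {L n<..a}) \<longlonglongrightarrow> emeasure (family_measure x) {..a}"
    by simp
  have "L n \<le> a" "L n < - norm B" for n
    by (auto simp: L_def)
  then have "emeasure (family_measure x) {L n<..a} = ennreal (family_distr x a)" for n
    by (simp add: family_measure_Ioc family_distr_0)
  then show "(\<lambda>n. emeasure (family_measure x) {L n<..a}) \<longlonglongrightarrow> ennreal (family_distr x a)"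
    by simp
qed

lemma family_measure_UNIV: "emeasure (family_measure x) UNIV = ennreal ((norm x)\<^sup>2)"
proof (rule LIMSEQ_unique)
  have "(\<lambda>n. emeasure (family_measure x) {..norm B + real n})
      \<longlonglongrightarrow> emeasure (family_measure x) (\<Union>n. {..norm B + real n})"
    by (rule Lim_emeasure_incseq) (auto simp: incseq_def)
  moreover have "(\<Union>n. {..norm B + real n}) = UNIV"
  proof safe
    fix t :: real
    obtain n :: nat where "t - norm B < real n"
      using reals_Archimedean2 by blast
    then show "t \<in> (\<Union>n. {..norm B + real n})"
      by (auto intro!: exI[of _ n])
  qed auto
  ultimately show "(\<lambda>n. emeasure (family_measure x) {..norm B + real n}) \<longlonglongrightarrow> emeasure (family_measure x) UNIV"
    by simp
  show "(\<lambda>n. emeasure (family_measure x) {..norm B + real n}) \<longlonglongrightarrow> ennreal ((norm x)\<^sup>2)"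
    by (simp add: family_measure_Iic family_distr_1)
qed

lemma finite_family_measure: "finite_measure (family_measure x)"
  by (rule finite_measureI) (simp add: family_measure_UNIV)

text \<open>At a vector \<open>x\<close> in the range of \<open>R\<close>, the set \<open>T\<close>
  carries the whole mass, so the disjoint set \<open>S\<close> carries none and
  \<open>Q \<cdot> x\<close> is zero.\<close>

lemma orthogonal_if_disjoint:
  assumes Q: "is_projection Q" "is_projection R"
    and S: "S \<in> sets borel" "T \<in> sets borel" "S \<inter> T = {}"
    and mu: "\<And>x. emeasure (family_measure x) S = ennreal ((norm (Q \<cdot> x))\<^sup>2)"
      "\<And>x. emeasure (family_measure x) T = ennreal ((norm (R \<cdot> x))\<^sup>2)"
  shows "Q * R = 0"
proof (rule bop_eqI)
  fix u
  define x where "x = R \<cdot> u"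
  have "ennreal ((norm (Q \<cdot> x))\<^sup>2) + ennreal ((norm (R \<cdot> x))\<^sup>2) = emeasure (family_measure x) (S \<union> T)"
    unfolding mu[symmetric] using S by (intro plus_emeasure) auto
  also have "\<dots> \<le> emeasure (family_measure x) UNIV"
    by (rule emeasure_mono) auto
  finally have "(norm (Q \<cdot> x))\<^sup>2 + (norm (R \<cdot> x))\<^sup>2 \<le> (norm x)\<^sup>2"
    by (simp add: family_measure_UNIV flip: ennreal_plus)
  moreover have "R \<cdot> x = x"
    by (simp add: x_def projection_apply[OF Q(2)])
  ultimately have "(norm (Q \<cdot> x))\<^sup>2 \<le> 0"
    by simp
  then show "(Q * R) \<cdot> u = 0 \<cdot> u"
    by (simp add: x_def)
qed

text \<open>The sets whose measure is given by a projection form a Dynkin system containing the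
  half-lines.\<close>

lemma borel_projection_exists:
  assumes "S \<in> sets borel"
  shows "\<exists>Q. is_projection Q \<and> (\<forall>x. emeasure (family_measure x) S = ennreal ((norm (Q \<cdot> x))\<^sup>2))"
proof -
  let ?G = "range (\<lambda>a::real. {..a})"
  let ?P = "\<lambda>S. \<exists>Q. is_projection Q \<and> (\<forall>x. emeasure (family_measure x) S = ennreal ((norm (Q \<cdot> x))\<^sup>2))"
  have borel: "sets borel = sigma_sets UNIV ?G"
    by (subst borel_eq_atMost) simp
  have "Int_stable ?G"
    by (auto simp: Int_stable_def)
  moreover have "?G \<subseteq> Pow UNIV"
    by simp
  moreover have "S \<in> sigma_sets UNIV ?G"
    using assms borel by simp
  ultimately show "?P S"
  proof (induction rule: sigma_sets_induct_disjoint)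
    case (basic A)
    then obtain a where "A = {..a}"
      by blast
    then show ?case
      by (intro exI[of _ "spectral_family a"])
        (simp add: family_projection family_measure_Iic family_distr_def)
  next
    case empty
    show ?case
      by (rule exI[of _ 0]) (simp add: projection_zero)
  next
    case (compl A)
    then obtain Q where Q: "is_projection Q" "\<And>x. emeasure (family_measure x) A = ennreal ((norm (Q \<cdot> x))\<^sup>2)"
      by blast
    have A: "A \<in> sets borel"
      using compl borel by simp
    have "emeasure (family_measure x) (UNIV - A) = ennreal ((norm ((1 - Q) \<cdot> x))\<^sup>2)" for x
    proof -
      have "emeasure (family_measure x) (space (family_measure x) - A)
          = emeasure (family_measure x) (space (family_measure x)) - emeasure (family_measure x) A"
        by (rule emeasure_compl) (use A Q in auto)
      then have "emeasure (family_measure x) (UNIV - A) = ennreal ((norm x)\<^sup>2) - ennreal ((norm (Q \<cdot> x))\<^sup>2)"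
        by (simp add: family_measure_UNIV Q(2))
      also have "\<dots> = ennreal ((norm x)\<^sup>2 - (norm (Q \<cdot> x))\<^sup>2)"
        by (rule ennreal_minus) simp
      also have "(norm x)\<^sup>2 - (norm (Q \<cdot> x))\<^sup>2 = (norm ((1 - Q) \<cdot> x))\<^sup>2"
        using projection_pythagoras[OF Q(1), of x] by simp
      finally show ?thesis .
    qed
    then show ?case
      using projection_compl[OF Q(1)] by blast
  next
    case (union A)
    then have A: "A n \<in> sets borel" for n
      using borel by auto
    have "\<forall>n. ?P (A n)"
      using union by blast
    then obtain Q where "\<forall>n. is_projection (Q n) \<and>
        (\<forall>x. emeasure (family_measure x) (A n) = ennreal ((norm (Q n \<cdot> x))\<^sup>2))"
      using choice[of "\<lambda>n Q. is_projection Q \<and>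
        (\<forall>x. emeasure (family_measure x) (A n) = ennreal ((norm (Q \<cdot> x))\<^sup>2))"] by blast
    then have Q: "\<And>n. is_projection (Q n)"
      and mu: "\<And>n x. emeasure (family_measure x) (A n) = ennreal ((norm (Q n \<cdot> x))\<^sup>2)"
      by auto
    have orth: "Q m * Q n = 0" if "m \<noteq> n" for m n
      by (rule orthogonal_if_disjoint[OF Q Q A[of m] A[of n] _ mu mu])
        (use union(1) that in \<open>auto simp: disjoint_family_on_def\<close>)
    obtain L where L: "is_projection L" "\<And>x. (\<lambda>n. (norm (Q n \<cdot> x))\<^sup>2) sums (norm (L \<cdot> x))\<^sup>2"
      by (rule orthogonal_projections_sum[of Q, OF Q]) (erule orth, rule that)
    have "emeasure (family_measure x) (\<Union>n. A n) = ennreal ((norm (L \<cdot> x))\<^sup>2)" for x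
    proof -
      have "emeasure (family_measure x) (\<Union>n. A n) = (\<Sum>n. emeasure (family_measure x) (A n))"
        using A union(1) by (intro suminf_emeasure[symmetric]) auto
      also have "\<dots> = ennreal ((norm (L \<cdot> x))\<^sup>2)"
        unfolding mu by (intro suminf_ennreal_eq L) simp
      finally show ?thesis .
    qed
    with L show ?case by blast
  qed
qed

section \<open>The projection-valued measure\<close>

definition spectral_resolution :: "real set \<Rightarrow> 'a bop" where
  "spectral_resolution S = (SOME Q. is_projection Q \<and>
     (\<forall>x. emeasure (family_measure x) S = ennreal ((norm (Q \<cdot> x))\<^sup>2)))"

lemma
  assumes "S \<in> sets borel"
  shows resolution_projection: "is_projection (spectral_resolution S)"
    and emeasure_resolution:
      "emeasure (family_measure x) S = ennreal ((norm (spectral_resolution S \<cdot> x))\<^sup>2)"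
  using someI_ex[OF borel_projection_exists[OF assms], folded spectral_resolution_def] by simp_all

text \<open>The scalar measures determine the quadratic form and hence, by polarisation, the
  projection.\<close>

lemma resolution_eqI:
  assumes S: "S \<in> sets borel" and Q: "is_projection Q"
    and mu: "\<And>x. emeasure (family_measure x) S = ennreal ((norm (Q \<cdot> x))\<^sup>2)"
  shows "spectral_resolution S = Q"
proof (rule selfadjoint_eqI)
  show "star (spectral_resolution S) = spectral_resolution S" "star Q = Q"
    using resolution_projection[OF S] Q by (auto simp: is_projection_def)
  show "inner x (spectral_resolution S \<cdot> x) = inner x (Q \<cdot> x)" for x
    using emeasure_resolution[OF S, of x] mu[of x]
    by (simp add: projection_norm_sq[OF resolution_projection[OF S]] projection_norm_sq[OF Q])
qed

lemma resolution_Iic: "spectral_resolution {..a} = spectral_family a"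
  by (rule resolution_eqI) (auto simp: family_projection family_measure_Iic family_distr_def)

lemma resolution_UNIV: "spectral_resolution UNIV = 1"
  by (rule resolution_eqI) (auto simp: projection_one family_measure_UNIV)

lemma resolution_orthogonal:
  assumes "S \<in> sets borel" "T \<in> sets borel" "S \<inter> T = {}"
  shows "spectral_resolution S * spectral_resolution T = 0"
  using assms by (intro orthogonal_if_disjoint[of _ _ S T] resolution_projection emeasure_resolution)

lemma resolution_Un:
  assumes S: "S \<in> sets borel" "T \<in> sets borel" "S \<inter> T = {}"
  shows "spectral_resolution (S \<union> T) = spectral_resolution S + spectral_resolution T"
proof (rule resolution_eqI)
  have P: "is_projection (spectral_resolution S)" "is_projection (spectral_resolution T)"
    using S by (auto intro: resolution_projection)
  show Q: "is_projection (spectral_resolution S + spectral_resolution T)"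
    by (intro projection_add P resolution_orthogonal S)
  fix x
  have "emeasure (family_measure x) (S \<union> T) = emeasure (family_measure x) S + emeasure (family_measure x) T"
    using S by (intro plus_emeasure[symmetric]) auto
  also have "\<dots> = ennreal (inner x (spectral_resolution S \<cdot> x) + inner x (spectral_resolution T \<cdot> x))"
    using S P by (simp add: emeasure_resolution projection_norm_sq)
  also have "\<dots> = ennreal (inner x ((spectral_resolution S + spectral_resolution T) \<cdot> x))"
    by (simp add: inner_add_right)
  finally show "emeasure (family_measure x) (S \<union> T)
      = ennreal ((norm ((spectral_resolution S + spectral_resolution T) \<cdot> x))\<^sup>2)"
    unfolding projection_norm_sq[OF Q] .
qed (use S in auto)

text \<open>Cutting \<open>S\<close> and \<open>T\<close> into their intersection and the two
  differences reduces multiplicativity to the orthogonality of disjoint pieces.\<close>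

lemma resolution_Int:
  assumes S: "S \<in> sets borel" "T \<in> sets borel"
  shows "spectral_resolution (S \<inter> T) = spectral_resolution S * spectral_resolution T"
proof -
  let ?a = "spectral_resolution (S \<inter> T)" and ?b = "spectral_resolution (S - T)"
    and ?c = "spectral_resolution (T - S)"
  have "spectral_resolution (S \<inter> T \<union> (S - T)) = ?a + ?b" "spectral_resolution (S \<inter> T \<union> (T - S)) = ?a + ?c"
    using S by (auto intro!: resolution_Un)
  moreover have "S \<inter> T \<union> (S - T) = S" "S \<inter> T \<union> (T - S) = T"
    by auto
  moreover have "?b * ?a = 0" "?a * ?c = 0" "?b * ?c = 0"
    using S by (auto intro!: resolution_orthogonal)
  moreover have "?a * ?a = ?a"
    using resolution_projection[of "S \<inter> T"] S by (simp add: is_projection_def)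
  ultimately show ?thesis
    by (simp add: distrib_left distrib_right)
qed

lemma resolution_sums:
  fixes A :: "nat \<Rightarrow> real set"
  assumes A: "range A \<subseteq> sets borel" "disjoint_family A"
  shows "(\<lambda>n. spectral_resolution (A n) \<cdot> x) sums (spectral_resolution (\<Union>n. A n) \<cdot> x)"
proof -
  have An: "A n \<in> sets borel" for n
    using A(1) by auto
  have proj: "is_projection (spectral_resolution (A n))" for n
    by (rule resolution_projection[OF An])
  have orth: "spectral_resolution (A m) * spectral_resolution (A n) = 0" if "m \<noteq> n" for m n
    by (rule resolution_orthogonal[OF An An]) (use A(2) that in \<open>auto simp: disjoint_family_on_def\<close>)
  obtain L where L: "is_projection L" "\<And>x. (\<lambda>n. spectral_resolution (A n) \<cdot> x) sums (L \<cdot> x)"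
    "\<And>x. (\<lambda>n. (norm (spectral_resolution (A n) \<cdot> x))\<^sup>2) sums (norm (L \<cdot> x))\<^sup>2"
    by (rule orthogonal_projections_sum[of "\<lambda>n. spectral_resolution (A n)", OF proj]) (erule orth, rule that)
  have "spectral_resolution (\<Union>n. A n) = L"
  proof (rule resolution_eqI)
    fix x
    have "emeasure (family_measure x) (\<Union>n. A n) = (\<Sum>n. emeasure (family_measure x) (A n))"
      using A by (intro suminf_emeasure[symmetric]) auto
    also have "\<dots> = ennreal ((norm (L \<cdot> x))\<^sup>2)"
      unfolding emeasure_resolution[OF An] by (intro suminf_ennreal_eq L) simp
    finally show "emeasure (family_measure x) (\<Union>n. A n) = ennreal ((norm (L \<cdot> x))\<^sup>2)" .
  qed (use An L in auto)
  then show ?thesis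
    using L(2) by simp
qed

lemma resolution_support: "spectral_resolution {- norm B - 1..norm B + 1} = 1"
proof -
  let ?M = "norm B + 1"
  have "spectral_resolution {..?M} = spectral_resolution ({..- ?M} \<union> {- ?M<..?M})"
    by (intro arg_cong[where f = spectral_resolution]) (auto intro: order_trans[of _ "- norm B - 1"])
  also have "\<dots> = spectral_resolution {..- ?M} + spectral_resolution {- ?M<..?M}"
    by (rule resolution_Un) auto
  finally have 1: "spectral_resolution {- ?M<..?M} = 1"
    by (simp add: resolution_Iic family_eq_1 family_eq_0)
  have "spectral_resolution ({- ?M..?M} \<inter> {- ?M<..?M})
      = spectral_resolution {- ?M..?M} * spectral_resolution {- ?M<..?M}"
    by (rule resolution_Int) auto
  moreover have "{- ?M..?M} \<inter> {- ?M<..?M} = {- ?M<..?M}"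
    by auto
  ultimately show ?thesis
    using 1 by simp
qed

lemma integrable_family_measure:
  assumes R: "R \<in> sets borel"
  shows "integrable (family_measure x) (\<lambda>l. indicator R l * l)"
proof -
  let ?S = "{- norm B - 1..norm B + 1}"
  have "spectral_resolution (?S \<union> - ?S) = spectral_resolution ?S + spectral_resolution (- ?S)"
    by (rule resolution_Un) auto
  then have "spectral_resolution (- ?S) = 0"
    by (simp add: resolution_support resolution_UNIV)
  then have "emeasure (family_measure x) (- ?S) = 0"
    by (subst emeasure_resolution) auto
  then have "AE l in family_measure x. l \<in> ?S"
    by (intro AE_I[of _ _ "- ?S"]) auto
  then have "AE l in family_measure x. norm (indicator R l * l) \<le> norm B + 1"
    by eventually_elim (auto split: split_indicator)
  then show ?thesis
    by (rule finite_measure.integrable_const_bound[OF finite_family_measure]) (use R in measurable)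
qed

text \<open>\<open>g\<close> compares the form on the range of the projection at \<open>c\<close>
  with the integral over \<open>{..c}\<close>. Over \<open>{a<..b}\<close> both change by an amount
  between \<open>a * d\<close> and \<open>b * d\<close>, with \<open>d\<close> the mass, so
  \<open>eq_if_increment_le\<close> applies. To the left of the support \<open>g\<close> is zero, to
  the right it is the difference in question.\<close>

lemma form_eq_integral: "inner x (B \<cdot> x) = integral\<^sup>L (family_measure x) (\<lambda>l. l)"
proof -
  let ?P = spectral_family and ?F = "family_distr x" and ?M = "family_measure x"
  define K where "K = norm B + 1"
  define J where "J c = integral\<^sup>L ?M (\<lambda>l. indicator {..c} l * l)" for c
  define g where "g c = inner (?P c \<cdot> x) (B \<cdot> ?P c \<cdot> x) - J c" for c
  have "g (- K) = g K"
  proof (rule eq_if_increment_le[where g = g and F = ?F and a = "- K" and b = K])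
    show "- K \<le> K"
      by (simp add: K_def)
    fix a b :: real assume ab: "a \<le> b"
    define y where "y = ?P b \<cdot> x - ?P a \<cdot> x"
    define d where "d = ?F b - ?F a"
    have d: "(norm y)\<^sup>2 = d"
      unfolding y_def d_def by (rule family_diff_norm[OF ab])
    have PP: "?P a \<cdot> ?P b \<cdot> x = ?P a \<cdot> x" "?P b \<cdot> ?P a \<cdot> x = ?P a \<cdot> x"
      using family_mono[OF ab] family_mono'[OF ab] by (simp_all flip: bop_apply_simps(7))
    have Pb: "?P b \<cdot> y = y" and Pa: "?P a \<cdot> y = 0"
      by (simp_all add: y_def PP projection_apply[OF family_projection])
    have By: "a * d \<le> inner y (B \<cdot> y)" "inner y (B \<cdot> y) \<le> b * d"
      using family_form_ge[OF Pa] family_form_le[OF Pb] by (simp_all add: d)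
    have "?P a \<cdot> B \<cdot> y = B \<cdot> ?P a \<cdot> y"
      using family_commute_B[of a] by (simp flip: bop_apply_simps(7))
    then have c1: "inner (?P a \<cdot> x) (B \<cdot> y) = 0"
      by (simp add: projection_inner[OF family_projection] Pa)
    then have c2: "inner y (B \<cdot> ?P a \<cdot> x) = 0"
      using selfadjoint_inner[OF B, of "?P a \<cdot> x" y] by (simp add: inner_commute)
    have "inner (?P a \<cdot> x + y) (B \<cdot> (?P a \<cdot> x + y))
        = inner (?P a \<cdot> x) (B \<cdot> ?P a \<cdot> x) + inner y (B \<cdot> y)"
      using c1 c2 by (simp add: inner_add_left inner_add_right)
    then have split: "inner (?P b \<cdot> x) (B \<cdot> ?P b \<cdot> x) = inner (?P a \<cdot> x) (B \<cdot> ?P a \<cdot> x) + inner y (B \<cdot> y)"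
      by (simp add: y_def)
    define I where "I = integral\<^sup>L ?M (\<lambda>l. indicator {a<..b} l * l)"
    have "J b = integral\<^sup>L ?M (\<lambda>l. indicator {..a} l * l + indicator {a<..b} l * l)"
      unfolding J_def using ab
      by (intro Bochner_Integration.integral_cong) (auto split: split_indicator)
    also have "\<dots> = J a + I"
      unfolding J_def I_def by (intro Bochner_Integration.integral_add integrable_family_measure) auto
    finally have J: "J b = J a + I" .
    have meas: "measure ?M {a<..b} = d"
      using family_measure_Ioc[OF ab, of x] family_distr_mono[OF ab, of x]
      by (simp add: measure_def d_def)
    have int: "integrable ?M (\<lambda>l. c * indicator {a<..b} l)" for c :: real
      by (intro integrable_mult_right integrable_real_indicator)
        (auto simp: finite_measure.emeasure_finite[OF finite_family_measure] less_top[symmetric])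
    have intc: "integral\<^sup>L ?M (\<lambda>l. c * indicator {a<..b} l) = c * d" for c
      by (simp add: meas)
    have "integral\<^sup>L ?M (\<lambda>l. a * indicator {a<..b} l) \<le> I"
      unfolding I_def
      by (intro integral_mono int integrable_family_measure) (auto split: split_indicator)
    moreover have "I \<le> integral\<^sup>L ?M (\<lambda>l. b * indicator {a<..b} l)"
      unfolding I_def
      by (intro integral_mono int integrable_family_measure) (auto split: split_indicator)
    ultimately have "a * d \<le> I" "I \<le> b * d"
      by (simp_all only: intc)
    then have "\<bar>inner y (B \<cdot> y) - I\<bar> \<le> b * d - a * d"
      using By by linarith
    then show "\<bar>g b - g a\<bar> \<le> (b - a) * (?F b - ?F a)"
      unfolding g_def split J by (simp add: left_diff_distrib flip: d_def)
  qed
  moreover have "g (- K) = 0"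
  proof -
    have "emeasure ?M {..- K} = 0"
      by (simp add: family_measure_Iic family_distr_0 K_def)
    then have "AE l in ?M. l \<notin> {..- K}"
      by (intro AE_I[of _ _ "{..- K}"]) auto
    then have "AE l in ?M. indicator {..- K} l * l = 0"
      by eventually_elim auto
    then have "J (- K) = 0"
      unfolding J_def by (rule integral_eq_zero_AE)
    moreover have "?P (- K) = 0"
      by (rule family_eq_0) (simp add: K_def)
    ultimately show ?thesis
      by (simp add: g_def)
  qed
  moreover have "g K = inner x (B \<cdot> x) - integral\<^sup>L ?M (\<lambda>l. l)"
  proof -
    have "spectral_resolution ({..K} \<union> {K<..}) = spectral_resolution {..K} + spectral_resolution {K<..}"
      by (rule resolution_Un) auto
    moreover have "{..K} \<union> {K<..} = UNIV"
      by auto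
    moreover have PK: "?P K = 1"
      by (rule family_eq_1) (simp add: K_def)
    ultimately have "spectral_resolution {K<..} = 0"
      by (simp add: resolution_UNIV resolution_Iic)
    then have "emeasure ?M {K<..} = 0"
      by (subst emeasure_resolution) auto
    then have "AE l in ?M. l \<notin> {K<..}"
      by (intro AE_I[of _ _ "{K<..}"]) auto
    then have "AE l in ?M. indicator {..K} l * l = l"
      by eventually_elim auto
    then have "J K = integral\<^sup>L ?M (\<lambda>l. l)"
      unfolding J_def by (intro integral_cong_AE) auto
    then show ?thesis
      by (simp add: g_def PK)
  qed
  ultimately show ?thesis
    by simp
qed

lemma spectral_measure_exists: "is_spectral_measure B spectral_resolution"
  unfolding is_spectral_measure_def
proof (intro conjI ballI allI impI)
  show "\<exists>M. spectral_resolution {- M..M} = 1"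
    using resolution_support by (intro exI[of _ "norm B + 1"]) simp
  fix x
  have "measure_of UNIV (sets borel) (\<lambda>S. ennreal ((norm (spectral_resolution S \<cdot> x))\<^sup>2))
      = measure_of UNIV (sets borel) (emeasure (family_measure x))"
    using sets.sigma_sets_eq[of "borel :: real measure"]
    by (intro measure_of_eq) (auto simp: emeasure_resolution)
  also have "\<dots> = family_measure x"
    using measure_of_of_measure[of "family_measure x"] by simp
  finally have *: "measure_of UNIV (sets borel) (\<lambda>S. ennreal ((norm (spectral_resolution S \<cdot> x))\<^sup>2))
      = family_measure x" .
  \<comment> \<open>The definition asks for an equation of complex numbers, and this is the
    imaginary part of the form up to sign.\<close>
  have "inner (\<i> *\<^sub>C x) (B \<cdot> x) = 0"
  proof -
    have "cinner x (B \<cdot> x) = cinner (B \<cdot> x) x"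
      by (rule cinner_eqI[symmetric]) (rule selfadjoint_inner[OF B])
    then have "cinner x (B \<cdot> x) = cnj (cinner x (B \<cdot> x))"
      by (metis cinner_commute)
    then have "Im (cinner x (B \<cdot> x)) = 0"
      by (metis complex_cnj_cancel_iff cnj.simps(2) equal_neg_zero)
    then show ?thesis
      by (simp add: cinner_eq_Complex)
  qed
  then show "cinner x (B \<cdot> x) = complex_of_real (integral\<^sup>L
      (measure_of UNIV (sets borel) (\<lambda>S. ennreal ((norm (spectral_resolution S \<cdot> x))\<^sup>2))) (\<lambda>l. l))"
    unfolding * form_eq_integral[symmetric] by (simp add: cinner_eq_Complex complex_eq_iff)
qed (simp_all add: resolution_projection resolution_UNIV resolution_Int resolution_sums)

text \<open>The definite description takes both halves of the section: the constructed resolution is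
  a witness, and \<open>spectral_projection_nonneg\<close> gives every spectral measure the same
  value on \<open>{0..}\<close>.\<close>

lemma chi_eq_nonneg_proj: "chi B = nonneg_proj B"
  unfolding chi_def spectral_projection_def
proof (rule the_equality)
  show "\<exists>E. is_spectral_measure B E \<and> nonneg_proj B = E {0..}"
    using spectral_measure_exists spectral_projection_nonneg[OF spectral_measure_exists B] by auto
  show "P = nonneg_proj B" if "\<exists>E. is_spectral_measure B E \<and> P = E {0..}" for P
    using that spectral_projection_nonneg[OF _ B] by auto
qed

end

lemma chi_projection: "star B = B \<Longrightarrow> is_projection (chi B)"
  by (simp add: chi_eq_nonneg_proj nonneg_proj_projection)

lemma chi_commutant: "star B = B \<Longrightarrow> is_commutant N \<Longrightarrow> B \<in> N \<Longrightarrow> chi B \<in> N"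
  by (simp add: chi_eq_nonneg_proj nonneg_proj_commutant)

section \<open>The group K0\<close>

text \<open>Matrices occur over two rings, the unitization and the complex numbers of its scalar
  part; this class treats both at once.\<close>

class star_ring = ring + star +
  assumes star_ring_add: "star (x + y) = star x + star y"
    and star_ring_mult: "star (x * y) = star y * star x"
    and star_ring_star: "star (star x) = x"
begin

lemma star_ring_zero: "star 0 = 0"
  using star_ring_add[of 0 0] by simp

lemma star_ring_sum: "star (\<Sum>i\<in>I. f i) = (\<Sum>i\<in>I. star (f i))"
  by (induction I rule: infinite_finite_induct) (auto simp: star_ring_zero star_ring_add)

end

class complex_star_algebra = complex_algebra + star_ring +
  assumes star_scaleC: "star (c *\<^sub>C x) = cnj c *\<^sub>C star x"

instance complex :: star_ring
  by standard (auto simp: star_complex_def)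

instance unitization :: (complex_star_algebra) star_ring
  by standard (auto simp: star_unitization_def plus_unitization_def times_unitization_def
      star_ring_add star_ring_mult star_ring_star star_scaleC add.assoc add.commute)

lemma bop_apply_scaleC_left: "(c *\<^sub>C T) \<cdot> x = c *\<^sub>C (T \<cdot> x)"
  by transfer (simp add: bounded_linear_Blinfun_apply bounded_linear_scaleC)

instance bop :: (hilbert_space) complex_star_algebra
proof
  fix c :: complex and S T :: "'a bop"
  show "star (c *\<^sub>C S) = cnj c *\<^sub>C star S"
  proof (rule star_eqI)
    fix x y
    have "inner (c *\<^sub>C (S \<cdot> x)) y = inner (S \<cdot> x) (cnj c *\<^sub>C y)"
      by (simp add: inner_scaleC_right)
    also have "\<dots> = inner x (star S \<cdot> (cnj c *\<^sub>C y))"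
      by (rule inner_star)
    finally show "inner ((c *\<^sub>C S) \<cdot> x) y = inner x ((cnj c *\<^sub>C star S) \<cdot> y)"
      by (simp add: bop_apply_scaleC_left bop_apply_scaleC)
  qed
qed simp_all

subsection \<open>Matrices over star rings\<close>

lemma star_mat_carrier [simp]: "M \<in> carrier_mat m n \<Longrightarrow> star M \<in> carrier_mat n m"
  by (simp add: star_mat_def)

lemma star_mat_dim [simp]: "dim_row (star M) = dim_col M" "dim_col (star M) = dim_row M" for M :: "'a::star mat"
  by (simp_all add: star_mat_def)

lemma star_mat_index [simp]: "i < dim_col M \<Longrightarrow> j < dim_row M \<Longrightarrow> star M $$ (i, j) = star (M $$ (j, i))"
  by (simp add: star_mat_def)

lemma star_mat_star [simp]: "star (star M) = (M :: 'a::star_ring mat)"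
  by (rule eq_matI) (auto simp: star_ring_star)

lemma mult_mat_index:
  "M \<in> carrier_mat m n \<Longrightarrow> N \<in> carrier_mat n k \<Longrightarrow> i < m \<Longrightarrow> j < k \<Longrightarrow>
    (M * N) $$ (i, j) = (\<Sum>l<n. M $$ (i, l) * N $$ (l, j))"
  by (auto simp: scalar_prod_def lessThan_atLeast0 intro!: sum.cong)

lemma star_mat_mult:
  fixes M N :: "'a::star_ring mat"
  assumes M: "M \<in> carrier_mat m n" and N: "N \<in> carrier_mat n k"
  shows "star (M * N) = star N * star M"
proof (rule eq_matI)
  fix i j assume "i < dim_row (star N * star M)" "j < dim_col (star N * star M)"
  then have ij: "i < k" "j < m"
    using M N by auto
  have "star (M * N) $$ (i, j) = star ((M * N) $$ (j, i))"
    using M N ij by auto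
  also have "\<dots> = (\<Sum>l<n. star (N $$ (l, i)) * star (M $$ (j, l)))"
    using ij by (simp add: mult_mat_index[OF M N] star_ring_sum star_ring_mult del: index_mult_mat)
  also have "\<dots> = (star N * star M) $$ (i, j)"
    using M N ij by (subst mult_mat_index[of _ k n _ m]) auto
  finally show "star (M * N) $$ (i, j) = (star N * star M) $$ (i, j)" .
qed (use M N in auto)

lemma star_four_block_mat:
  assumes "M \<in> carrier_mat n1 m1" "M' \<in> carrier_mat n1 m2" "N \<in> carrier_mat n2 m1" "N' \<in> carrier_mat n2 m2"
  shows "star (four_block_mat M M' N N') = four_block_mat (star M) (star N) (star M') (star N')"
  using assms by (intro eq_matI) auto

lemma star_zero_mat: "star (0\<^sub>m m n :: 'a::star_ring mat) = 0\<^sub>m n m"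
  by (rule eq_matI) (auto simp: star_ring_zero)

lemma dsum_dim [simp]:
  "dim_row (e \<oplus>\<^sub>m f) = dim_row e + dim_row f" "dim_col (e \<oplus>\<^sub>m f) = dim_col e + dim_col f"
  by (simp_all add: mat_dsum_def)

lemma dsum_index:
  "i < dim_row e + dim_row f \<Longrightarrow> j < dim_col e + dim_col f \<Longrightarrow> (e \<oplus>\<^sub>m f) $$ (i, j) =
    (if i < dim_row e then if j < dim_col e then e $$ (i, j) else 0
     else if j < dim_col e then 0 else f $$ (i - dim_row e, j - dim_col e))"
  by (auto simp: mat_dsum_def)

lemma dsum_assoc: "(e \<oplus>\<^sub>m f) \<oplus>\<^sub>m g = e \<oplus>\<^sub>m (f \<oplus>\<^sub>m g)"
  unfolding mat_dsum_def by (rule assoc_four_block_mat[symmetric])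

lemma dsum_empty [simp]: "0\<^sub>m 0 0 \<oplus>\<^sub>m e = e" "e \<oplus>\<^sub>m 0\<^sub>m 0 0 = e"
  by (rule eq_matI; auto simp: dsum_index)+

lemma dsum_mult:
  fixes e f :: "'a::ring mat"
  assumes "e \<in> carrier_mat m n" "e' \<in> carrier_mat n p" "f \<in> carrier_mat k l" "f' \<in> carrier_mat l q"
  shows "(e \<oplus>\<^sub>m f) * (e' \<oplus>\<^sub>m f') = (e * e') \<oplus>\<^sub>m (f * f')"
  using assms unfolding mat_dsum_def
  by (subst mult_four_block_mat[of _ m n _ l _ k _ _ p _ q]) auto

lemma star_dsum: "star (e \<oplus>\<^sub>m f) = star e \<oplus>\<^sub>m star (f :: 'a::star_ring mat)"
  by (rule eq_matI) (auto simp: dsum_index star_ring_zero)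

lemma mats_over_iff:
  "M \<in> mats_over A m n \<longleftrightarrow> M \<in> carrier_mat m n \<and> (\<forall>i<m. \<forall>j<n. M $$ (i, j) \<in> A)"
  unfolding mats_over_def using elements_matD[of _ M] elements_matI[of M m n] by fastforce

section \<open>Matrix projections and Murray-von Neumann equivalence\<close>

locale star_subring =
  fixes A :: "'b::star_ring set"
  assumes zero_closed: "0 \<in> A"
    and add_closed: "x \<in> A \<Longrightarrow> y \<in> A \<Longrightarrow> x + y \<in> A"
    and mult_closed: "x \<in> A \<Longrightarrow> y \<in> A \<Longrightarrow> x * y \<in> A"
    and star_closed: "x \<in> A \<Longrightarrow> star x \<in> A"
begin

lemma sum_closed: "(\<And>i. i \<in> I \<Longrightarrow> f i \<in> A) \<Longrightarrow> (\<Sum>i\<in>I. f i) \<in> A"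
  by (induction I rule: infinite_finite_induct) (auto intro: zero_closed add_closed)

lemma mats_mult: "M \<in> mats_over A m n \<Longrightarrow> M' \<in> mats_over A n k \<Longrightarrow> M * M' \<in> mats_over A m k"
  by (auto simp: mats_over_iff mult_mat_index simp del: index_mult_mat intro!: sum_closed mult_closed)

lemma mats_star: "M \<in> mats_over A m n \<Longrightarrow> star M \<in> mats_over A n m"
  by (auto simp: mats_over_iff intro!: star_closed)

lemma mats_four_block:
  assumes "M \<in> mats_over A n1 m1" "M' \<in> mats_over A n1 m2" "N \<in> mats_over A n2 m1" "N' \<in> mats_over A n2 m2"
  shows "four_block_mat M M' N N' \<in> mats_over A (n1 + n2) (m1 + m2)"
  using assms elements_four_block_mat[of M n1 m1 M' m2 N n2 N'] by (auto simp: mats_over_def)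

lemma mats_zero: "0\<^sub>m m n \<in> mats_over A m n"
  by (simp add: mats_over_iff zero_closed)

lemma mats_dsum:
  assumes "M \<in> mats_over A m n" "M' \<in> mats_over A k l"
  shows "M \<oplus>\<^sub>m M' \<in> mats_over A (m + k) (n + l)"
proof -
  have "dim_row M = m" "dim_col M = n" "dim_row M' = k" "dim_col M' = l"
    using assms by (auto simp: mats_over_def)
  then show ?thesis
    unfolding mat_dsum_def using assms by (simp add: mats_four_block mats_zero)
qed

abbreviation "Proj \<equiv> mat_projections A"

lemma ProjD:
  assumes "e \<in> Proj"
  shows "e \<in> mats_over A (dim_row e) (dim_row e)" "e \<in> carrier_mat (dim_row e) (dim_row e)"
    "e * e = e" "star e = e"
proof -
  obtain n where n: "e \<in> mats_over A n n" and e: "is_projection e"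
    using assms by (auto simp: mat_projections_def)
  then have "dim_row e = n"
    by (auto simp: mats_over_def)
  with n show "e \<in> mats_over A (dim_row e) (dim_row e)"
    by simp
  then show "e \<in> carrier_mat (dim_row e) (dim_row e)"
    by (simp add: mats_over_def)
  show "e * e = e" "star e = e"
    using e by (simp_all add: is_projection_def)
qed

lemma ProjI: "e \<in> mats_over A n n \<Longrightarrow> e * e = e \<Longrightarrow> star e = e \<Longrightarrow> e \<in> Proj"
  by (auto simp: mat_projections_def is_projection_def)

lemma Proj_dsum:
  assumes "e \<in> Proj" "f \<in> Proj"
  shows "e \<oplus>\<^sub>m f \<in> Proj"
proof -
  note e = ProjD[OF assms(1)] and f = ProjD[OF assms(2)]
  show ?thesis
  proof (rule ProjI)
    show "e \<oplus>\<^sub>m f \<in> mats_over A (dim_row e + dim_row f) (dim_row e + dim_row f)"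
      by (rule mats_dsum[OF e(1) f(1)])
    show "(e \<oplus>\<^sub>m f) * (e \<oplus>\<^sub>m f) = e \<oplus>\<^sub>m f"
      by (simp only: dsum_mult[OF e(2) e(2) f(2) f(2)] e(3) f(3))
    show "star (e \<oplus>\<^sub>m f) = e \<oplus>\<^sub>m f"
      by (simp only: star_dsum e(4) f(4))
  qed
qed

lemma Proj_zero: "0\<^sub>m n n \<in> Proj"
  by (rule ProjI[OF mats_zero]) (simp_all add: star_zero_mat)

lemma mvnI:
  "v \<in> mats_over A (dim_row f) (dim_row e) \<Longrightarrow> star v * v = e \<Longrightarrow> v * star v = f \<Longrightarrow> mvn_equiv A e f"
  by (auto simp: mvn_equiv_def)

lemma mvn_refl: "e \<in> Proj \<Longrightarrow> mvn_equiv A e e"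
  by (rule mvnI[OF ProjD(1)]) (simp_all only: ProjD(3,4))

lemma mvn_sym: "mvn_equiv A e f \<Longrightarrow> mvn_equiv A f e"
proof -
  assume "mvn_equiv A e f"
  then obtain v where "v \<in> mats_over A (dim_row f) (dim_row e)" "star v * v = e" "v * star v = f"
    by (auto simp: mvn_equiv_def)
  then show "mvn_equiv A f e"
    by (intro mvnI[of "star v"]) (simp_all only: mats_star star_mat_star)
qed

lemma mvn_trans:
  assumes P: "e \<in> Proj" "f \<in> Proj" "g \<in> Proj" and ef: "mvn_equiv A e f" and fg: "mvn_equiv A f g"
  shows "mvn_equiv A e g"
proof -
  obtain v where v: "v \<in> mats_over A (dim_row f) (dim_row e)" "star v * v = e" "v * star v = f"
    using ef by (auto simp: mvn_equiv_def)
  obtain w where w: "w \<in> mats_over A (dim_row g) (dim_row f)" "star w * w = f" "w * star w = g"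
    using fg by (auto simp: mvn_equiv_def)
  have c: "v \<in> carrier_mat (dim_row f) (dim_row e)" "w \<in> carrier_mat (dim_row g) (dim_row f)"
    "star v \<in> carrier_mat (dim_row e) (dim_row f)" "star w \<in> carrier_mat (dim_row f) (dim_row g)"
    using v w by (auto simp: mats_over_iff)
  have c': "star v * v \<in> carrier_mat (dim_row e) (dim_row e)" "w * star w \<in> carrier_mat (dim_row g) (dim_row g)"
    "star v * star w \<in> carrier_mat (dim_row e) (dim_row g)" "w * v \<in> carrier_mat (dim_row g) (dim_row e)"
    using c by (auto intro: mult_carrier_mat)
  have s: "star (w * v) = star v * star w"
    using c by (intro star_mat_mult)
  show ?thesis
  proof (rule mvnI)
    show "w * v \<in> mats_over A (dim_row g) (dim_row e)"
      using v w mats_mult by blast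
    have "star (w * v) * (w * v) = star v * ((star w * w) * v)"
      unfolding s using c c' by (simp add: assoc_mult_mat[of _ "dim_row e" "dim_row f" _ "dim_row g" _ "dim_row e"]
          assoc_mult_mat[of _ "dim_row f" "dim_row g" _ "dim_row f" _ "dim_row e"])
    also have "\<dots> = star v * ((v * star v) * v)"
      by (simp only: w v)
    also have "\<dots> = (star v * v) * (star v * v)"
      using c c' by (simp add: assoc_mult_mat[of _ "dim_row e" "dim_row f" _ "dim_row e" _ "dim_row e"]
          assoc_mult_mat[of _ "dim_row f" "dim_row e" _ "dim_row f" _ "dim_row e"])
    also have "\<dots> = e"
      by (simp only: v ProjD(3)[OF P(1)])
    finally show "star (w * v) * (w * v) = e" .
    have "(w * v) * star (w * v) = w * ((v * star v) * star w)"
      unfolding s using c c' by (simp add: assoc_mult_mat[of _ "dim_row g" "dim_row f" _ "dim_row e" _ "dim_row g"]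
          assoc_mult_mat[of _ "dim_row f" "dim_row e" _ "dim_row f" _ "dim_row g"])
    also have "\<dots> = w * ((star w * w) * star w)"
      by (simp only: w v)
    also have "\<dots> = (w * star w) * (w * star w)"
      using c c' by (simp add: assoc_mult_mat[of _ "dim_row g" "dim_row f" _ "dim_row g" _ "dim_row g"]
          assoc_mult_mat[of _ "dim_row f" "dim_row g" _ "dim_row f" _ "dim_row g"])
    also have "\<dots> = g"
      by (simp only: w ProjD(3)[OF P(3)])
    finally show "(w * v) * star (w * v) = g" .
  qed
qed

lemma mvn_dsum:
  assumes e: "mvn_equiv A e e'" and f: "mvn_equiv A f f'"
  shows "mvn_equiv A (e \<oplus>\<^sub>m f) (e' \<oplus>\<^sub>m f')"
proof -
  obtain v where v: "v \<in> mats_over A (dim_row e') (dim_row e)" "star v * v = e" "v * star v = e'"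
    using e by (auto simp: mvn_equiv_def)
  obtain w where w: "w \<in> mats_over A (dim_row f') (dim_row f)" "star w * w = f" "w * star w = f'"
    using f by (auto simp: mvn_equiv_def)
  have c: "v \<in> carrier_mat (dim_row e') (dim_row e)" "w \<in> carrier_mat (dim_row f') (dim_row f)"
    using v w by (auto simp: mats_over_iff)
  show ?thesis
  proof (rule mvnI)
    show "v \<oplus>\<^sub>m w \<in> mats_over A (dim_row (e' \<oplus>\<^sub>m f')) (dim_row (e \<oplus>\<^sub>m f))"
      using mats_dsum[OF v(1) w(1)] by simp
    show "star (v \<oplus>\<^sub>m w) * (v \<oplus>\<^sub>m w) = e \<oplus>\<^sub>m f"
      by (simp only: star_dsum dsum_mult[OF star_mat_carrier[OF c(1)] c(1) star_mat_carrier[OF c(2)] c(2)] v w)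
    show "(v \<oplus>\<^sub>m w) * star (v \<oplus>\<^sub>m w) = e' \<oplus>\<^sub>m f'"
      by (simp only: star_dsum dsum_mult[OF c(1) star_mat_carrier[OF c(1)] c(2) star_mat_carrier[OF c(2)]] v w)
  qed
qed

text \<open>The usual flip has identity blocks, but \<open>A\<close> is not assumed to contain a
  unit. The blocks \<open>f\<close> and \<open>e\<close> act as units on their own ranges and keep
  the matrix over \<open>A\<close>.\<close>

lemma mvn_dsum_comm:
  assumes P: "e \<in> Proj" "f \<in> Proj"
  shows "mvn_equiv A (e \<oplus>\<^sub>m f) (f \<oplus>\<^sub>m e)"
proof -
  let ?n = "dim_row e" and ?m = "dim_row f"
  note e = ProjD[OF P(1)] and f = ProjD[OF P(2)]
  define v where "v = four_block_mat (0\<^sub>m ?m ?n) f e (0\<^sub>m ?n ?m)"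
  note d = carrier_matD[OF e(2)] carrier_matD[OF f(2)]
  have sv: "star v = four_block_mat (0\<^sub>m ?n ?m) e f (0\<^sub>m ?m ?n)"
    unfolding v_def
    by (simp only: star_four_block_mat[OF zero_carrier_mat f(2) e(2) zero_carrier_mat] star_zero_mat e(4) f(4))
  show ?thesis
  proof (rule mvnI)
    show "v \<in> mats_over A (dim_row (f \<oplus>\<^sub>m e)) (dim_row (e \<oplus>\<^sub>m f))"
      unfolding v_def dsum_dim by (rule mats_four_block[OF mats_zero f(1) e(1) mats_zero])
    show "star v * v = e \<oplus>\<^sub>m f"
      unfolding sv unfolding v_def mat_dsum_def
        mult_four_block_mat[OF zero_carrier_mat e(2) f(2) zero_carrier_mat zero_carrier_mat f(2) e(2) zero_carrier_mat]
      by (simp add: d(2,4) e(3) f(3) left_add_zero_mat[OF e(2)] right_add_zero_mat[OF f(2)])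
    show "v * star v = f \<oplus>\<^sub>m e"
      unfolding sv unfolding v_def mat_dsum_def
        mult_four_block_mat[OF zero_carrier_mat f(2) e(2) zero_carrier_mat zero_carrier_mat e(2) f(2) zero_carrier_mat]
      by (simp add: d(2,4) e(3) f(3) left_add_zero_mat[OF f(2)] right_add_zero_mat[OF e(2)])
  qed
qed

lemma mvn_zero: "mvn_equiv A (0\<^sub>m n n) (0\<^sub>m k k)"
  by (rule mvnI[of "0\<^sub>m k n"]) (simp_all add: mats_zero star_zero_mat)

subsection \<open>The monoid of equivalence classes of projections\<close>

definition mvn_class :: "'b mat \<Rightarrow> 'b mat set" where
  "mvn_class e = {f \<in> Proj. mvn_equiv A e f}"

text \<open>In this monoid \<open>K00_rel\<close> becomes an equation with a cancelled summand, so
  the Grothendieck construction is bookkeeping with \<open>V.m_ac\<close> instead of work with block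
  matrices.\<close>

definition mvn_monoid :: "'b mat set monoid" where
  "mvn_monoid = \<lparr>carrier = mvn_class ` Proj,
     monoid.mult = (\<lambda>X Y. \<Union>e\<in>X. \<Union>f\<in>Y. mvn_class (e \<oplus>\<^sub>m f)), one = mvn_class (0\<^sub>m 0 0)\<rparr>"

lemma mvn_class_eq_iff:
  assumes "e \<in> Proj" "f \<in> Proj"
  shows "mvn_class e = mvn_class f \<longleftrightarrow> mvn_equiv A e f"
proof
  assume "mvn_class e = mvn_class f"
  then have "f \<in> mvn_class e"
    using assms mvn_refl by (simp add: mvn_class_def)
  then show "mvn_equiv A e f"
    by (simp add: mvn_class_def)
next
  assume *: "mvn_equiv A e f"
  have "mvn_equiv A e g \<longleftrightarrow> mvn_equiv A f g" if "g \<in> Proj" for g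
    using mvn_trans[OF assms that *] mvn_trans[OF assms(2,1) that mvn_sym[OF *]] by blast
  then show "mvn_class e = mvn_class f"
    by (auto simp: mvn_class_def)
qed

lemma mvn_class_mult:
  assumes e: "e \<in> Proj" and f: "f \<in> Proj"
  shows "mvn_class e \<otimes>\<^bsub>mvn_monoid\<^esub> mvn_class f = mvn_class (e \<oplus>\<^sub>m f)"
proof -
  have eq: "mvn_class (e' \<oplus>\<^sub>m f') = mvn_class (e \<oplus>\<^sub>m f)" if "e' \<in> mvn_class e" "f' \<in> mvn_class f" for e' f'
  proof -
    have *: "e' \<in> Proj" "mvn_equiv A e e'" "f' \<in> Proj" "mvn_equiv A f f'"
      using that by (auto simp: mvn_class_def)
    show ?thesis
      unfolding mvn_class_eq_iff[OF Proj_dsum[OF *(1,3)] Proj_dsum[OF e f]]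
      by (rule mvn_dsum[OF mvn_sym[OF *(2)] mvn_sym[OF *(4)]])
  qed
  have "mvn_class e \<otimes>\<^bsub>mvn_monoid\<^esub> mvn_class f = (\<Union>e'\<in>mvn_class e. \<Union>f'\<in>mvn_class f. mvn_class (e' \<oplus>\<^sub>m f'))"
    by (simp add: mvn_monoid_def)
  also have "\<dots> = (\<Union>e'\<in>mvn_class e. \<Union>f'\<in>mvn_class f. mvn_class (e \<oplus>\<^sub>m f))"
    by (intro SUP_cong refl eq)
  also have "\<dots> = mvn_class (e \<oplus>\<^sub>m f)"
  proof -
    have "e \<in> mvn_class e" "f \<in> mvn_class f"
      using e f mvn_refl by (simp_all add: mvn_class_def)
    then have "mvn_class e \<noteq> {}" "mvn_class f \<noteq> {}"
      by blast+
    then show ?thesis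
      by simp
  qed
  finally show ?thesis .
qed

lemma mvn_class_carrier: "e \<in> Proj \<Longrightarrow> mvn_class e \<in> carrier mvn_monoid"
  by (simp add: mvn_monoid_def)

lemma mvn_monoid_comm_monoid: "comm_monoid mvn_monoid"
proof (rule comm_monoidI)
  have carr: "carrier mvn_monoid = mvn_class ` Proj" and one: "\<one>\<^bsub>mvn_monoid\<^esub> = mvn_class (0\<^sub>m 0 0)"
    by (simp_all add: mvn_monoid_def)
  show "\<one>\<^bsub>mvn_monoid\<^esub> \<in> carrier mvn_monoid"
    by (simp add: one mvn_class_carrier Proj_zero)
  fix X Y Z
  assume "X \<in> carrier mvn_monoid" "Y \<in> carrier mvn_monoid" "Z \<in> carrier mvn_monoid"
  then obtain e f g where *: "e \<in> Proj" "f \<in> Proj" "g \<in> Proj" "X = mvn_class e" "Y = mvn_class f" "Z = mvn_class g"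
    by (auto simp: carr)
  then show "X \<otimes>\<^bsub>mvn_monoid\<^esub> Y \<in> carrier mvn_monoid"
    by (simp add: mvn_class_mult mvn_class_carrier Proj_dsum)
  show "X \<otimes>\<^bsub>mvn_monoid\<^esub> Y \<otimes>\<^bsub>mvn_monoid\<^esub> Z = X \<otimes>\<^bsub>mvn_monoid\<^esub> (Y \<otimes>\<^bsub>mvn_monoid\<^esub> Z)"
    using * by (simp add: mvn_class_mult Proj_dsum dsum_assoc)
  show "\<one>\<^bsub>mvn_monoid\<^esub> \<otimes>\<^bsub>mvn_monoid\<^esub> X = X"
    using * by (simp add: one mvn_class_mult Proj_zero)
  show "X \<otimes>\<^bsub>mvn_monoid\<^esub> Y = Y \<otimes>\<^bsub>mvn_monoid\<^esub> X"
    using * by (simp add: mvn_class_mult mvn_class_eq_iff Proj_dsum mvn_dsum_comm)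
qed

subsection \<open>The Grothendieck group\<close>

sublocale V: comm_monoid mvn_monoid
  by (rule mvn_monoid_comm_monoid)

lemma K00_rel_iff:
  assumes "e \<in> Proj" "f \<in> Proj" "e' \<in> Proj" "f' \<in> Proj"
  shows "((e, f), (e', f')) \<in> K00_rel A \<longleftrightarrow> (\<exists>g\<in>Proj.
    mvn_class e \<otimes>\<^bsub>mvn_monoid\<^esub> mvn_class f' \<otimes>\<^bsub>mvn_monoid\<^esub> mvn_class g =
    mvn_class e' \<otimes>\<^bsub>mvn_monoid\<^esub> mvn_class f \<otimes>\<^bsub>mvn_monoid\<^esub> mvn_class g)"
  using assms by (simp add: K00_rel_def mvn_class_mult Proj_dsum mvn_class_eq_iff)

lemma K00_rel_sub: "K00_rel A \<subseteq> (Proj \<times> Proj) \<times> (Proj \<times> Proj)"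
  by (auto simp: K00_rel_def)

lemma K00_equiv: "equiv (Proj \<times> Proj) (K00_rel A)"
proof (rule equivI)
  show "K00_rel A \<subseteq> (Proj \<times> Proj) \<times> (Proj \<times> Proj)"
    by (rule K00_rel_sub)
  show "refl_on (Proj \<times> Proj) (K00_rel A)"
  proof (rule refl_onI)
    fix x assume "x \<in> Proj \<times> Proj"
    then show "(x, x) \<in> K00_rel A"
      by (cases x) (auto simp: K00_rel_iff intro!: bexI[OF _ Proj_zero[of 0]])
  qed
  show "sym (K00_rel A)"
  proof (rule symI)
    fix x y assume xy: "(x, y) \<in> K00_rel A"
    obtain e f e' f' where *: "x = (e, f)" "y = (e', f')"
      by (cases x; cases y)
    have P: "e \<in> Proj" "f \<in> Proj" "e' \<in> Proj" "f' \<in> Proj"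
      using xy K00_rel_sub by (auto simp: *)
    let ?c = mvn_class and ?G = mvn_monoid
    obtain g where g: "g \<in> Proj" "?c e \<otimes>\<^bsub>?G\<^esub> ?c f' \<otimes>\<^bsub>?G\<^esub> ?c g = ?c e' \<otimes>\<^bsub>?G\<^esub> ?c f \<otimes>\<^bsub>?G\<^esub> ?c g"
      using xy unfolding * K00_rel_iff[OF P] by auto
    show "(y, x) \<in> K00_rel A"
      unfolding * K00_rel_iff[OF P(3,4,1,2)] using g(1) g(2)[symmetric] by (rule bexI[rotated])
  qed
  show "trans (K00_rel A)"
  proof (rule transI)
    fix x y z assume xy: "(x, y) \<in> K00_rel A" and yz: "(y, z) \<in> K00_rel A"
    obtain e f e' f' e'' f'' where *: "x = (e, f)" "y = (e', f')" "z = (e'', f'')"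
      by (cases x; cases y; cases z)
    have P: "e \<in> Proj" "f \<in> Proj" "e' \<in> Proj" "f' \<in> Proj" "e'' \<in> Proj" "f'' \<in> Proj"
      using xy yz K00_rel_sub by (auto simp: *)
    let ?c = mvn_class and ?G = mvn_monoid
    obtain g where g: "g \<in> Proj" "?c e \<otimes>\<^bsub>?G\<^esub> ?c f' \<otimes>\<^bsub>?G\<^esub> ?c g = ?c e' \<otimes>\<^bsub>?G\<^esub> ?c f \<otimes>\<^bsub>?G\<^esub> ?c g"
      using xy P unfolding * by (auto simp: K00_rel_iff)
    obtain h where h: "h \<in> Proj" "?c e' \<otimes>\<^bsub>?G\<^esub> ?c f'' \<otimes>\<^bsub>?G\<^esub> ?c h = ?c e'' \<otimes>\<^bsub>?G\<^esub> ?c f' \<otimes>\<^bsub>?G\<^esub> ?c h"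
      using yz P unfolding * by (auto simp: K00_rel_iff)
    note cl = P[THEN mvn_class_carrier] g(1)[THEN mvn_class_carrier] h(1)[THEN mvn_class_carrier]
    \<comment> \<open>The summand stabilising the composite is
      \<open>f' \<oplus>\<^sub>m g \<oplus>\<^sub>m h\<close>: with the middle term
      \<open>f'\<close> added, both given equations can be substituted in turn.\<close>
    have "?c e \<otimes>\<^bsub>?G\<^esub> ?c f'' \<otimes>\<^bsub>?G\<^esub> (?c f' \<otimes>\<^bsub>?G\<^esub> ?c g \<otimes>\<^bsub>?G\<^esub> ?c h)
        = (?c e \<otimes>\<^bsub>?G\<^esub> ?c f' \<otimes>\<^bsub>?G\<^esub> ?c g) \<otimes>\<^bsub>?G\<^esub> (?c f'' \<otimes>\<^bsub>?G\<^esub> ?c h)"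
      using cl by (simp add: V.m_ac)
    also have "\<dots> = (?c e' \<otimes>\<^bsub>?G\<^esub> ?c f'' \<otimes>\<^bsub>?G\<^esub> ?c h) \<otimes>\<^bsub>?G\<^esub> (?c f \<otimes>\<^bsub>?G\<^esub> ?c g)"
      unfolding g(2) using cl by (simp add: V.m_ac)
    also have "\<dots> = ?c e'' \<otimes>\<^bsub>?G\<^esub> ?c f \<otimes>\<^bsub>?G\<^esub> (?c f' \<otimes>\<^bsub>?G\<^esub> ?c g \<otimes>\<^bsub>?G\<^esub> ?c h)"
      unfolding h(2) using cl by (simp add: V.m_ac)
    finally show "(x, z) \<in> K00_rel A"
      unfolding * using P g(1) h(1)
      by (auto simp: K00_rel_iff mvn_class_mult Proj_dsum intro!: bexI[of _ "f' \<oplus>\<^sub>m g \<oplus>\<^sub>m h"])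
  qed
qed

definition K00_class :: "'b mat \<Rightarrow> 'b mat \<Rightarrow> ('b mat \<times> 'b mat) set" where
  "K00_class e f = K00_rel A `` {(e, f)}"

lemma K00_class_eq_iff:
  assumes "e \<in> Proj" "f \<in> Proj" "e' \<in> Proj" "f' \<in> Proj"
  shows "K00_class e f = K00_class e' f' \<longleftrightarrow> ((e, f), (e', f')) \<in> K00_rel A"
  unfolding K00_class_def using assms by (intro eq_equiv_class_iff[OF K00_equiv]) auto

lemma K00_carrier_iff: "X \<in> carrier (K00 A) \<longleftrightarrow> (\<exists>e\<in>Proj. \<exists>f\<in>Proj. X = K00_class e f)"
  by (auto simp: K00_def K00_class_def quotient_def)

lemma K00_class_carrier: "e \<in> Proj \<Longrightarrow> f \<in> Proj \<Longrightarrow> K00_class e f \<in> carrier (K00 A)"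
  by (auto simp: K00_carrier_iff)

lemma K00_class_self: "e \<in> Proj \<Longrightarrow> f \<in> Proj \<Longrightarrow> (e, f) \<in> K00_class e f"
  unfolding K00_class_def using equiv_class_self[OF K00_equiv, of "(e, f)"] by auto

lemma K00_class_mult:
  assumes P: "e \<in> Proj" "f \<in> Proj" "e' \<in> Proj" "f' \<in> Proj"
  shows "K00_class e f \<otimes>\<^bsub>K00 A\<^esub> K00_class e' f' = K00_class (e \<oplus>\<^sub>m e') (f \<oplus>\<^sub>m f')"
proof -
  let ?c = mvn_class and ?G = mvn_monoid
  have *: "K00_class (a \<oplus>\<^sub>m a') (b \<oplus>\<^sub>m b') = K00_class (e \<oplus>\<^sub>m e') (f \<oplus>\<^sub>m f')"
    if ab: "(a, b) \<in> K00_class e f" and ab': "(a', b') \<in> K00_class e' f'" for a b a' b'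
  proof -
    have r: "((e, f), (a, b)) \<in> K00_rel A" "((e', f'), (a', b')) \<in> K00_rel A"
      using ab ab' by (auto simp: K00_class_def)
    have Q: "a \<in> Proj" "b \<in> Proj" "a' \<in> Proj" "b' \<in> Proj"
      using r K00_rel_sub by auto
    obtain g where g: "g \<in> Proj" "?c e \<otimes>\<^bsub>?G\<^esub> ?c b \<otimes>\<^bsub>?G\<^esub> ?c g = ?c a \<otimes>\<^bsub>?G\<^esub> ?c f \<otimes>\<^bsub>?G\<^esub> ?c g"
      using r(1) P Q by (auto simp: K00_rel_iff)
    obtain h where h: "h \<in> Proj" "?c e' \<otimes>\<^bsub>?G\<^esub> ?c b' \<otimes>\<^bsub>?G\<^esub> ?c h = ?c a' \<otimes>\<^bsub>?G\<^esub> ?c f' \<otimes>\<^bsub>?G\<^esub> ?c h"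
      using r(2) P Q by (auto simp: K00_rel_iff)
    note cl = P[THEN mvn_class_carrier] Q[THEN mvn_class_carrier]
      g(1)[THEN mvn_class_carrier] h(1)[THEN mvn_class_carrier]
    have "(?c a \<otimes>\<^bsub>?G\<^esub> ?c a') \<otimes>\<^bsub>?G\<^esub> (?c f \<otimes>\<^bsub>?G\<^esub> ?c f') \<otimes>\<^bsub>?G\<^esub> (?c g \<otimes>\<^bsub>?G\<^esub> ?c h)
        = (?c a \<otimes>\<^bsub>?G\<^esub> ?c f \<otimes>\<^bsub>?G\<^esub> ?c g) \<otimes>\<^bsub>?G\<^esub> (?c a' \<otimes>\<^bsub>?G\<^esub> ?c f' \<otimes>\<^bsub>?G\<^esub> ?c h)"
      using cl by (simp add: V.m_ac)
    also have "\<dots> = (?c e \<otimes>\<^bsub>?G\<^esub> ?c e') \<otimes>\<^bsub>?G\<^esub> (?c b \<otimes>\<^bsub>?G\<^esub> ?c b') \<otimes>\<^bsub>?G\<^esub> (?c g \<otimes>\<^bsub>?G\<^esub> ?c h)"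
      unfolding g(2)[symmetric] h(2)[symmetric] using cl by (simp add: V.m_ac)
    finally show ?thesis
      using P Q g(1) h(1)
      by (subst K00_class_eq_iff)
        (auto simp: K00_rel_iff mvn_class_mult Proj_dsum intro!: bexI[of _ "g \<oplus>\<^sub>m h"])
  qed
  have "K00_class e f \<otimes>\<^bsub>K00 A\<^esub> K00_class e' f'
      = (\<Union>(a, b)\<in>K00_class e f. \<Union>(a', b')\<in>K00_class e' f'. K00_class (a \<oplus>\<^sub>m a') (b \<oplus>\<^sub>m b'))"
    by (simp add: K00_def K00_class_def)
  also have "\<dots> = (\<Union>(a, b)\<in>K00_class e f. \<Union>(a', b')\<in>K00_class e' f'. K00_class (e \<oplus>\<^sub>m e') (f \<oplus>\<^sub>m f'))"
    using * by (intro SUP_cong refl) (auto split: prod.splits)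
  also have "\<dots> = K00_class (e \<oplus>\<^sub>m e') (f \<oplus>\<^sub>m f')"
  proof -
    have "K00_class e f \<noteq> {}" "K00_class e' f' \<noteq> {}"
      using K00_class_self[OF P(1,2)] K00_class_self[OF P(3,4)] by blast+
    then show ?thesis
      by (simp add: split_beta)
  qed
  finally show ?thesis .
qed

lemma K00_one: "\<one>\<^bsub>K00 A\<^esub> = K00_class (0\<^sub>m 0 0) (0\<^sub>m 0 0)"
  by (simp add: K00_def K00_class_def)

lemma K00_comm_group: "comm_group (K00 A)"
proof (rule comm_groupI)
  show "\<one>\<^bsub>K00 A\<^esub> \<in> carrier (K00 A)"
    by (simp add: K00_one K00_class_carrier Proj_zero)
  fix X Y Z
  assume X: "X \<in> carrier (K00 A)" and Y: "Y \<in> carrier (K00 A)" and Z: "Z \<in> carrier (K00 A)"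
  obtain e f where x: "e \<in> Proj" "f \<in> Proj" "X = K00_class e f"
    using X by (auto simp: K00_carrier_iff)
  obtain e' f' where y: "e' \<in> Proj" "f' \<in> Proj" "Y = K00_class e' f'"
    using Y by (auto simp: K00_carrier_iff)
  obtain e'' f'' where z: "e'' \<in> Proj" "f'' \<in> Proj" "Z = K00_class e'' f''"
    using Z by (auto simp: K00_carrier_iff)
  show "X \<otimes>\<^bsub>K00 A\<^esub> Y \<in> carrier (K00 A)"
    using x y by (simp add: K00_class_mult K00_class_carrier Proj_dsum)
  show "X \<otimes>\<^bsub>K00 A\<^esub> Y \<otimes>\<^bsub>K00 A\<^esub> Z = X \<otimes>\<^bsub>K00 A\<^esub> (Y \<otimes>\<^bsub>K00 A\<^esub> Z)"
    using x y z by (simp add: K00_class_mult Proj_dsum dsum_assoc)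
  show "\<one>\<^bsub>K00 A\<^esub> \<otimes>\<^bsub>K00 A\<^esub> X = X"
    using x by (simp add: K00_one K00_class_mult Proj_zero)
  have cl: "mvn_class e \<in> carrier mvn_monoid" "mvn_class f \<in> carrier mvn_monoid"
    "mvn_class e' \<in> carrier mvn_monoid" "mvn_class f' \<in> carrier mvn_monoid"
    "mvn_class (0\<^sub>m 0 0) \<in> carrier mvn_monoid"
    using x y by (auto intro: mvn_class_carrier Proj_zero)
  show "X \<otimes>\<^bsub>K00 A\<^esub> Y = Y \<otimes>\<^bsub>K00 A\<^esub> X"
    using x y cl
    by (auto simp: K00_class_mult K00_class_eq_iff Proj_dsum K00_rel_iff V.m_ac
        simp flip: mvn_class_mult intro!: bexI[OF _ Proj_zero[of 0]])
  show "\<exists>Y\<in>carrier (K00 A). Y \<otimes>\<^bsub>K00 A\<^esub> X = \<one>\<^bsub>K00 A\<^esub>"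
  proof
    show "K00_class f e \<in> carrier (K00 A)"
      using x by (simp add: K00_class_carrier)
    show "K00_class f e \<otimes>\<^bsub>K00 A\<^esub> X = \<one>\<^bsub>K00 A\<^esub>"
      using x cl
      by (auto simp: K00_one K00_class_mult K00_class_eq_iff Proj_dsum Proj_zero K00_rel_iff V.m_ac
          simp flip: mvn_class_mult intro!: bexI[OF _ Proj_zero[of 0]])
  qed
qed

end

lemma star_subring_UNIV: "star_subring UNIV"
  by standard auto

section \<open>Functoriality of K00\<close>

locale star_hom =
  fixes h :: "'b::star_ring \<Rightarrow> 'c::star_ring"
  assumes hom_add: "h (x + y) = h x + h y"
    and hom_mult: "h (x * y) = h x * h y"
    and hom_star: "h (star x) = star (h x)"
begin

lemma hom_zero: "h 0 = 0"
  using hom_add[of 0 0] by simp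

lemma hom_sum: "h (\<Sum>i\<in>I. f i) = (\<Sum>i\<in>I. h (f i))"
  by (induction I rule: infinite_finite_induct) (auto simp: hom_zero hom_add)

lemma map_mat_mult:
  assumes M: "M \<in> carrier_mat m n" and N: "N \<in> carrier_mat n k"
  shows "map_mat h (M * N) = map_mat h M * map_mat h N"
proof (rule eq_matI)
  fix i j assume "i < dim_row (map_mat h M * map_mat h N)" "j < dim_col (map_mat h M * map_mat h N)"
  then have ij: "i < m" "j < k"
    using M N by auto
  have MN: "M * N \<in> carrier_mat m k"
    using M N by (rule mult_carrier_mat)
  have "map_mat h (M * N) $$ (i, j) = h ((M * N) $$ (i, j))"
    using ij MN by (intro index_map_mat) auto
  also have "\<dots> = (\<Sum>l<n. h (M $$ (i, l)) * h (N $$ (l, j)))"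
    unfolding mult_mat_index[OF M N ij] hom_sum hom_mult ..
  also have "\<dots> = (\<Sum>l<n. map_mat h M $$ (i, l) * map_mat h N $$ (l, j))"
    using M N ij by (intro sum.cong) auto
  also have "\<dots> = (map_mat h M * map_mat h N) $$ (i, j)"
    using M N ij by (intro mult_mat_index[symmetric]) auto
  finally show "map_mat h (M * N) $$ (i, j) = (map_mat h M * map_mat h N) $$ (i, j)" .
qed (use M N in auto)

lemma map_mat_star: "map_mat h (star M) = star (map_mat h M)"
  by (rule eq_matI) (auto simp: hom_star)

lemma map_mat_dsum: "map_mat h (e \<oplus>\<^sub>m f) = map_mat h e \<oplus>\<^sub>m map_mat h f"
  by (rule eq_matI) (auto simp: dsum_index hom_zero)

lemma map_mat_projection:
  assumes "star_subring A" "e \<in> mat_projections A"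
  shows "map_mat h e \<in> mat_projections UNIV"
proof -
  note e = star_subring.ProjD[OF assms]
  show ?thesis
  proof (rule star_subring.ProjI[OF star_subring_UNIV])
    show "map_mat h e \<in> mats_over UNIV (dim_row e) (dim_row e)"
      unfolding mats_over_def using map_carrier_mat[THEN iffD2, OF e(2)] by blast
    show "map_mat h e * map_mat h e = map_mat h e"
      by (simp only: map_mat_mult[OF e(2) e(2), symmetric] e(3))
    show "star (map_mat h e) = map_mat h e"
      by (simp only: map_mat_star[symmetric] e(4))
  qed
qed

lemma map_mat_mvn:
  assumes "mvn_equiv A e f"
  shows "mvn_equiv UNIV (map_mat h e) (map_mat h f)"
proof -
  obtain v where v: "v \<in> mats_over A (dim_row f) (dim_row e)" "star v * v = e" "v * star v = f"
    using assms by (auto simp: mvn_equiv_def)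
  have c: "v \<in> carrier_mat (dim_row f) (dim_row e)"
    using v(1) by (simp add: mats_over_def)
  show ?thesis
  proof (rule star_subring.mvnI[OF star_subring_UNIV])
    show "map_mat h v \<in> mats_over UNIV (dim_row (map_mat h f)) (dim_row (map_mat h e))"
      using c by (simp add: mats_over_def)
    show "star (map_mat h v) * map_mat h v = map_mat h e"
      by (simp only: map_mat_star[symmetric] map_mat_mult[OF star_mat_carrier[OF c] c, symmetric] v(2))
    show "map_mat h v * star (map_mat h v) = map_mat h f"
      by (simp only: map_mat_star[symmetric] map_mat_mult[OF c star_mat_carrier[OF c], symmetric] v(3))
  qed
qed

context
  fixes A :: "'b set"
  assumes A: "star_subring A"
begin

lemma K00_map_class:
  assumes P: "e \<in> mat_projections A" "f \<in> mat_projections A"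
  shows "K00_map UNIV h (star_subring.K00_class A e f)
    = star_subring.K00_class UNIV (map_mat h e) (map_mat h f)"
proof -
  interpret A: star_subring A by (rule A)
  interpret U: star_subring "UNIV :: 'c set" by (rule star_subring_UNIV)
  have eq: "U.K00_class (map_mat h a) (map_mat h b) = U.K00_class (map_mat h e) (map_mat h f)"
    if ab: "(a, b) \<in> A.K00_class e f" for a b
  proof -
    have r: "((e, f), (a, b)) \<in> K00_rel A"
      using ab by (simp add: A.K00_class_def)
    then have Q: "a \<in> mat_projections A" "b \<in> mat_projections A"
      using A.K00_rel_sub by auto
    obtain g where g: "g \<in> mat_projections A" "mvn_equiv A (e \<oplus>\<^sub>m b \<oplus>\<^sub>m g) (a \<oplus>\<^sub>m f \<oplus>\<^sub>m g)"
      using r by (auto simp: K00_rel_def)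
    have "mvn_equiv UNIV (map_mat h e \<oplus>\<^sub>m map_mat h b \<oplus>\<^sub>m map_mat h g)
        (map_mat h a \<oplus>\<^sub>m map_mat h f \<oplus>\<^sub>m map_mat h g)"
      using map_mat_mvn[OF g(2)] by (simp add: map_mat_dsum)
    moreover note p = P[THEN map_mat_projection[OF A]] Q[THEN map_mat_projection[OF A]]
      map_mat_projection[OF A g(1)]
    ultimately have "((map_mat h e, map_mat h f), (map_mat h a, map_mat h b)) \<in> K00_rel UNIV"
      unfolding K00_rel_def by (simp, intro bexI[of _ "map_mat h g"])
    then have "U.K00_class (map_mat h e) (map_mat h f) = U.K00_class (map_mat h a) (map_mat h b)"
      unfolding U.K00_class_eq_iff[OF p(1-4)] .
    then show ?thesis ..
  qed
  have "K00_map UNIV h (A.K00_class e f)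
      = (\<Union>(a, b)\<in>A.K00_class e f. U.K00_class (map_mat h a) (map_mat h b))"
    by (simp add: K00_map_def U.K00_class_def)
  also have "\<dots> = (\<Union>(a, b)\<in>A.K00_class e f. U.K00_class (map_mat h e) (map_mat h f))"
    using eq by (intro SUP_cong refl) (auto split: prod.splits)
  also have "\<dots> = U.K00_class (map_mat h e) (map_mat h f)"
  proof -
    have "A.K00_class e f \<noteq> {}"
      using A.K00_class_self[OF P] by blast
    then show ?thesis
      by (simp add: split_beta)
  qed
  finally show ?thesis .
qed

text \<open>This homomorphism property makes the kernel that defines \<open>K0\<close> a subgroup,
  from which the group laws are inherited.\<close>

lemma K00_map_hom: "group_hom (K00 A) (K00 UNIV) (K00_map UNIV h)"
proof -
  interpret A: star_subring A by (rule A)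
  interpret U: star_subring "UNIV :: 'c set" by (rule star_subring_UNIV)
  have "K00_map UNIV h \<in> hom (K00 A) (K00 UNIV)"
  proof (rule homI)
    fix X assume "X \<in> carrier (K00 A)"
    then show "K00_map UNIV h X \<in> carrier (K00 UNIV)"
      by (auto simp: A.K00_carrier_iff K00_map_class intro!: U.K00_class_carrier map_mat_projection[OF A])
  next
    fix X Y assume "X \<in> carrier (K00 A)" "Y \<in> carrier (K00 A)"
    then obtain e f e' f' where P: "e \<in> mat_projections A" "f \<in> mat_projections A"
      "e' \<in> mat_projections A" "f' \<in> mat_projections A"
      and XY: "X = A.K00_class e f" "Y = A.K00_class e' f'"
      by (auto simp: A.K00_carrier_iff)
    show "K00_map UNIV h (X \<otimes>\<^bsub>K00 A\<^esub> Y) = K00_map UNIV h X \<otimes>\<^bsub>K00 UNIV\<^esub> K00_map UNIV h Y"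
      unfolding XY using P
      by (simp add: A.K00_class_mult K00_map_class A.Proj_dsum map_mat_dsum
          U.K00_class_mult map_mat_projection[OF A])
  qed
  then show ?thesis
    using A.K00_comm_group U.K00_comm_group
    by (auto simp: group_hom_def group_hom_axioms_def comm_group_def)
qed

end

end

lemma scalar_part_hom: "star_hom (scalar_part :: 'a::complex_star_algebra unitization \<Rightarrow> complex)"
  by standard
    (simp_all add: plus_unitization_def times_unitization_def star_unitization_def star_complex_def)

lemma zero_scaleC: "0 *\<^sub>C x = (0 :: 'a::complex_algebra)"
  using scaleC_distrib_left[of 0 0 x] by simp

lemma Unitize_mult: "Unitize a 0 * Unitize b 0 = Unitize (a * b) (0::complex)" for a b :: "'a::complex_algebra"
  by (simp add: times_unitization_def zero_scaleC)

lemma Unitize_add: "Unitize a 0 + Unitize b 0 = Unitize (a + b) (0::complex)" for a b :: "'a::complex_algebra"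
  by (simp add: plus_unitization_def)

lemma Unitize_star: "star (Unitize a 0) = Unitize (star a) (0::complex)"
  by (simp add: star_unitization_def)

lemma Unitize_zero: "Unitize 0 0 = (0 :: 'a::complex_algebra unitization)"
  by (simp add: zero_unitization_def)

abbreviation elem_mat :: "'a \<Rightarrow> 'a unitization mat" where
  "elem_mat p \<equiv> mat 1 1 (\<lambda>_. Unitize p 0)"

section \<open>Classes of projections of the ideal\<close>

context
  fixes J :: "'a::complex_star_algebra set"
  assumes J: "star_subring (unitize J)"
begin

interpretation A: star_subring "unitize J" by (rule J)

lemma K0_comm_group: "comm_group (K0 J)"
proof -
  interpret G: comm_group "K00 (unitize J)" by (rule A.K00_comm_group)
  interpret H: group_hom "K00 (unitize J)" "K00 (UNIV :: complex set)" "K00_map UNIV scalar_part"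
    by (rule star_hom.K00_map_hom[OF scalar_part_hom J])
  have "group (K0 J)"
    unfolding K0_def by (rule subgroup.subgroup_is_group[OF H.subgroup_kernel G.is_group])
  then show ?thesis
  proof (rule group.group_comm_groupI)
    fix X Y assume "X \<in> carrier (K0 J)" "Y \<in> carrier (K0 J)"
    then show "X \<otimes>\<^bsub>K0 J\<^esub> Y = Y \<otimes>\<^bsub>K0 J\<^esub> X"
      by (simp add: K0_def kernel_def G.m_comm)
  qed
qed

lemma elem_mat_in: "p \<in> J \<Longrightarrow> elem_mat p \<in> mats_over (unitize J) 1 1"
  by (simp add: mats_over_iff unitize_def)

lemma elem_mat_projection:
  assumes "p \<in> J" "is_projection p"
  shows "elem_mat p \<in> mat_projections (unitize J)"
proof (rule A.ProjI[OF elem_mat_in[OF assms(1)]])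
  show "elem_mat p * elem_mat p = elem_mat p"
    using assms(2) by (intro eq_matI)
      (simp_all add: mult_mat_index[of _ 1 1 _ 1] Unitize_mult is_projection_def del: index_mult_mat(1))
  show "star (elem_mat p) = elem_mat p"
    using assms(2) by (intro eq_matI) (auto simp: Unitize_star is_projection_def)
qed

lemma K0_class_eq: "K0_class J p = A.K00_class (elem_mat p) (0\<^sub>m 0 0)"
  by (simp add: K0_class_def A.K00_class_def)

text \<open>The scalar part of \<open>elem_mat p\<close> is a zero matrix of size one, which is
  equivalent to the empty matrix, so a single projection of \<open>J\<close> already gives a class
  in the kernel.\<close>

lemma K0_class_carrier:
  assumes "p \<in> J" "is_projection p"
  shows "K0_class J p \<in> carrier (K0 J)"
proof -
  interpret U: star_subring "UNIV :: complex set" by (rule star_subring_UNIV)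
  have "map_mat scalar_part (elem_mat p) = 0\<^sub>m 1 1" "map_mat scalar_part (0\<^sub>m 0 0 :: 'a unitization mat) = 0\<^sub>m 0 0"
    by (auto intro!: eq_matI)
  then have "K00_map UNIV scalar_part (K0_class J p) = U.K00_class (0\<^sub>m 1 1) (0\<^sub>m 0 0)"
    unfolding K0_class_eq
    by (subst star_hom.K00_map_class[OF scalar_part_hom J elem_mat_projection[OF assms] A.Proj_zero]) simp
  also have "\<dots> = U.K00_class (0\<^sub>m 0 0) (0\<^sub>m 0 0)"
  proof -
    have "mvn_equiv UNIV (0\<^sub>m 1 1 \<oplus>\<^sub>m 0\<^sub>m 0 0 \<oplus>\<^sub>m 0\<^sub>m 0 0) (0\<^sub>m 0 0 \<oplus>\<^sub>m 0\<^sub>m 0 0 \<oplus>\<^sub>m (0\<^sub>m 0 0 :: complex mat))"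
      using U.mvn_zero[of 1 0] by simp
    then show ?thesis
      unfolding U.K00_class_eq_iff[OF U.Proj_zero U.Proj_zero U.Proj_zero U.Proj_zero] K00_rel_def
      using U.Proj_zero by blast
  qed
  finally have "K00_map UNIV scalar_part (K0_class J p) = \<one>\<^bsub>K00 (UNIV :: complex set)\<^esub>"
    by (simp add: U.K00_one)
  moreover have "K0_class J p \<in> carrier (K00 (unitize J))"
    unfolding K0_class_eq by (rule A.K00_class_carrier[OF elem_mat_projection[OF assms] A.Proj_zero])
  ultimately show ?thesis
    by (simp add: K0_def kernel_def)
qed

lemma K00_class_mvn:
  assumes "e \<in> mat_projections (unitize J)" "f \<in> mat_projections (unitize J)" "mvn_equiv (unitize J) e f"
  shows "A.K00_class e (0\<^sub>m 0 0) = A.K00_class f (0\<^sub>m 0 0)"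
proof -
  have "mvn_equiv (unitize J) (e \<oplus>\<^sub>m 0\<^sub>m 0 0 \<oplus>\<^sub>m 0\<^sub>m 0 0) (f \<oplus>\<^sub>m 0\<^sub>m 0 0 \<oplus>\<^sub>m 0\<^sub>m 0 0)"
    using assms(3) by simp
  then show ?thesis
    unfolding A.K00_class_eq_iff[OF assms(1) A.Proj_zero assms(2) A.Proj_zero] K00_rel_def
    using assms(1,2) A.Proj_zero by blast
qed

text \<open>The matrix of \<open>v\<close> is over the unitization of \<open>J\<close> only if
  \<open>v\<close> itself lies in \<open>J\<close>, hence this hypothesis besides those on the two
  projections.\<close>

lemma K0_class_mvn:
  assumes v: "v \<in> J" and e: "star v * v \<in> J" "is_projection (star v * v)"
    and f: "v * star v \<in> J" "is_projection (v * star v)"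
  shows "K0_class J (star v * v) = K0_class J (v * star v)"
  unfolding K0_class_eq
proof (rule K00_class_mvn[OF elem_mat_projection[OF e] elem_mat_projection[OF f] A.mvnI])
  show "elem_mat v \<in> mats_over (unitize J) (dim_row (elem_mat (v * star v))) (dim_row (elem_mat (star v * v)))"
    using elem_mat_in[OF v] by simp
  have s: "star (elem_mat v) = elem_mat (star v)"
    by (rule eq_matI) (auto simp: Unitize_star)
  show "star (elem_mat v) * elem_mat v = elem_mat (star v * v)"
    unfolding s by (rule eq_matI)
      (simp_all add: mult_mat_index[of _ 1 1 _ 1] Unitize_mult del: index_mult_mat(1))
  show "elem_mat v * star (elem_mat v) = elem_mat (v * star v)"
    unfolding s by (rule eq_matI)
      (simp_all add: mult_mat_index[of _ 1 1 _ 1] Unitize_mult del: index_mult_mat(1))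
qed

text \<open>A column with entries \<open>e\<close> and \<open>f\<close> implements the equivalence:
  orthogonality makes \<open>v * star v\<close> block diagonal, while \<open>star v * v\<close> is
  the sum.\<close>

lemma K0_class_add:
  assumes e: "e \<in> J" "is_projection e" and f: "f \<in> J" "is_projection f"
    and ef: "e + f \<in> J" "is_projection (e + f)" and orth: "e * f = 0" "f * e = 0"
  shows "K0_class J (e + f) = K0_class J e \<otimes>\<^bsub>K0 J\<^esub> K0_class J f"
proof -
  note P = elem_mat_projection[OF e] elem_mat_projection[OF f] elem_mat_projection[OF ef]
  define v where "v = mat 2 1 (\<lambda>(i, j). Unitize (if i = 0 then e else f) (0::complex))"
  have v: "v \<in> carrier_mat 2 1"
    by (simp add: v_def)
  have sv: "star v = mat 1 2 (\<lambda>(i, j). Unitize (if j = 0 then e else f) 0)"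
    using e f by (intro eq_matI) (auto simp: v_def Unitize_star is_projection_def)
  have ee: "e * e = e" "f * f = f" "star e = e" "star f = f"
    using e f by (simp_all add: is_projection_def)
  have "mvn_equiv (unitize J) (elem_mat (e + f)) (elem_mat e \<oplus>\<^sub>m elem_mat f)"
  proof (rule A.mvnI)
    show "v \<in> mats_over (unitize J) (dim_row (elem_mat e \<oplus>\<^sub>m elem_mat f)) (dim_row (elem_mat (e + f)))"
      using e f by (auto simp: mats_over_iff v_def unitize_def)
    show "star v * v = elem_mat (e + f)"
    proof (rule eq_matI)
      fix i j assume "i < dim_row (elem_mat (e + f))" "j < dim_col (elem_mat (e + f))"
      then have ij: "i = 0" "j = 0" by auto
      have "(star v * v) $$ (0, 0) = (\<Sum>l<2. star v $$ (0, l) * v $$ (l, 0))"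
        using v by (intro mult_mat_index[of _ 1 2 _ 1]) auto
      also have "\<dots> = Unitize (e + f) 0"
        by (simp add: sv v_def numeral_2_eq_2 Unitize_mult Unitize_add Unitize_star ee)
      finally show "(star v * v) $$ (i, j) = elem_mat (e + f) $$ (i, j)"
        by (simp add: ij)
    qed (use v in auto)
    show "v * star v = elem_mat e \<oplus>\<^sub>m elem_mat f"
    proof (rule eq_matI)
      fix i j assume "i < dim_row (elem_mat e \<oplus>\<^sub>m elem_mat f)" "j < dim_col (elem_mat e \<oplus>\<^sub>m elem_mat f)"
      then have ij: "i < 2" "j < 2" by auto
      have "(v * star v) $$ (i, j) = (\<Sum>l<1. v $$ (i, l) * star v $$ (l, j))"
        using v ij by (intro mult_mat_index[of _ 2 1 _ 2]) auto
      also have "\<dots> = Unitize ((if i = 0 then e else f) * (if j = 0 then e else f)) 0"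
        using ij by (simp add: sv v_def Unitize_mult Unitize_star ee(3,4))
      also have "\<dots> = (elem_mat e \<oplus>\<^sub>m elem_mat f) $$ (i, j)"
        using ij by (auto simp: dsum_index ee orth Unitize_zero)
      finally show "(v * star v) $$ (i, j) = (elem_mat e \<oplus>\<^sub>m elem_mat f) $$ (i, j)" .
    qed (use v in auto)
  qed
  then have "K0_class J (e + f) = A.K00_class (elem_mat e \<oplus>\<^sub>m elem_mat f) (0\<^sub>m 0 0)"
    unfolding K0_class_eq by (rule K00_class_mvn[OF P(3) A.Proj_dsum[OF P(1,2)]])
  also have "\<dots> = K0_class J e \<otimes>\<^bsub>K00 (unitize J)\<^esub> K0_class J f"
    unfolding K0_class_eq using A.K00_class_mult[OF P(1) A.Proj_zero P(2) A.Proj_zero] by simp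
  finally show ?thesis
    by (simp add: K0_def)
qed

end

section \<open>Closed ideals of von Neumann algebras\<close>

lemma commutant_scaleC: "is_commutant N \<Longrightarrow> T \<in> N \<Longrightarrow> c *\<^sub>C T \<in> N" for T :: "'a::hilbert_space bop"
  by (auto simp: is_commutant_def commutant_def mult_scaleC_left mult_scaleC_right)

locale vn_ideal =
  fixes N J :: "'a::hilbert_space bop set"
  assumes vn: "von_neumann_algebra N" and ideal: "ideal J (op_ring N)" and closed: "closed J"
begin

interpretation I: ideal J "op_ring N" by (rule ideal)

lemma comm: "is_commutant N"
  by (rule von_neumann_is_commutant[OF vn])

lemmas N_one = commutant_one[OF comm]
  and N_add = commutant_add[OF comm] and N_diff = commutant_diff[OF comm]
  and N_uminus = commutant_uminus[OF comm] and N_mult = commutant_mult[OF comm]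
  and N_scaleR = commutant_scaleR[OF comm] and N_star = von_neumann_star[OF vn]

lemma J_sub: "x \<in> J \<Longrightarrow> x \<in> N"
  using I.a_Hcarr by (simp add: op_ring_def)

lemma J_zero: "0 \<in> J"
  using additive_subgroup.zero_closed[OF I.is_additive_subgroup] by (simp add: op_ring_def)

lemma J_add: "x \<in> J \<Longrightarrow> y \<in> J \<Longrightarrow> x + y \<in> J"
  using additive_subgroup.a_closed[OF I.is_additive_subgroup, of x y] by (simp add: op_ring_def)

lemma J_mult_left: "x \<in> J \<Longrightarrow> T \<in> N \<Longrightarrow> T * x \<in> J"
  using I.I_l_closed by (simp add: op_ring_def)

lemma J_mult_right: "x \<in> J \<Longrightarrow> T \<in> N \<Longrightarrow> x * T \<in> J"
  using I.I_r_closed by (simp add: op_ring_def)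

lemma J_uminus: "x \<in> J \<Longrightarrow> - x \<in> J"
  using J_mult_left[of x "- 1"] N_uminus[OF N_one] by simp

lemma J_diff: "x \<in> J \<Longrightarrow> y \<in> J \<Longrightarrow> x - y \<in> J"
  using J_add[of x "- y"] J_uminus by simp

lemma J_scaleR: "x \<in> J \<Longrightarrow> a *\<^sub>R x \<in> J"
  using J_mult_left[of x "a *\<^sub>R 1"] N_scaleR[OF N_one] by simp

lemma J_scaleC: "x \<in> J \<Longrightarrow> c *\<^sub>C x \<in> J"
  using J_mult_left[of x "c *\<^sub>C 1"] commutant_scaleC[OF comm N_one] by (simp add: mult_scaleC_left)

text \<open>With \<open>A = T T*\<close> scaled so that \<open>0 \<le> A \<le> 1\<close>, the elements \<open>T* (1 - (1 - A)\<^sup>n)\<close> of \<open>J\<close> converge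
  to \<open>T*\<close> because \<open>\<parallel>T* (1 - A)\<^sup>n\<parallel>\<^sup>2\<close> is of order \<open>1 / n\<close>.\<close>

lemma J_star:
  assumes T: "T \<in> J"
  shows "star T \<in> J"
proof -
  define c where "c = 1 / (norm (T * star T) + 1)"
  have c: "c > 0" "c * norm (T * star T) \<le> 1"
    by (auto simp: c_def field_simps add_pos_nonneg)
  have pos: "positive_op (T * star T)"
    using positive_star_mult[of "star T"] by simp
  define C where "C = 1 - c *\<^sub>R (T * star T)"
  have C: "positive_op C" "positive_op (1 - C)"
    unfolding C_def using c pos by (auto intro: positive_one_minus_scaled positive_scaleR)
  have TN: "T \<in> N" "star T \<in> N"
    using T J_sub N_star by auto
  have CN: "C \<in> N"
    unfolding C_def using TN by (intro N_diff N_one N_scaleR N_mult)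
  have "1 - C \<in> J"
    unfolding C_def using T TN by (simp add: J_scaleR J_mult_right)
  then have "(1 - C) * (\<Sum>k<n. C ^ k) \<in> J" for n
    using CN by (intro J_mult_right commutant_sum[OF comm] commutant_power[OF comm])
  moreover have "(1 - C) * (\<Sum>k<n. C ^ k) = 1 - C ^ n" for n
    by (induction n) (simp_all add: distrib_left, simp add: left_diff_distrib)
  ultimately have inJ: "star T * (1 - C ^ n) \<in> J" for n
    using J_mult_left[OF _ TN(2)] by simp
  have bound: "norm (star T * C ^ n) \<le> sqrt (1 / c * (1 / real (Suc n)))" for n
  proof (rule norm_bop_le)
    fix x
    have sa: "star C = C"
      by (rule positive_selfadjoint[OF C(1)])
    have TT: "T * star T = (1 / c) *\<^sub>R (1 - C)"
      using c by (simp add: C_def)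
    have "(1 - C) * C ^ n = C ^ n * (1 - C)"
      by (simp add: left_diff_distrib right_diff_distrib power_commutes)
    then have prod: "C ^ n * ((1 - C) * C ^ n) = C ^ (n + n) * (1 - C)"
      by (simp add: power_add mult.assoc)
    have "(norm ((star T * C ^ n) \<cdot> x))\<^sup>2 = inner (C ^ n \<cdot> x) ((T * star T) \<cdot> C ^ n \<cdot> x)"
      using norm_star_mult[of "star T" "C ^ n \<cdot> x"] by simp
    also have "\<dots> = 1 / c * inner (C ^ n \<cdot> x) ((1 - C) \<cdot> C ^ n \<cdot> x)"
      unfolding TT by simp
    also have "inner (C ^ n \<cdot> x) ((1 - C) \<cdot> C ^ n \<cdot> x) = inner x ((C ^ n * ((1 - C) * C ^ n)) \<cdot> x)"
      unfolding inner_star[of "C ^ n"] by (simp add: sa)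
    also note prod
    \<comment> \<open>\<open>contraction_form_gap\<close> is applied at the doubled exponent, and
      its factor \<open>2 n + 1\<close> is lowered to \<open>n + 1\<close>.\<close>
    also have "1 / c * inner x ((C ^ (n + n) * (1 - C)) \<cdot> x) \<le> 1 / c * (1 / real (Suc n) * (norm x)\<^sup>2)"
    proof (intro mult_left_mono)
      let ?d = "inner x ((C ^ (n + n) * (1 - C)) \<cdot> x)"
      have "0 \<le> ?d"
        by (rule positive_inner[OF contraction_power_step[OF C]])
      then have "real (Suc n) * ?d \<le> real (Suc (n + n)) * ?d"
        by (intro mult_right_mono) auto
      also have "\<dots> \<le> (norm x)\<^sup>2"
        by (rule contraction_form_gap[OF C])
      finally have "?d * real (Suc n) \<le> (norm x)\<^sup>2"
        by (simp only: mult.commute)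
      then have "?d \<le> (norm x)\<^sup>2 / real (Suc n)"
        by (simp only: pos_le_divide_eq of_nat_0_less_iff zero_less_Suc)
      then show "?d \<le> 1 / real (Suc n) * (norm x)\<^sup>2"
        by (simp only: times_divide_eq_left mult_1)
    qed (use c in simp)
    also have "\<dots> = (sqrt (1 / c * (1 / real (Suc n))) * norm x)\<^sup>2"
      using c by (simp add: power_mult_distrib)
    finally show "norm ((star T * C ^ n) \<cdot> x) \<le> sqrt (1 / c * (1 / real (Suc n))) * norm x"
      using c by (intro power2_le_imp_le[OF _ mult_nonneg_nonneg]) auto
  qed (use c in simp)
  have "(\<lambda>n. sqrt (1 / c * (1 / real (Suc n)))) \<longlonglongrightarrow> sqrt (1 / c * 0)"
    by (intro tendsto_intros LIMSEQ_Suc[OF lim_1_over_n])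
  then have lim: "(\<lambda>n. sqrt (1 / c * (1 / real (Suc n)))) \<longlonglongrightarrow> 0"
    by (simp only: mult_zero_right real_sqrt_zero)
  have "(\<lambda>n. star T * C ^ n) \<longlonglongrightarrow> 0"
    by (rule Lim_null_comparison[OF always_eventually lim]) (intro allI bound)
  then have "(\<lambda>n. star T - star T * C ^ n) \<longlonglongrightarrow> star T - 0"
    by (intro tendsto_diff tendsto_const)
  then have "(\<lambda>n. star T * (1 - C ^ n)) \<longlonglongrightarrow> star T"
    by (simp add: right_diff_distrib)
  then show ?thesis
    using closed inJ by (rule closed_sequentially[rotated 2])
qed

text \<open>Closure under \<open>star\<close> comes from \<open>J_star\<close> and thus from the
  norm closedness of \<open>J\<close>.\<close>

lemma unitize_star_subring: "star_subring (unitize J)"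
  by standard
    (auto simp: unitize_def zero_unitization_def plus_unitization_def times_unitization_def
      star_unitization_def J_zero J_add J_star J_scaleC intro!: J_add J_mult_right J_sub)

lemmas K0_group = K0_comm_group[OF unitize_star_subring]

section \<open>Representatives modulo the ideal\<close>

lemma quot_map_eq: "quot_map N J S = {j + S | j. j \<in> J}"
  by (auto simp: quot_map_def a_r_coset_def' op_ring_def)

lemma quot_map_eqI:
  assumes "S - T \<in> J"
  shows "quot_map N J S = quot_map N J T"
proof -
  have "j + S \<in> quot_map N J T" if "j \<in> J" for j
    unfolding quot_map_eq using J_add[OF that assms] by (auto intro!: exI[of _ "j + (S - T)"])
  moreover have "j + T \<in> quot_map N J S" if "j \<in> J" for j
    unfolding quot_map_eq using J_diff[OF that assms] by (auto intro!: exI[of _ "j - (S - T)"])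
  ultimately show ?thesis
    by (auto simp: quot_map_eq)
qed

text \<open>An infimum below \<open>c\<close> is undercut by some representative, which turns a
  bound in the quotient norm into a bound in norm up to a correction from \<open>J\<close>.\<close>

lemma quot_dist_less:
  assumes S: "S \<in> N" and T: "T \<in> N" and less: "quot_dist N J S T < c"
  obtains j where "j \<in> J" "norm (S - T + j) < c"
proof -
  let ?R = "op_ring N"
  interpret H: ring_hom_ring ?R "?R Quot J" "(+>\<^bsub>?R\<^esub>) J"
    by (rule I.rcos_ring_hom_ring)
  have carr: "S \<in> carrier ?R" "T \<in> carrier ?R"
    using S T by (simp_all add: op_ring_def)
  have "\<ominus>\<^bsub>?R\<^esub> T = - T"
    using T N_uminus by (intro I.minus_equality) (auto simp: op_ring_def)
  then have diff: "S \<ominus>\<^bsub>?R\<^esub> T = S - T"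
    by (simp add: a_minus_def) (simp add: op_ring_def)
  have "quot_map N J S \<ominus>\<^bsub>?R Quot J\<^esub> quot_map N J T = quot_map N J (S \<ominus>\<^bsub>?R\<^esub> T)"
    using carr by (simp add: quot_map_def a_minus_def)
  then have "quot_dist N J S T = Inf (norm ` {j + (S - T) | j. j \<in> J})"
    by (simp add: quot_dist_def quot_norm_def diff quot_map_eq)
  then have "Inf (norm ` {j + (S - T) | j. j \<in> J}) < c"
    using less by simp
  then obtain y where "y \<in> norm ` {j + (S - T) | j. j \<in> J}" "y < c"
    using J_zero by (subst (asm) cInf_less_iff) (auto intro: bdd_belowI2[of _ 0])
  then show ?thesis
    using that by (auto simp: add.commute)
qed

text \<open>\<open>1 - D\<close> is invertible within \<open>N\<close>, so the factor can be
  cancelled inside the ideal.\<close>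

lemma J_inverse_cancel:
  assumes "x * (1 - D) \<in> J" "D \<in> N" "norm D < 1" "x \<in> N"
  shows "x \<in> J"
proof -
  obtain R where R: "R \<in> N" "R * (1 - D) = 1" "(1 - D) * R = 1"
    by (rule neumann_inverse[OF comm assms(2,3)]) (rule that)
  have "x * (1 - D) * R \<in> J"
    using assms(1) R(1) by (rule J_mult_right)
  then show ?thesis
    by (simp add: mult.assoc R)
qed

text \<open>\<open>e\<close> is the spectral projection of \<open>K\<close> for the numbers above
  \<open>eps\<close>; it lies below \<open>p\<close> because \<open>K\<close> vanishes off
  \<open>p\<close>. On its range \<open>C = 1 - c *\<^sub>R K\<close> is a strict contraction, so
  \<open>1 - C * e\<close> is invertible, and \<open>e * (1 - C * e)\<close> is a multiple of
  \<open>K * e\<close>. Cancelling puts \<open>e\<close> into \<open>J\<close>.\<close>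

lemma spectral_cut:
  assumes K: "positive_op K" "K \<in> J" and eps: "eps > 0"
    and p: "is_projection p" "p * K = K" "K * p = K"
  obtains e where "is_projection e" "e \<in> J" "p * e = e" "e * p = e"
    "\<And>x. e \<cdot> x = 0 \<Longrightarrow> inner x (K \<cdot> x) \<le> eps * (norm x)\<^sup>2"
proof -
  have Ksa: "star K = K"
    by (rule positive_selfadjoint[OF K(1)])
  define P where "P = nonneg_proj (eps *\<^sub>R 1 - K)"
  have sa: "star (eps *\<^sub>R 1 - K) = eps *\<^sub>R 1 - K"
    by (simp add: Ksa)
  have P: "is_projection P"
    unfolding P_def by (rule nonneg_proj_projection)
  define e where "e = 1 - P"
  have e: "is_projection e"
    unfolding e_def by (rule projection_compl[OF P])
  have KN: "K \<in> N"
    by (rule J_sub[OF K(2)])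
  have PN: "P \<in> N"
    unfolding P_def using KN by (intro nonneg_proj_commutant[OF sa comm] N_diff N_scaleR N_one)
  have eN: "e \<in> N"
    unfolding e_def by (intro N_diff N_one PN)
  have PK: "P * K = K * P"
    unfolding P_def by (rule nonneg_proj_commute[OF sa]) (simp add: algebra_simps)
  have Pp: "P * p = p * P"
    unfolding P_def by (rule nonneg_proj_commute[OF sa]) (simp add: algebra_simps p)
  have low: "inner x (K \<cdot> x) \<le> eps * (norm x)\<^sup>2" if "e \<cdot> x = 0" for x
  proof -
    have "x = P \<cdot> x"
      using that unfolding e_def bop_apply_simps right_minus_eq .
    then have "P \<cdot> x = x" ..
    from nonneg_proj_form[OF sa, folded P_def, OF this] show ?thesis
      by (simp add: inner_diff_right power2_norm_eq_inner)
  qed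
  have high: "eps * (norm x)\<^sup>2 \<le> inner x (K \<cdot> x)" if "e \<cdot> x = x" for x
    using nonneg_proj_form_compl[OF sa, of x] that
    by (cases "x = 0") (auto simp: e_def P_def inner_diff_right power2_norm_eq_inner)
  have pe: "p * e = e"
  proof (rule bop_eqI)
    fix x
    define z where "z = e \<cdot> x - p \<cdot> e \<cdot> x"
    have "e * p = p * e"
      by (simp add: e_def algebra_simps Pp)
    from this[THEN arg_cong[where f = "\<lambda>T. T \<cdot> e \<cdot> x"]]
    have "e \<cdot> p \<cdot> e \<cdot> x = p \<cdot> e \<cdot> e \<cdot> x"
      by simp
    then have ez: "e \<cdot> z = z"
      by (simp add: z_def projection_apply[OF e])
    have "K \<cdot> z = (K * p) \<cdot> z"
      by (simp add: p)
    also have "\<dots> = 0"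
      by (simp add: z_def projection_apply[OF p(1)])
    finally have "eps * (norm z)\<^sup>2 \<le> 0"
      using high[OF ez] by simp
    then have "z = 0"
      using eps by (simp add: mult_le_0_iff)
    then have "e \<cdot> x = p \<cdot> e \<cdot> x"
      unfolding z_def right_minus_eq .
    then show "(p * e) \<cdot> x = e \<cdot> x"
      unfolding bop_apply_simps ..
  qed
  have "e * p = p * e"
    by (simp add: e_def algebra_simps Pp)
  then have ep: "e * p = e"
    by (simp only: pe)
  \<comment> \<open>The added \<open>eps\<close> ensures \<open>c * eps \<le> 1\<close>, so the
    square root below is taken of a nonnegative number.\<close>
  define c where "c = 1 / (norm K + 1 + eps)"
  have c: "c > 0" "c * norm K \<le> 1" "c * eps \<le> 1"
    using eps by (auto simp: c_def field_simps add_pos_nonneg)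
  define C where "C = 1 - c *\<^sub>R K"
  have C: "positive_op C" "positive_op (1 - C)"
    unfolding C_def using c K by (auto intro: positive_one_minus_scaled positive_scaleR)
  have "norm (C * e) \<le> sqrt (1 - c * eps)"
  proof (rule norm_bop_le)
    fix x
    let ?y = "e \<cdot> x"
    have ey: "e \<cdot> ?y = ?y"
      by (rule projection_apply[OF e])
    have "(norm (C \<cdot> ?y))\<^sup>2 = inner ?y (C ^ Suc 1 \<cdot> ?y)"
      using contraction_power_inner[OF C, of 1 ?y 1] by (simp add: power2_norm_eq_inner)
    also have "\<dots> \<le> inner ?y (C ^ 1 \<cdot> ?y)"
      by (rule contraction_form_decreasing[OF C])
    also have "\<dots> = (norm ?y)\<^sup>2 - c * inner ?y (K \<cdot> ?y)"
      by (simp add: C_def inner_diff_right power2_norm_eq_inner)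
    also have "\<dots> \<le> (norm ?y)\<^sup>2 - c * (eps * (norm ?y)\<^sup>2)"
      using c by (intro diff_left_mono mult_left_mono high ey) simp
    also have "\<dots> = (1 - c * eps) * (norm ?y)\<^sup>2"
      by (simp only: left_diff_distrib mult_1 mult.assoc)
    also have "\<dots> \<le> (1 - c * eps) * (norm x)\<^sup>2"
      using c by (intro mult_left_mono power_mono projection_norm_le[OF e]) auto
    also have "\<dots> = (sqrt (1 - c * eps) * norm x)\<^sup>2"
      using c by (simp add: power_mult_distrib)
    finally show "norm ((C * e) \<cdot> x) \<le> sqrt (1 - c * eps) * norm x"
      using c by (intro power2_le_imp_le[OF _ mult_nonneg_nonneg]) auto
  qed (use c in simp)
  also have "\<dots> < 1"
    using c eps by simp
  finally have less: "norm (C * e) < 1" .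
  have eK: "e * K = K * e"
    using PK by (simp add: e_def algebra_simps)
  have "e * C = C * e"
    by (simp add: C_def algebra_simps eK)
  then have "e * (C * e) = C * (e * e)"
    by (simp flip: mult.assoc)
  then have "e * (C * e) = C * e"
    using e by (simp add: is_projection_def)
  then have "e * (1 - C * e) = (1 - C) * e"
    by (simp only: right_diff_distrib left_diff_distrib mult_1_right mult_1_left)
  also have "1 - C = c *\<^sub>R K"
    by (simp add: C_def)
  finally have "e * (1 - C * e) = c *\<^sub>R (K * e)"
    by simp
  then have "e * (1 - C * e) \<in> J"
    using K(2) eN by (simp add: J_scaleR J_mult_right)
  moreover have "C * e \<in> N"
    unfolding C_def using KN eN by (intro N_mult N_diff N_one N_scaleR)
  ultimately have "e \<in> J"
    using less eN by (rule J_inverse_cancel)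
  then show ?thesis
    using low by (rule that[OF e _ pe ep])
qed

end

section \<open>The index of a pair of projections\<close>

lemma (in comm_group) div_eq_div:
  assumes "x \<in> carrier G" "a \<in> carrier G" "b \<in> carrier G" "c \<in> carrier G" "x \<otimes> b = c \<otimes> a"
  shows "x \<otimes> inv c = a \<otimes> inv b"
proof -
  let ?y = "a \<otimes> inv b"
  have "x = x \<otimes> b \<otimes> inv b"
    using assms(1-4) by (simp add: m_assoc)
  then have "x = c \<otimes> ?y"
    unfolding assms(5) using assms(1-4) by (simp add: m_assoc)
  then have "x \<otimes> inv c = inv c \<otimes> (c \<otimes> ?y)"
    using assms(1-4) by (simp only: m_comm m_closed inv_closed)
  also have "\<dots> = ?y"
    using assms(1-4) by (simp flip: m_assoc)
  finally show ?thesis .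
qed

lemma mult_eq_assoc: "S * T = R \<Longrightarrow> S * (T * X) = R * (X :: 'a::semigroup_mult)"
  by (simp flip: mult.assoc)

lemma bop_mult_eq: "S * T = R \<Longrightarrow> S \<cdot> T \<cdot> x = R \<cdot> x"
  by (simp flip: bop_apply_simps(7))

lemma null_proj_eqI:
  assumes R: "is_projection R" and "\<And>x. T \<cdot> x = 0 \<longleftrightarrow> R \<cdot> x = 0"
  shows "null_proj T = 1 - R"
proof (rule projection_eqI_range[OF null_proj_projection projection_compl[OF R]])
  show "range (bop_apply (null_proj T)) = range (bop_apply (1 - R))"
    unfolding null_proj_range projection_range[OF projection_compl[OF R]] by (simp add: assms(2))
qed

text \<open>\<open>Y\<close> inverts the compression \<open>q\<^sub>1 p\<^sub>1\<close>, viewed as a map from the range of \<open>p\<^sub>1\<close> to that of \<open>q\<^sub>1\<close>.\<close>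

definition linked :: "'a::hilbert_space bop \<Rightarrow> 'a bop \<Rightarrow> 'a bop \<Rightarrow> bool" where
  "linked p1 q1 Y \<longleftrightarrow> p1 * Y = Y \<and> Y * q1 = Y \<and> Y * p1 = p1 \<and> q1 * Y = q1"

text \<open>The relation is symmetric up to adjoints, which lets the cokernel of
  \<open>q * p\<close> be treated as the kernel of \<open>p * q\<close>.\<close>

lemma linked_star:
  assumes "is_projection p1" "is_projection q1" "linked p1 q1 Y"
  shows "linked q1 p1 (star Y)"
proof -
  have "star (p1 * Y) = star Y" "star (Y * q1) = star Y" "star (Y * p1) = star p1" "star (q1 * Y) = star q1"
    using assms(3) by (simp_all only: linked_def)
  then show ?thesis
    using assms(1,2) by (simp add: linked_def is_projection_def)
qed

context vn_ideal
begin

interpretation G: comm_group "K0 J" by (rule K0_group)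

abbreviation D where "D \<equiv> K0_class J"

lemmas D_carrier = K0_class_carrier[OF unitize_star_subring]

lemma projection_sub:
  assumes p: "is_projection p" and p1: "is_projection p1" and le: "p * p1 = p1"
  shows "is_projection (p - p1)" "p1 * p = (p1 :: 'a bop)"
proof -
  have "star (p * p1) = star p1"
    by (simp only: le)
  then show *: "p1 * p = p1"
    using p p1 by (simp add: is_projection_def)
  then show "is_projection (p - p1)"
    using p p1 le by (simp add: is_projection_def algebra_simps)
qed

lemma D_add:
  assumes e: "is_projection e" "e \<in> J" and f: "is_projection f" "f \<in> J" and orth: "e * f = 0"
  shows "D (e + f) = D e \<otimes>\<^bsub>K0 J\<^esub> D f"
proof -
  have "f * e = star (e * f)"
    using e f by (simp add: is_projection_def)
  then have "f * e = 0"
    unfolding orth by simp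
  then show ?thesis
    using e f orth by (intro K0_class_add[OF unitize_star_subring] J_add projection_add)
qed

text \<open>From \<open>v = v * P\<close> the partial isometry lies in \<open>J\<close> as soon as
  \<open>P\<close> does, and so it implements the equivalence over the unitization.\<close>

lemma D_partial_isometry:
  assumes v: "v \<in> N" and P: "star v * v = P" "is_projection P" "P \<in> J"
    and Q: "v * star v = Q" "is_projection Q"
  shows "Q \<in> J" "D P = D Q"
proof -
  have "v * P = v"
  proof (rule bop_eqI)
    fix x
    have "(norm (v \<cdot> (x - P \<cdot> x)))\<^sup>2 = inner (x - P \<cdot> x) (P \<cdot> (x - P \<cdot> x))"
      unfolding norm_star_mult P(1) ..
    then have "v \<cdot> (x - P \<cdot> x) = 0"
      by (simp add: projection_apply[OF P(2)])
    then show "(v * P) \<cdot> x = v \<cdot> x"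
      by simp
  qed
  then have vJ: "v \<in> J"
    using J_mult_left[OF P(3) v] by simp
  then show "Q \<in> J"
    unfolding Q(1)[symmetric] using v by (intro J_mult_right N_star)
  then show "D P = D Q"
    using vJ P Q K0_class_mvn[OF unitize_star_subring, of v] by simp
qed

text \<open>Polar decomposition turns a bijection between the ranges into a partial isometry.\<close>

lemma D_subspace_iso:
  assumes P: "is_projection P" "P \<in> J" and Q: "is_projection Q" "Q \<in> N" and A: "A \<in> N"
    and PQ: "\<And>x. P \<cdot> x = x \<Longrightarrow> Q \<cdot> A \<cdot> x = A \<cdot> x" "\<And>x. P \<cdot> x = x \<Longrightarrow> A' \<cdot> A \<cdot> x = x"
    and QP: "\<And>y. Q \<cdot> y = y \<Longrightarrow> P \<cdot> A' \<cdot> y = A' \<cdot> y" "\<And>y. Q \<cdot> y = y \<Longrightarrow> A \<cdot> A' \<cdot> y = y"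
  shows "Q \<in> J" "D P = D Q"
proof -
  define B where "B = A * P"
  have BN: "B \<in> N" "star B \<in> N"
    using A J_sub[OF P(2)] by (auto simp: B_def intro!: N_mult N_star)
  obtain v where v: "v \<in> N" "star v * v = 1 - null_proj B" "v * star v = 1 - null_proj (star B)"
    by (rule polar_decomposition[OF comm BN]) (rule that)
  have "B \<cdot> x = 0 \<longleftrightarrow> P \<cdot> x = 0" for x
    using PQ(2)[of "P \<cdot> x"] projection_apply[OF P(1), of x] by (auto simp: B_def)
  then have "null_proj B = 1 - P"
    by (rule null_proj_eqI[OF P(1)])
  then have vP: "star v * v = P"
    by (simp add: v)
  have "star B \<cdot> y = 0 \<longleftrightarrow> Q \<cdot> y = 0" for y
  proof
    assume *: "star B \<cdot> y = 0"
    have Qy: "Q \<cdot> Q \<cdot> y = Q \<cdot> y"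
      by (rule projection_apply[OF Q(1)])
    have "B \<cdot> A' \<cdot> Q \<cdot> y = Q \<cdot> y"
      using QP[OF Qy] by (simp add: B_def)
    then have "inner (Q \<cdot> y) y = inner (B \<cdot> A' \<cdot> Q \<cdot> y) y"
      by (simp only:)
    also have "\<dots> = inner (A' \<cdot> Q \<cdot> y) (star B \<cdot> y)"
      by (rule inner_star)
    finally have "inner y (Q \<cdot> y) = 0"
      using * by (simp add: inner_commute)
    then show "Q \<cdot> y = 0"
      by (simp add: projection_norm_sq[OF Q(1)])
  next
    assume *: "Q \<cdot> y = 0"
    have "inner u (star B \<cdot> y) = inner u 0" for u
    proof -
      have "inner u (star B \<cdot> y) = inner (B \<cdot> u) y"
        by (rule inner_star[symmetric])
      also have "B \<cdot> u = Q \<cdot> B \<cdot> u"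
        using PQ(1)[of "P \<cdot> u"] projection_apply[OF P(1), of u] by (simp add: B_def)
      also have "inner (Q \<cdot> B \<cdot> u) y = inner (B \<cdot> u) (Q \<cdot> y)"
        by (rule projection_inner[OF Q(1)])
      finally show ?thesis
        using * by simp
    qed
    then show "star B \<cdot> y = 0"
      by (rule inner_eq_rightI)
  qed
  then have "null_proj (star B) = 1 - Q"
    by (rule null_proj_eqI[OF Q(1)])
  then have vQ: "v * star v = Q"
    by (simp add: v)
  show "Q \<in> J" "D P = D Q"
    using D_partial_isometry[OF v(1) vP P vQ Q(1)] by auto
qed

definition defect :: "'a bop \<Rightarrow> 'a bop \<Rightarrow> 'a bop \<Rightarrow> 'a bop \<Rightarrow> 'a bop \<Rightarrow> 'a bop" where
  "defect p q p1 q1 Y = (q - q1) * ((1 - Y) * (p - p1))"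

text \<open>The defect is a Schur complement of \<open>q p\<close> with respect to the invertible block \<open>q\<^sub>1 p\<^sub>1\<close>, so both
  have isomorphic kernels.\<close>

lemma kernel_iso:
  assumes p: "is_projection p" "p \<in> N" and q: "is_projection q" "q \<in> N"
    and p1: "is_projection p1" "p1 \<in> N" "p * p1 = p1" and q1: "is_projection q1" "q1 \<in> N" "q * q1 = q1"
    and Y: "linked p1 q1 Y" "Y \<in> N" and a: "p - p1 \<in> J"
  defines "k0 \<equiv> null_proj (defect p q p1 q1 Y) \<sqinter>\<^sub>p (p - p1)"
  shows "k0 \<in> J" "(1 - q) \<sqinter>\<^sub>p p \<in> J" "D k0 = D ((1 - q) \<sqinter>\<^sub>p p)"
proof -
  let ?T = "defect p q p1 q1 Y" and ?k = "(1 - q) \<sqinter>\<^sub>p p"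
  have pa: "is_projection (p - p1)" and p1p: "p1 * p = p1"
    using projection_sub[OF p(1) p1(1,3)] by auto
  have q1q: "q1 * q = q1"
    using projection_sub[OF q(1) q1(1,3)] by auto
  have TN: "?T \<in> N"
    unfolding defect_def using p q p1 q1 Y by (intro N_mult N_diff N_one)
  have k0: "is_projection k0"
    unfolding k0_def by (intro proj_meet_projection null_proj_projection pa)
  have k0_iff: "k0 \<cdot> x = x \<longleftrightarrow> ?T \<cdot> x = 0 \<and> p \<cdot> x - p1 \<cdot> x = x" for x
    unfolding k0_def proj_meet_fixed_iff[OF null_proj_projection pa] null_proj_fixed_iff by simp
  have k0N: "k0 \<in> N"
    unfolding k0_def using TN
    by (intro proj_meet_commutant[OF null_proj_projection pa comm _ J_sub[OF a]] null_proj_commutant[OF comm] N_star)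
  have "(p - p1) * k0 = k0"
  proof (rule bop_eqI)
    fix x
    show "((p - p1) * k0) \<cdot> x = k0 \<cdot> x"
      using k0_iff[of "k0 \<cdot> x"] projection_apply[OF k0, of x] by simp
  qed
  then show k0J: "k0 \<in> J"
    using J_mult_right[OF a k0N] by simp
  have k_iff: "?k \<cdot> x = x \<longleftrightarrow> q \<cdot> x = 0 \<and> p \<cdot> x = x" for x
    unfolding proj_meet_fixed_iff[OF projection_compl[OF q(1)] p(1)] by simp
  have k: "is_projection ?k" "?k \<in> N"
    using p q by (auto intro!: proj_meet_projection projection_compl proj_meet_commutant[OF _ _ comm] N_diff N_one)
  have l: "p1 \<cdot> Y \<cdot> x = Y \<cdot> x" "Y \<cdot> q1 \<cdot> x = Y \<cdot> x" "Y \<cdot> p1 \<cdot> x = p1 \<cdot> x" "q1 \<cdot> Y \<cdot> x = q1 \<cdot> x" for x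
    using Y(1) by (simp_all add: linked_def flip: bop_apply_simps(7))
  have pp: "p \<cdot> p1 \<cdot> x = p1 \<cdot> x" "p1 \<cdot> p \<cdot> x = p1 \<cdot> x" "q \<cdot> q1 \<cdot> x = q1 \<cdot> x" "q1 \<cdot> q \<cdot> x = q1 \<cdot> x"
    "p \<cdot> p \<cdot> x = p \<cdot> x" "p1 \<cdot> p1 \<cdot> x = p1 \<cdot> x" for x
    using bop_mult_eq[OF p1(3)] bop_mult_eq[OF p1p] bop_mult_eq[OF q1(3)] bop_mult_eq[OF q1q]
      projection_apply[OF p(1)] projection_apply[OF p1(1)] by auto
  have pY: "p \<cdot> Y \<cdot> x = Y \<cdot> x" for x
    using pp(1)[of "Y \<cdot> x"] by (simp add: l)
  \<comment> \<open>The isomorphism from the kernel of the defect is \<open>1 - Y\<close>, with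
    inverse \<open>p - p1\<close>; this fact and the next check the two directions.\<close>
  have 1: "?k \<cdot> (1 - Y) \<cdot> x = (1 - Y) \<cdot> x" "(p - p1) \<cdot> (1 - Y) \<cdot> x = x" if kx: "k0 \<cdot> x = x" for x
  proof -
    have ax: "(p - p1) \<cdot> x = x" and Tx: "?T \<cdot> x = 0"
      using kx k0_iff by auto
    have "p \<cdot> (p - p1) \<cdot> x = (p - p1) \<cdot> x"
      by (simp add: pp)
    then have px: "p \<cdot> x = x"
      unfolding ax .
    have p1x: "p1 \<cdot> x = 0"
      using ax px by simp
    have "?T \<cdot> x = (q - q1) \<cdot> (1 - Y) \<cdot> (p - p1) \<cdot> x"
      by (simp only: defect_def bop_apply_simps(7))
    then have "(q - q1) \<cdot> (1 - Y) \<cdot> x = 0"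
      unfolding ax Tx ..
    moreover have "q1 \<cdot> (1 - Y) \<cdot> x = 0"
      by (simp add: l)
    ultimately have "q \<cdot> (1 - Y) \<cdot> x = 0"
      by (simp only: bop_apply_simps(4) diff_zero)
    moreover have "p \<cdot> (1 - Y) \<cdot> x = (1 - Y) \<cdot> x"
      by (simp add: px pY)
    ultimately show "?k \<cdot> (1 - Y) \<cdot> x = (1 - Y) \<cdot> x"
      using k_iff by blast
    show "(p - p1) \<cdot> (1 - Y) \<cdot> x = x"
      by (simp add: px p1x pY l)
  qed
  \<comment> \<open>Block elimination: \<open>q1 \<cdot> x = 0\<close> forces
    \<open>Y \<cdot> x = 0\<close>, so the component of \<open>x\<close> in \<open>p1\<close> is
    minus the image under \<open>Y\<close> of its component in \<open>p - p1\<close>, and the latter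
    determines \<open>x\<close>.\<close>
  have 2: "k0 \<cdot> (p - p1) \<cdot> x = (p - p1) \<cdot> x" "(1 - Y) \<cdot> (p - p1) \<cdot> x = x" if kx: "?k \<cdot> x = x" for x
  proof -
    have qx: "q \<cdot> x = 0" and px: "p \<cdot> x = x"
      using kx k_iff by auto
    have q1x: "q1 \<cdot> x = 0"
      using pp(4)[of x] qx by simp
    have Yx: "Y \<cdot> x = 0"
      using l(2)[of x] q1x by simp
    have *: "(1 - Y) \<cdot> (p - p1) \<cdot> x = x"
      by (simp add: px Yx l)
    then show "(1 - Y) \<cdot> (p - p1) \<cdot> x = x" .
    have aa: "(p - p1) \<cdot> (p - p1) \<cdot> x = (p - p1) \<cdot> x"
      by (rule projection_apply[OF pa])
    have "?T \<cdot> (p - p1) \<cdot> x = (q - q1) \<cdot> (1 - Y) \<cdot> (p - p1) \<cdot> (p - p1) \<cdot> x"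
      by (simp only: defect_def bop_apply_simps(7))
    also have "\<dots> = (q - q1) \<cdot> x"
      unfolding aa * ..
    also have "\<dots> = 0"
      by (simp add: qx q1x)
    finally have "?T \<cdot> (p - p1) \<cdot> x = 0" .
    then show "k0 \<cdot> (p - p1) \<cdot> x = (p - p1) \<cdot> x"
      unfolding k0_iff using aa by (simp only: bop_apply_simps(4))
  qed
  show "?k \<in> J" "D k0 = D ?k"
    using D_subspace_iso[OF k0 k0J k N_diff[OF N_one Y(2)], of "p - p1"] 1 2 by blast+
qed

text \<open>\<open>T\<close> is supported on \<open>a\<close>, so the support projection of
  \<open>T\<close> is what remains of \<open>a\<close> once the kernel part is removed, and the
  class of \<open>a\<close> splits accordingly.\<close>

lemma defect_classes:
  assumes a: "is_projection a" "a \<in> J" and T: "T \<in> N" "T * a = T"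
  shows "is_projection (a - null_proj T \<sqinter>\<^sub>p a)" "1 - null_proj T = a - null_proj T \<sqinter>\<^sub>p a"
    "null_proj T \<sqinter>\<^sub>p a \<in> J" "D a = D (null_proj T \<sqinter>\<^sub>p a) \<otimes>\<^bsub>K0 J\<^esub> D (a - null_proj T \<sqinter>\<^sub>p a)"
proof -
  let ?k = "null_proj T \<sqinter>\<^sub>p a"
  have k: "is_projection ?k"
    by (intro proj_meet_projection null_proj_projection a)
  have k_iff: "?k \<cdot> x = x \<longleftrightarrow> T \<cdot> x = 0 \<and> a \<cdot> x = x" for x
    unfolding proj_meet_fixed_iff[OF null_proj_projection a(1)] null_proj_fixed_iff ..
  have kN: "?k \<in> N"
    using T by (intro proj_meet_commutant[OF null_proj_projection a(1) comm _ J_sub[OF a(2)]]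
        null_proj_commutant[OF comm] N_star)
  have ak: "a * ?k = ?k"
  proof (rule bop_eqI)
    fix x
    show "(a * ?k) \<cdot> x = ?k \<cdot> x"
      using k_iff[of "?k \<cdot> x"] projection_apply[OF k, of x] by simp
  qed
  show sub: "is_projection (a - ?k)"
    by (rule projection_sub[OF a(1) k ak])
  have ka: "?k * a = ?k"
    by (rule projection_sub[OF a(1) k ak])
  show kJ: "?k \<in> J"
    using J_mult_right[OF a(2) kN] by (simp add: ak)
  have ker: "(a - ?k) \<cdot> x = 0 \<longleftrightarrow> T \<cdot> x = 0" for x
  proof -
    have "?k \<cdot> a \<cdot> x = ?k \<cdot> x" "T \<cdot> a \<cdot> x = T \<cdot> x"
      using bop_mult_eq[OF ka] bop_mult_eq[OF T(2)] by auto
    then have "(a - ?k) \<cdot> x = 0 \<longleftrightarrow> a \<cdot> x = ?k \<cdot> a \<cdot> x"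
      by simp
    also have "\<dots> \<longleftrightarrow> ?k \<cdot> a \<cdot> x = a \<cdot> x"
      by (rule eq_commute)
    also have "\<dots> \<longleftrightarrow> T \<cdot> x = 0"
      unfolding k_iff using \<open>T \<cdot> a \<cdot> x = T \<cdot> x\<close> projection_apply[OF a(1)] by simp
    finally show ?thesis .
  qed
  have "null_proj T = 1 - (a - ?k)"
    by (rule null_proj_eqI[OF sub ker[symmetric]])
  then have "1 - null_proj T = 1 - (1 - (a - ?k))"
    by (rule arg_cong)
  also have "\<dots> = a - ?k"
    by (rule diff_diff_eq2[THEN trans]) simp
  finally show "1 - null_proj T = a - ?k" .
  have "D (?k + (a - ?k)) = D ?k \<otimes>\<^bsub>K0 J\<^esub> D (a - ?k)"
  proof (rule D_add[OF k kJ sub])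
    show "a - ?k \<in> J"
      by (rule J_diff[OF a(2) kJ])
    show "?k * (a - ?k) = 0"
      using k by (simp add: right_diff_distrib ka is_projection_def)
  qed
  then show "D a = D ?k \<otimes>\<^bsub>K0 J\<^esub> D (a - ?k)"
    by simp
qed

end

context vn_ideal
begin

interpretation G: comm_group "K0 J" by (rule K0_group)

text \<open>The same expression is a factor of \<open>sf\<close> and the value of \<open>Ind\<close>
  at \<open>q * p\<close>, so one additivity statement serves both halves of the theorem.\<close>

definition pair_index :: "'a bop \<Rightarrow> 'a bop \<Rightarrow> ('a bop unitization mat \<times> 'a bop unitization mat) set" where
  "pair_index q p = K0_diff J ((1 - q) \<sqinter>\<^sub>p p) ((1 - p) \<sqinter>\<^sub>p q)"

lemma null_proj_meet:
  assumes "is_projection p" "is_projection q"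
  shows "null_proj (q * p) \<sqinter>\<^sub>p p = (1 - q) \<sqinter>\<^sub>p p"
  unfolding proj_meet_def null_proj_range projection_range[OF assms(1)]
    projection_range[OF projection_compl[OF assms(2)]]
  by (rule arg_cong[where f = proj_onto]) auto

lemma Ind_eq_pair_index:
  assumes p: "is_projection p" and q: "is_projection q" and "fredholm N J q p (q * p)"
  shows "Ind N J q p (q * p) = pair_index q p"
proof -
  have "star (q * p) = p * q"
    using p q by (simp add: is_projection_def)
  then show ?thesis
    using assms by (simp add: Ind_def pair_index_def null_proj_meet)
qed

text \<open>\<open>Y\<close> doubles as a parametrix for \<open>q * p\<close>. The adjoint of the
  defect is the defect of the exchanged pair, so \<open>kernel_iso\<close> treats kernel and
  cokernel alike. What remains of \<open>p - p1\<close> and \<open>q - q1\<close> are the supports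
  of \<open>T\<close> and \<open>star T\<close>, equivalent by polar decomposition, and they
  cancel.\<close>

lemma index_formula:
  assumes p: "is_projection p" "p \<in> N" and q: "is_projection q" "q \<in> N"
    and p1: "is_projection p1" "p1 \<in> N" "p * p1 = p1" and q1: "is_projection q1" "q1 \<in> N" "q * q1 = q1"
    and Y: "linked p1 q1 Y" "Y \<in> N" and a: "p - p1 \<in> J" and b: "q - q1 \<in> J"
  shows "fredholm N J q p (q * p)"
    and "pair_index q p = D (p - p1) \<otimes>\<^bsub>K0 J\<^esub> inv\<^bsub>K0 J\<^esub> D (q - q1)"
proof -
  have pa: "is_projection (p - p1)" and p1p: "p1 * p = p1"
    using projection_sub[OF p(1) p1(1,3)] by auto
  have qb: "is_projection (q - q1)" and q1q: "q1 * q = q1"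
    using projection_sub[OF q(1) q1(1,3)] by auto
  have Yl: "p1 * Y = Y" "Y * q1 = Y" "Y * p1 = p1" "q1 * Y = q1"
    using Y(1) by (simp_all add: linked_def)
  have pY: "p * Y = Y"
    using mult_eq_assoc[OF p1(3), of Y] by (simp add: Yl)
  have "Y * q1 * q = Y * q1"
    by (simp add: mult.assoc q1q)
  then have Yq: "Y * q = Y"
    by (simp add: Yl)
  have sY: "linked q1 p1 (star Y)" "star Y \<in> N"
    using linked_star[OF p1(1) q1(1) Y(1)] N_star[OF Y(2)] by auto
  show "fredholm N J q p (q * p)"
    unfolding fredholm_def
  proof (intro conjI bexI)
    show "q * p \<in> corner N q p"
      unfolding corner_def using N_one by (auto intro!: exI[of _ 1])
    show "Y \<in> corner N p q"
      unfolding corner_def using Y(2) by (auto intro!: exI[of _ Y] simp: pY Yq)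
    have "Y * (q * p) - p = (Y - 1) * (p - p1)"
      unfolding mult.assoc[symmetric] Yq by (simp add: algebra_simps Yl)
    then show "quot_map N J (Y * (q * p)) = quot_map N J p"
      using a Y(2) by (intro quot_map_eqI) (auto intro!: J_mult_left N_diff N_one)
    have "q * p * Y - q = (q - q1) * (Y - 1)"
      unfolding mult.assoc pY by (simp add: algebra_simps Yl)
    then show "quot_map N J (q * p * Y) = quot_map N J q"
      using b Y(2) by (intro quot_map_eqI) (auto intro!: J_mult_right N_diff N_one)
  qed
  define T where "T = defect p q p1 q1 Y"
  have TN: "T \<in> N" "star T \<in> N"
    unfolding T_def defect_def using p q p1 q1 Y by (auto intro!: N_mult N_diff N_one N_star)
  have sT: "star T = defect q p q1 p1 (star Y)"
    using pa qb by (simp add: T_def defect_def is_projection_def mult.assoc)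
  have Ta: "T * (p - p1) = T"
    using pa by (simp add: T_def defect_def is_projection_def mult.assoc)
  have Tb: "star T * (q - q1) = star T"
    unfolding sT using qb by (simp add: defect_def is_projection_def mult.assoc)
  let ?k = "(1 - q) \<sqinter>\<^sub>p p" and ?c = "(1 - p) \<sqinter>\<^sub>p q"
  let ?k0 = "null_proj T \<sqinter>\<^sub>p (p - p1)" and ?c0 = "null_proj (star T) \<sqinter>\<^sub>p (q - q1)"
  note K = kernel_iso[OF p q p1 q1 Y a, folded T_def]
  note C = kernel_iso[OF q p q1 p1 sY b, folded sT]
  note A = defect_classes[OF pa a TN(1) Ta]
  note B = defect_classes[OF qb b TN(2) Tb]
  obtain v where v: "v \<in> N" "star v * v = 1 - null_proj T" "v * star v = 1 - null_proj (star T)"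
    by (rule polar_decomposition[OF comm TN]) (rule that)
  have W: "D (p - p1 - ?k0) = D (q - q1 - ?c0)"
    by (rule D_partial_isometry(2)[OF v(1) v(2)[unfolded A(2)] A(1) J_diff[OF a A(3)] v(3)[unfolded B(2)] B(1)])
  have carr: "D ?k0 \<in> carrier (K0 J)" "D ?c0 \<in> carrier (K0 J)" "D (p - p1 - ?k0) \<in> carrier (K0 J)"
    "D (p - p1) \<in> carrier (K0 J)" "D (q - q1) \<in> carrier (K0 J)"
    by (intro D_carrier A B J_diff a b pa qb proj_meet_projection null_proj_projection)+
  have "D ?k0 \<otimes>\<^bsub>K0 J\<^esub> D (q - q1) = D ?c0 \<otimes>\<^bsub>K0 J\<^esub> D (p - p1)"
    unfolding A(4) B(4) W[symmetric] using carr by (simp add: G.m_ac)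
  then have "D ?k0 \<otimes>\<^bsub>K0 J\<^esub> inv\<^bsub>K0 J\<^esub> D ?c0 = D (p - p1) \<otimes>\<^bsub>K0 J\<^esub> inv\<^bsub>K0 J\<^esub> D (q - q1)"
    using carr by (intro G.div_eq_div)
  then show "pair_index q p = D (p - p1) \<otimes>\<^bsub>K0 J\<^esub> inv\<^bsub>K0 J\<^esub> D (q - q1)"
    by (simp add: pair_index_def K0_diff_def K(3) C(3))
qed

text \<open>The inverse of \<open>1 - (p1 - X)\<close> acts as the identity off the corner of
  \<open>p1\<close> and inverts \<open>X\<close> on it; hence it commutes with
  \<open>p1\<close>.\<close>

lemma neumann_corner:
  assumes p1: "is_projection p1" "p1 \<in> N" and X: "X \<in> N" "p1 * X = X" "X * p1 = X" and less: "norm (p1 - X) < 1"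
  obtains R where "R \<in> N" "R * p1 = p1 * R" "R * X = p1" "X * R = p1"
proof -
  have "p1 - X \<in> N"
    using p1 X by (intro N_diff)
  then obtain R where R: "R \<in> N" "R * (1 - (p1 - X)) = 1" "(1 - (p1 - X)) * R = 1"
    by (rule neumann_inverse[OF comm _ less]) (rule that)
  have pp: "p1 * p1 = p1"
    using p1 by (simp add: is_projection_def)
  have "(1 - (p1 - X)) * p1 = X" "p1 * (1 - (p1 - X)) = X"
    by (simp_all add: algebra_simps pp X)
  then have RX: "R * X = p1" and XR: "X * R = p1"
    using mult_eq_assoc[OF R(2), of p1] R(3)[THEN arg_cong[where f = "\<lambda>S. p1 * S"]]
    by (simp_all flip: mult.assoc)
  have "R * p1 = R * (X * R)"
    by (simp add: XR)
  also have "\<dots> = p1 * R"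
    by (rule mult_eq_assoc[OF RX])
  finally show ?thesis
    using that R(1) RX XR by blast
qed

text \<open>\<open>X = p1 * (q * p1)\<close> is close to \<open>p1\<close>, hence invertible in the
  corner by some \<open>R\<close>. Then \<open>Y = R * (p1 * q)\<close> is a left inverse of
  \<open>q * p1\<close>, and \<open>q1 = q * Y\<close> projects onto the image of the range of
  \<open>p1\<close> under \<open>q\<close>, which is thereby closed.\<close>

lemma link_exists:
  assumes p1: "is_projection p1" "p1 \<in> N" and q: "is_projection q" "q \<in> N" and less: "norm ((1 - q) * p1) < 1"
  obtains q1 Y where "is_projection q1" "q1 \<in> N" "q * q1 = q1" "q1 * p1 = q * p1" "linked p1 q1 Y" "Y \<in> N"
proof -
  have pp: "p1 * p1 = p1" "star p1 = p1" and qq: "q * q = q" "star q = q"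
    using p1 q by (simp_all add: is_projection_def)
  define X where "X = p1 * (q * p1)"
  have X: "X \<in> N" "p1 * X = X" "X * p1 = X" "star X = X"
    using p1 q by (auto simp: X_def mult.assoc pp qq mult_eq_assoc[OF pp(1)] intro!: N_mult)
  have "norm (p1 - X) = norm (p1 * ((1 - q) * p1))"
    by (simp add: X_def algebra_simps pp)
  also have "\<dots> \<le> norm p1 * norm ((1 - q) * p1)"
    by (rule norm_mult_ineq)
  also have "\<dots> \<le> 1 * norm ((1 - q) * p1)"
    by (intro mult_right_mono norm_projection p1) simp
  finally have "norm (p1 - X) < 1"
    using less by simp
  then obtain R where R: "R \<in> N" "R * p1 = p1 * R" "R * X = p1" "X * R = p1"
    by (rule neumann_corner[OF p1 X(1-3)]) (rule that)
  define Y where "Y = R * (p1 * q)"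
  define q1 where "q1 = q * Y"
  have Yp: "Y * p1 = p1"
    using R(3) by (simp add: Y_def X_def mult.assoc)
  have pY: "p1 * Y = Y"
    unfolding Y_def mult.assoc[symmetric] R(2)[symmetric] by (simp add: mult.assoc pp mult_eq_assoc[OF pp(1)])
  have Yq: "Y * q = Y"
    by (simp add: Y_def mult.assoc qq)
  have YY: "Y * Y = Y"
    using mult_eq_assoc[OF Yp, of Y] by (simp add: pY)
  have Yqs: "Y * q1 = Y"
    using mult_eq_assoc[OF Yq, of Y] by (simp add: q1_def YY)
  have q1Y: "q1 * Y = q1"
    by (simp add: q1_def mult.assoc YY)
  have "q1 * q1 = q1"
    by (simp add: q1_def mult.assoc mult_eq_assoc[OF Yq] YY)
  moreover have "star q1 = q1"
  proof -
    \<comment> \<open>What is known of \<open>R\<close> concerns the corner, so self-adjointness is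
      derived only after multiplication by \<open>p1\<close>, from that of \<open>X\<close>.\<close>
    have "star R * p1 = star R * (X * R)"
      by (simp add: R)
    also have "\<dots> = star (X * R) * R"
      by (simp add: X mult.assoc)
    also have "\<dots> = p1 * R"
      by (simp add: R pp)
    finally have 1: "star R * p1 = p1 * R" .
    have "p1 * star R = star R * p1"
      using R(2)[THEN arg_cong[where f = star]] by (simp only: star_simps pp)
    then have "p1 * star R = R * p1"
      by (simp only: 1 R(2))
    moreover have "star q1 = q * (p1 * star R) * q"
      by (simp add: q1_def Y_def mult.assoc pp qq)
    ultimately show ?thesis
      by (simp add: q1_def Y_def mult.assoc)
  qed
  ultimately have "is_projection q1"
    by (simp add: is_projection_def)
  moreover have "q1 \<in> N" "Y \<in> N"
    using R(1) p1 q by (auto simp: q1_def Y_def intro!: N_mult)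
  moreover have "q * q1 = q1" "q1 * p1 = q * p1"
    by (simp_all add: q1_def mult_eq_assoc[OF qq(1)] mult.assoc Yp)
  moreover have "linked p1 q1 Y"
    using pY Yqs Yp q1Y by (simp add: linked_def)
  ultimately show ?thesis
    using that by blast
qed

text \<open>Both projections factor through \<open>p1\<close>, as \<open>q1 * (p1 * Y)\<close> and
  \<open>star Z * (p1 * r1)\<close>. Inverting \<open>r1 * q1\<close> thus reduces to inverting
  \<open>p1 * (r * (q * p1))\<close>, which is near \<open>p1\<close>; \<open>W\<close> is that
  inverse carried back.\<close>

lemma link_compose:
  assumes p1: "is_projection p1" "p1 \<in> N" and q: "is_projection q" "q \<in> N" and r: "is_projection r" "r \<in> N"
    and q1: "is_projection q1" "q1 \<in> N" "q1 * p1 = q * p1" "linked p1 q1 Y"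
    and r1: "is_projection r1" "r1 \<in> N" "r1 * p1 = r * p1" "linked p1 r1 Z"
    and less: "norm (p1 - p1 * (r * (q * p1))) < 1"
  obtains W where "linked q1 r1 W" "W \<in> N"
proof -
  have pp: "p1 * p1 = p1" "star p1 = p1"
    using p1 by (simp_all add: is_projection_def)
  have "star (r1 * p1) = star (r * p1)"
    by (simp only: r1)
  then have pr: "p1 * r1 = p1 * r"
    using r1(1) r(1) by (simp add: is_projection_def pp)
  define X where "X = p1 * (r * (q * p1))"
  have X: "X \<in> N" "p1 * X = X" "X * p1 = X"
    using p1 q r by (auto simp: X_def mult.assoc pp mult_eq_assoc[OF pp(1)] intro!: N_mult)
  have X1: "p1 * (r1 * (q1 * p1)) = X"
    by (simp add: X_def q1(3) mult_eq_assoc[OF pr] mult.assoc)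
  obtain R where R: "R \<in> N" "R * p1 = p1 * R" "R * X = p1" "X * R = p1"
    by (rule neumann_corner[OF p1 X less[folded X_def]]) (rule that)
  have Y: "p1 * Y = Y" "q1 * Y = q1" and Z: "p1 * Z = Z" "r1 * Z = r1"
    using q1(4) r1(4) by (simp_all add: linked_def)
  have q1Y: "q1 * (p1 * Y) = q1"
    by (simp add: Y)
  have "star (r1 * (p1 * Z)) = star r1"
    by (simp add: Z)
  then have r1Z: "star Z * (p1 * r1) = r1"
    using r1(1) by (simp add: is_projection_def pp mult.assoc)
  have qq1: "q1 * q1 = q1" "r1 * r1 = r1"
    using q1(1) r1(1) by (simp_all add: is_projection_def)
  define W where "W = q1 * (R * (p1 * r1))"
  have "W * q1 = q1"
  proof -
    have "W * q1 = q1 * (R * (p1 * (r1 * q1)))"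
      by (simp add: W_def mult.assoc)
    also have "\<dots> = q1 * (R * (p1 * (r1 * (q1 * (p1 * Y)))))"
      by (simp add: q1Y)
    also have "\<dots> = q1 * (R * (p1 * (r1 * (q1 * p1)) * Y))"
      by (simp add: mult.assoc)
    also have "\<dots> = q1 * (R * X * Y)"
      by (simp only: X1 mult.assoc)
    also have "\<dots> = q1"
      by (simp add: R q1Y)
    finally show ?thesis .
  qed
  moreover have "r1 * W = r1"
  proof -
    have "r1 * W = r1 * (q1 * (p1 * (R * r1)))"
      by (simp add: W_def mult_eq_assoc[OF R(2)] mult.assoc)
    also have "\<dots> = star Z * (p1 * r1) * (q1 * (p1 * (R * r1)))"
      by (simp only: r1Z)
    also have "\<dots> = star Z * (p1 * (r1 * (q1 * p1)) * (R * r1))"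
      by (simp add: mult.assoc)
    also have "\<dots> = star Z * (X * R * r1)"
      by (simp only: X1 mult.assoc)
    also have "\<dots> = r1"
      by (simp add: R r1Z)
    finally show ?thesis .
  qed
  moreover have "q1 * W = W" "W * r1 = W"
    by (simp_all add: W_def mult.assoc qq1 mult_eq_assoc[OF qq1(1)])
  moreover have "W \<in> N"
    using q1 r1 p1 R by (auto simp: W_def intro!: N_mult)
  ultimately show ?thesis
    using that by (simp add: linked_def)
qed

text \<open>\<open>q - q1\<close> annihilates \<open>p1\<close> because
  \<open>q1 * p1 = q * p1\<close>, hence it annihilates \<open>p\<close> modulo \<open>J\<close>.
  Since \<open>p\<close> is near \<open>q\<close> modulo \<open>J\<close>, it is also an element of
  \<open>J\<close> times an inverse.\<close>

lemma complement_in_ideal: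
  assumes p: "p \<in> N" and q: "is_projection q" "q \<in> N" and q1: "is_projection q1" "q1 \<in> N" "q * q1 = q1"
    and p1: "p1 \<in> N" "q1 * p1 = q * p1" "p - p1 \<in> J" and j: "j \<in> J" "norm (p - q + j) < 1"
  shows "q - q1 \<in> J"
proof (rule J_inverse_cancel)
  let ?s = "q - q1"
  have "q * q = q" "q1 * q = q1"
    using q projection_sub[OF q(1) q1(1,3)] by (simp_all add: is_projection_def)
  then have "?s * (1 - - (p - q + j)) = ?s * (p - p1) + ?s * j"
    by (simp add: algebra_simps p1(2))
  moreover have "?s \<in> N"
    using q q1 by (intro N_diff)
  ultimately show "?s * (1 - - (p - q + j)) \<in> J"
    using p1(3) j(1) by (auto intro!: J_add J_mult_left)
  show "- (p - q + j) \<in> N"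
    using p q(2) by (intro N_uminus N_add N_diff J_sub[OF j(1)])
  show "norm (- (p - q + j)) < 1"
    using j(2) by (simp only: norm_minus_cancel)
  show "?s \<in> N"
    using q q1 by (intro N_diff)
qed

text \<open>The sum \<open>L\<close> dominates both of its summands, so a single cut at the square
  of \<open>eps\<close> makes both corrections small on the same \<open>p1\<close>. Compressing
  \<open>L\<close> by \<open>p\<close> places the cut below \<open>p\<close>.\<close>

lemma cut_projection:
  assumes p: "is_projection p" "p \<in> N" and j: "j1 \<in> J" "j2 \<in> J" and eps: "eps > 0"
  obtains p1 where "is_projection p1" "p1 \<in> N" "p * p1 = p1" "p - p1 \<in> J"
    "norm (j1 * p1) \<le> eps" "norm (j2 * p1) \<le> eps"
proof -
  define L where "L = star j1 * j1 + star j2 * j2"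
  define K where "K = star p * L * p"
  have pp: "p * p = p" "star p = p"
    using p by (simp_all add: is_projection_def)
  have L: "positive_op L"
    unfolding L_def by (intro positive_add positive_star_mult)
  have LJ: "L \<in> J"
    unfolding L_def by (intro J_add J_mult_left j N_star[OF J_sub])
  have K: "positive_op K" "K \<in> J"
    unfolding K_def
    by (rule positive_conj[OF L], rule J_mult_right[OF J_mult_left[OF LJ N_star[OF p(2)]] p(2)])
  have pK: "p * K = K" "K * p = K"
    by (simp_all add: K_def pp mult.assoc mult_eq_assoc[OF pp(1)])
  have "eps\<^sup>2 > 0"
    using eps by simp
  then obtain e where e: "is_projection e" "e \<in> J" "p * e = e" "e * p = e"
    and low: "\<And>x. e \<cdot> x = 0 \<Longrightarrow> inner x (K \<cdot> x) \<le> eps\<^sup>2 * (norm x)\<^sup>2"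
    by (rule spectral_cut[OF K _ p(1) pK]) (rule that)
  define p1 where "p1 = p - e"
  have p1: "is_projection p1"
    unfolding p1_def by (rule projection_sub[OF p(1) e(1,3)])
  have pp1: "p * p1 = p1"
    by (simp add: p1_def right_diff_distrib pp e)
  have bound: "norm (i * p1) \<le> eps" if i: "i = j1 \<or> i = j2" for i
  proof (rule norm_bop_le)
    fix x
    let ?y = "p1 \<cdot> x"
    have "e * p1 = 0"
      using e(1) by (simp add: p1_def right_diff_distrib e(4) is_projection_def)
    then have ey: "e \<cdot> ?y = 0"
      using bop_mult_eq[of e p1 0 x] by simp
    have py: "p \<cdot> ?y = ?y"
      by (rule bop_mult_eq[OF pp1])
    have "(norm (i \<cdot> ?y))\<^sup>2 \<le> (norm (j1 \<cdot> ?y))\<^sup>2 + (norm (j2 \<cdot> ?y))\<^sup>2"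
      using i by auto
    also have "\<dots> = inner ?y (L \<cdot> ?y)"
      by (simp add: norm_star_mult L_def inner_add_right)
    also have "\<dots> = inner ?y (K \<cdot> ?y)"
      using inner_star[of p ?y "L \<cdot> ?y"] by (simp add: K_def py)
    also have "\<dots> \<le> eps\<^sup>2 * (norm ?y)\<^sup>2"
      by (rule low[OF ey])
    also have "\<dots> \<le> eps\<^sup>2 * (norm x)\<^sup>2"
      by (intro mult_left_mono power_mono projection_norm_le[OF p1]) simp_all
    also have "\<dots> = (eps * norm x)\<^sup>2"
      by (simp add: power_mult_distrib)
    finally have "norm (i \<cdot> ?y) \<le> eps * norm x"
      by (rule power2_le_imp_le) (use eps in simp)
    then show "norm ((i * p1) \<cdot> x) \<le> eps * norm x"
      by simp
  qed (use eps in simp)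
  show ?thesis
  proof (rule that[OF p1 _ pp1])
    show "p1 \<in> N"
      unfolding p1_def using p(2) J_sub[OF e(2)] by (rule N_diff)
    show "p - p1 \<in> J"
      using e(2) by (simp add: p1_def)
  qed (simp_all add: bound)
qed

lemma pair_index_additive:
  assumes p: "is_projection p" "p \<in> N" and q: "is_projection q" "q \<in> N" and r: "is_projection r" "r \<in> N"
    and pq: "quot_dist N J p q < 1/2" and rp: "quot_dist N J r p < 1/2"
  shows "fredholm N J q p (q * p)" "fredholm N J r q (r * q)" "fredholm N J r p (r * p)"
    and "pair_index q p \<in> carrier (K0 J)" "pair_index r q \<in> carrier (K0 J)" "pair_index r p \<in> carrier (K0 J)"
    and "pair_index r q \<otimes>\<^bsub>K0 J\<^esub> pair_index q p = pair_index r p"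
proof -
  obtain j1 where j1: "j1 \<in> J" "norm (p - q + j1) < 1/2"
    by (rule quot_dist_less[OF p(2) q(2) pq]) (rule that)
  obtain i where i: "i \<in> J" "norm (r - p + i) < 1/2"
    by (rule quot_dist_less[OF r(2) p(2) rp]) (rule that)
  define j2 where "j2 = - i"
  have "p - r + j2 = - (r - p + i)"
    by (simp add: j2_def)
  then have j2: "j2 \<in> J" "norm (p - r + j2) < 1/2"
    using J_uminus[OF i(1)] i(2) by (simp_all only: j2_def norm_minus_cancel)
  \<comment> \<open>Half of the remaining distance to 1/2: a correction term on \<open>p1\<close>
    may use up \<open>eps\<close> and the total still stays below 1/2.\<close>
  define eps where "eps = (1/2 - max (norm (p - q + j1)) (norm (p - r + j2))) / 2"
  have eps: "eps > 0"
    using j1 j2 by (simp add: eps_def)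
  obtain p1 where p1: "is_projection p1" "p1 \<in> N" "p * p1 = p1" "p - p1 \<in> J"
    and small: "norm (j1 * p1) \<le> eps" "norm (j2 * p1) \<le> eps"
    by (rule cut_projection[OF p j1(1) j2(1) eps]) (rule that)
  have eps2: "1/2 - 2 * eps = max (norm (p - q + j1)) (norm (p - r + j2))"
    by (simp add: eps_def field_simps)
  have near: "norm ((1 - s) * p1) < 1/2" if "norm (j * p1) \<le> eps" "norm (p - s + j) \<le> 1/2 - 2 * eps" for s j
  proof -
    have "(1 - s) * p1 = (p - s + j) * p1 - j * p1"
      by (simp add: algebra_simps p1(3))
    then have "norm ((1 - s) * p1) \<le> norm ((p - s + j) * p1) + norm (j * p1)"
      by (simp only: norm_triangle_ineq4)
    also have "norm ((p - s + j) * p1) \<le> norm (p - s + j) * norm p1"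
      by (rule norm_mult_ineq)
    also have "\<dots> \<le> norm (p - s + j) * 1"
      by (intro mult_left_mono norm_projection p1) simp
    finally show ?thesis
      using that eps by linarith
  qed
  have cq: "norm ((1 - q) * p1) < 1/2"
    by (rule near[OF small(1)]) (simp only: eps2 max.cobounded1)
  then have cq1: "norm ((1 - q) * p1) < 1"
    by linarith
  have cr: "norm ((1 - r) * p1) < 1/2"
    by (rule near[OF small(2)]) (simp only: eps2 max.cobounded2)
  then have cr1: "norm ((1 - r) * p1) < 1"
    by linarith
  obtain q1 Y where q1: "is_projection q1" "q1 \<in> N" "q * q1 = q1" and q1p: "q1 * p1 = q * p1"
    and Y: "linked p1 q1 Y" "Y \<in> N"
    by (rule link_exists[OF p1(1,2) q cq1]) (rule that)
  obtain r1 Z where r1: "is_projection r1" "r1 \<in> N" "r * r1 = r1" and r1p: "r1 * p1 = r * p1"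
    and Z: "linked p1 r1 Z" "Z \<in> N"
    by (rule link_exists[OF p1(1,2) r cr1]) (rule that)
  have qJ: "q - q1 \<in> J"
    by (rule complement_in_ideal[OF p(2) q q1 p1(2) q1p p1(4) j1(1)]) (use j1 in simp)
  have rJ: "r - r1 \<in> J"
    by (rule complement_in_ideal[OF p(2) r r1 p1(2) r1p p1(4) j2(1)]) (use j2 in simp)
  \<comment> \<open>The error splits into that of \<open>r\<close>, which enters squared as
    \<open>star ?X * ?X\<close>, and that of \<open>q\<close>; they contribute at most 1/4 and less
    than 1/2.\<close>
  have "norm (p1 - p1 * (r * (q * p1))) < 1"
  proof -
    let ?X = "(1 - r) * p1" and ?V = "(1 - q) * p1"
    have ps: "p1 * p1 = p1" "star p1 = p1" "r * r = r" "star r = r"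
      using p1 r by (simp_all add: is_projection_def)
    have "p1 - p1 * (r * (q * p1)) = star ?X * ?X + p1 * (r * ?V)"
      by (simp add: ps algebra_simps mult_eq_assoc[OF ps(3)])
    then have "norm (p1 - p1 * (r * (q * p1))) \<le> norm (star ?X * ?X) + norm (p1 * (r * ?V))"
      by (simp only: norm_triangle_ineq)
    also have "norm (star ?X * ?X) \<le> norm ?X * norm ?X"
      using norm_mult_ineq[of "star ?X" ?X] by (simp only: norm_star)
    also have "\<dots> \<le> 1/2 * (1/2)"
      using cr by (intro mult_mono) auto
    also have "norm (p1 * (r * ?V)) \<le> norm p1 * (norm r * norm ?V)"
      by (intro order_trans[OF norm_mult_ineq] mult_left_mono norm_mult_ineq) simp
    also have "\<dots> \<le> 1 * (1 * norm ?V)"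
      by (intro mult_mono norm_projection p1 r) auto
    finally show ?thesis
      using cq by simp
  qed
  then obtain W where W: "linked q1 r1 W" "W \<in> N"
    by (rule link_compose[OF p1(1,2) q r q1(1,2) q1p Y(1) r1(1,2) r1p Z(1)]) (rule that)
  note iqp = index_formula[OF p q p1(1-3) q1 Y p1(4) qJ]
  note irp = index_formula[OF p r p1(1-3) r1 Z p1(4) rJ]
  note irq = index_formula[OF q r q1 r1 W qJ rJ]
  show "fredholm N J q p (q * p)" "fredholm N J r q (r * q)" "fredholm N J r p (r * p)"
    by (rule iqp irq irp)+
  have carr: "D (p - p1) \<in> carrier (K0 J)" "D (q - q1) \<in> carrier (K0 J)" "D (r - r1) \<in> carrier (K0 J)"
    using projection_sub(1)[OF p(1) p1(1,3)] projection_sub(1)[OF q(1) q1(1,3)] projection_sub(1)[OF r(1) r1(1,3)]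
      p1(4) qJ rJ by (auto intro: D_carrier)
  then show "pair_index q p \<in> carrier (K0 J)" "pair_index r q \<in> carrier (K0 J)" "pair_index r p \<in> carrier (K0 J)"
    by (simp_all add: iqp irq irp)
  have "pair_index r q \<otimes>\<^bsub>K0 J\<^esub> pair_index q p
      = (D (p - p1) \<otimes>\<^bsub>K0 J\<^esub> inv\<^bsub>K0 J\<^esub> D (r - r1)) \<otimes>\<^bsub>K0 J\<^esub> (D (q - q1) \<otimes>\<^bsub>K0 J\<^esub> inv\<^bsub>K0 J\<^esub> D (q - q1))"
    unfolding iqp(2) irq(2) using carr by (simp only: G.m_ac G.inv_closed G.m_closed)
  then show "pair_index r q \<otimes>\<^bsub>K0 J\<^esub> pair_index q p = pair_index r p"
    unfolding irp(2) using carr by simp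
qed

end

section \<open>Independence of the partition\<close>

context comm_group
begin

text \<open>The additivity of the index on one cell in abstract form; it is all that the comparison
  of partitions uses of operators.\<close>

definition additive_on :: "real set \<Rightarrow> (real \<Rightarrow> real \<Rightarrow> 'a) \<Rightarrow> bool" where
  "additive_on S \<sigma> \<longleftrightarrow> (\<forall>x\<in>S. \<forall>y\<in>S. \<sigma> x y \<in> carrier G \<and> (\<forall>z\<in>S. \<sigma> x y \<otimes> \<sigma> y z = \<sigma> x z))"

lemma additive_onD:
  assumes "additive_on S \<sigma>" "x \<in> S" "y \<in> S"
  shows "\<sigma> x y \<in> carrier G" "z \<in> S \<Longrightarrow> \<sigma> x y \<otimes> \<sigma> y z = \<sigma> x z"
  using assms by (auto simp: additive_on_def)

lemma additive_on_refl:
  assumes "additive_on S \<sigma>" "x \<in> S"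
  shows "\<sigma> x x = \<one>"
  using additive_onD[OF assms assms(2)] assms(2) by (metis r_cancel_one')

lemma finprod_Suc:
  assumes "\<And>i. i \<in> {1..Suc k} \<Longrightarrow> f i \<in> carrier G"
  shows "finprod G f {1..Suc k} = finprod G f {1..k} \<otimes> f (Suc k)"
proof -
  have "{1..Suc k} = insert (Suc k) {1..k}"
    by auto
  then have "finprod G f {1..Suc k} = f (Suc k) \<otimes> finprod G f {1..k}"
    using assms by (simp add: Pi_iff)
  also have "\<dots> = finprod G f {1..k} \<otimes> f (Suc k)"
    using assms by (intro m_comm finprod_closed) (auto simp: Pi_iff)
  finally show ?thesis .
qed

lemma finprod_eqI:
  assumes "\<And>i. i \<in> I \<Longrightarrow> f i = g i" "\<And>i. i \<in> I \<Longrightarrow> g i \<in> carrier G"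
  shows "finprod G f I = finprod G g I"
  using assms by (intro finprod_cong') auto

lemma finprod_telescope:
  fixes d :: "nat \<Rightarrow> real" and k :: nat
  assumes S: "additive_on S \<sigma>" and d: "\<And>i. i \<le> k \<Longrightarrow> d i \<in> S"
  shows "finprod G (\<lambda>i. \<sigma> (d (i - 1)) (d i)) {1..k} = \<sigma> (d 0) (d k)"
  using d
proof (induction k)
  case 0
  then show ?case
    using additive_on_refl[OF S] by simp
next
  case (Suc k)
  have "finprod G (\<lambda>i. \<sigma> (d (i - 1)) (d i)) {1..Suc k} = \<sigma> (d 0) (d k) \<otimes> \<sigma> (d k) (d (Suc k))"
    using Suc by (subst finprod_Suc) (auto intro!: additive_onD[OF S])
  also have "\<dots> = \<sigma> (d 0) (d (Suc k))"
    using Suc.prems by (intro additive_onD[OF S]) auto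
  finally show ?case .
qed

text \<open>\<open>\<Phi> x\<close> is the sum along the first partition up to the point \<open>x\<close>.\<close>

lemma partition_sum_eq:
  fixes t u :: "nat \<Rightarrow> real" and \<sigma> :: "real \<Rightarrow> real \<Rightarrow> 'a"
  assumes t: "t 0 = 0" "t m = 1" "\<And>i. i \<in> {1..m} \<Longrightarrow> t (i - 1) < t i"
      "\<And>i. i \<in> {1..m} \<Longrightarrow> additive_on {t (i - 1)..t i} \<sigma>"
    and u: "u 0 = 0" "u n = 1" "\<And>i. i \<in> {1..n} \<Longrightarrow> u (i - 1) < u i"
      "\<And>i. i \<in> {1..n} \<Longrightarrow> additive_on {u (i - 1)..u i} \<sigma>"
  shows "finprod G (\<lambda>i. \<sigma> (t (i - 1)) (t i)) {1..m} = finprod G (\<lambda>i. \<sigma> (u (i - 1)) (u i)) {1..n}"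
proof -
  have mono: "w i \<le> w j" if "i \<le> j" "j \<le> k" "\<And>i. i \<in> {1..k} \<Longrightarrow> w (i - 1) < w i"
    for w :: "nat \<Rightarrow> real" and i j k
    using that(1,2)
  proof (induction j rule: dec_induct)
    case (step l)
    then show ?case
      using that(3)[of "Suc l"] by simp
  qed simp
  have t01: "0 \<le> t i" "t i \<le> 1" if "i \<le> m" for i
    using mono[of 0 i m t] mono[of i m m t] that t by auto
  have u01: "0 \<le> u i" "u i \<le> 1" if "i \<le> n" for i
    using mono[of 0 i n u] mono[of i n n u] that u by auto
  \<comment> \<open>\<open>c i x\<close> is \<open>x\<close> clamped to the cell with index
    \<open>i\<close>, so \<open>\<sigma> (t (i - 1)) (c i x)\<close> is the contribution of this
    cell up to \<open>x\<close>; it is trivial for cells to the right of \<open>x\<close>.\<close>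
  define c where "c i x = max (t (i - 1)) (min (t i) x)" for i x
  have c: "c i x \<in> {t (i - 1)..t i}" "t (i - 1) \<in> {t (i - 1)..t i}" if "i \<in> {1..m}" for i x
    using t(3)[OF that] by (auto simp: c_def)
  have cl1: "\<sigma> (t (i - 1)) (c i x) \<in> carrier G" and cl2: "\<sigma> (c i x) (c i y) \<in> carrier G"
    if i: "i \<in> {1..m}" for i x y
    using additive_onD(1)[OF t(4)[OF i] c(2)[OF i] c(1)[OF i]]
      additive_onD(1)[OF t(4)[OF i] c(1)[OF i] c(1)[OF i]] by auto
  define \<Phi> where "\<Phi> x = finprod G (\<lambda>i. \<sigma> (t (i - 1)) (c i x)) {1..m}" for x
  have \<Phi>: "\<Phi> x \<in> carrier G" for x
    unfolding \<Phi>_def by (rule finprod_closed, rule Pi_I) (erule cl1)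
  have step: "\<Phi> y = \<Phi> x \<otimes> \<sigma> x y"
    if xy: "0 \<le> x" "x \<le> y" "y \<le> 1" and S: "additive_on {x..y} \<sigma>" for x y
  proof -
    \<comment> \<open>The dual clamping, of \<open>t i\<close> to \<open>{x..y}\<close>. On a cell
      that meets this interval both clampings yield the same pair of points; on any other cell both
      yield a repeated point and hence the unit.\<close>
    define d where "d i = max x (min y (t i))" for i
    have d: "d i \<in> {x..y}" for i
      using xy by (auto simp: d_def)
    have eq: "\<sigma> (c i x) (c i y) = \<sigma> (d (i - 1)) (d i)" if i: "i \<in> {1..m}" for i
    proof -
      have refl: "\<sigma> z z = \<one>" if "z \<in> {t (i - 1)..t i} \<or> z \<in> {x..y}" for z
        using that additive_on_refl[OF t(4)[OF i]] additive_on_refl[OF S] by blast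
      have lt: "t (i - 1) < t i"
        by (rule t(3)[OF i])
      consider "t i < x" | "y < t (i - 1)" | "x \<le> t i" "t (i - 1) \<le> y"
        by linarith
      then show ?thesis
      proof cases
        case 1
        then have "c i x = t i" "c i y = t i" "d (i - 1) = x" "d i = x"
          using lt xy by (auto simp: c_def d_def)
        then show ?thesis
          using refl[of "t i"] refl[of x] lt xy by simp
      next
        case 2
        then have "c i x = t (i - 1)" "c i y = t (i - 1)" "d (i - 1) = y" "d i = y"
          using lt xy by (auto simp: c_def d_def)
        then show ?thesis
          using refl[of "t (i - 1)"] refl[of y] lt xy by simp
      next
        case 3
        then have "c i x = d (i - 1)" "c i y = d i"
          using lt xy by (auto simp: c_def d_def)
        then show ?thesis
          by simp
      qed
    qed
    have "\<Phi> y = finprod G (\<lambda>i. \<sigma> (t (i - 1)) (c i x) \<otimes> \<sigma> (c i x) (c i y)) {1..m}"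
      unfolding \<Phi>_def
    proof (rule finprod_eqI)
      fix i assume i: "i \<in> {1..m}"
      show "\<sigma> (t (i - 1)) (c i y) = \<sigma> (t (i - 1)) (c i x) \<otimes> \<sigma> (c i x) (c i y)"
        by (rule additive_onD(2)[OF t(4)[OF i] c(2)[OF i] c(1)[OF i] c(1)[OF i], symmetric])
      show "\<sigma> (t (i - 1)) (c i x) \<otimes> \<sigma> (c i x) (c i y) \<in> carrier G"
        by (intro m_closed cl1 cl2 i)
    qed
    also have "\<dots> = \<Phi> x \<otimes> finprod G (\<lambda>i. \<sigma> (c i x) (c i y)) {1..m}"
      unfolding \<Phi>_def by (rule finprod_multf; rule Pi_I; erule cl1 cl2)
    also have "finprod G (\<lambda>i. \<sigma> (c i x) (c i y)) {1..m} = finprod G (\<lambda>i. \<sigma> (d (i - 1)) (d i)) {1..m}"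
      by (rule finprod_eqI) (erule eq, rule additive_onD(1)[OF S d d])
    also have "\<dots> = \<sigma> (d 0) (d m)"
      by (rule finprod_telescope[OF S d])
    also have "\<dots> = \<sigma> x y"
      using xy by (simp add: d_def t)
    finally show ?thesis .
  qed
  have "\<Phi> (u k) = finprod G (\<lambda>i. \<sigma> (u (i - 1)) (u i)) {1..k}" if "k \<le> n" for k
    using that
  proof (induction k)
    case 0
    have "\<sigma> (t (i - 1)) (c i 0) = \<one>" if i: "i \<in> {1..m}" for i
    proof -
      have "i - 1 \<le> m"
        using i by auto
      from t01(1)[OF this] have "c i 0 = t (i - 1)"
        using t(3)[OF i] by (simp add: c_def max_def min_def)
      then show ?thesis
        using additive_on_refl[OF t(4)[OF i] c(2)[OF i]] by simp
    qed
    then have "\<Phi> 0 = finprod G (\<lambda>i. \<one>) {1..m}"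
      unfolding \<Phi>_def by (intro finprod_eqI) auto
    then show ?case
      by (simp add: u)
  next
    case (Suc k)
    have k: "Suc k \<in> {1..n}"
      using Suc.prems by simp
    have "\<Phi> (u (Suc k)) = \<Phi> (u k) \<otimes> \<sigma> (u k) (u (Suc k))"
    proof (rule step)
      show "0 \<le> u k" "u (Suc k) \<le> 1"
        using u01[of k] u01[of "Suc k"] Suc.prems by auto
      show "u k \<le> u (Suc k)" "additive_on {u k..u (Suc k)} \<sigma>"
        using u(3)[OF k] u(4)[OF k] by simp_all
    qed
    also have "\<dots> = finprod G (\<lambda>i. \<sigma> (u (i - 1)) (u i)) {1..Suc k}"
    proof (subst finprod_Suc)
      fix i assume "i \<in> {1..Suc k}"
      then have i: "i \<in> {1..n}"
        using Suc.prems by auto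
      show "\<sigma> (u (i - 1)) (u i) \<in> carrier G"
        using u(3)[OF i] by (intro additive_onD(1)[OF u(4)[OF i]]) auto
    qed (use Suc in simp)
    finally show ?case .
  qed
  from this[of n] have "\<Phi> 1 = finprod G (\<lambda>i. \<sigma> (u (i - 1)) (u i)) {1..n}"
    by (simp add: u)
  moreover have "\<Phi> 1 = finprod G (\<lambda>i. \<sigma> (t (i - 1)) (t i)) {1..m}"
    unfolding \<Phi>_def
  proof (rule finprod_eqI)
    fix i assume i: "i \<in> {1..m}"
    have "t i \<le> 1"
      using t01(2)[of i] i by simp
    then have ci: "c i 1 = t i"
      using t(3)[OF i] by (simp add: c_def)
    then show "\<sigma> (t (i - 1)) (c i 1) = \<sigma> (t (i - 1)) (t i)"
      by simp
    show "\<sigma> (t (i - 1)) (t i) \<in> carrier G"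
      using cl1[OF i, of 1] by (simp only: ci)
  qed
  ultimately show ?thesis
    by simp
qed

end

section \<open>The spectral flow as a product of pair indices\<close>

context vn_ideal
begin

interpretation G: comm_group "K0 J" by (rule K0_group)

text \<open>The path runs from \<open>x\<close> to \<open>y\<close>, while the index of a pair is
  written with the target first. Additivity along the path is therefore the identity for three
  projections in reversed order, and commutativity of \<open>K0 J\<close> restores it.\<close>

lemma pair_index_additive_on:
  assumes path: "fredholm_path N J B" and ab: "0 \<le> a" "b \<le> 1"
    and close: "\<forall>x\<in>{a..b}. \<forall>y\<in>{a..b}. quot_dist N J (chi (B x)) (chi (B y)) < 1/2"
  shows "G.additive_on {a..b} (\<lambda>x y. pair_index (chi (B y)) (chi (B x)))"
  unfolding G.additive_on_def
proof (intro ballI conjI)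
  have chi: "is_projection (chi (B x))" "chi (B x) \<in> N" if "x \<in> {a..b}" for x
  proof -
    have "star (B x) = B x" "B x \<in> N"
      using path that ab by (auto simp: fredholm_path_def J_fredholm_def)
    then show "is_projection (chi (B x))" "chi (B x) \<in> N"
      using chi_projection chi_commutant[OF _ comm] by auto
  qed
  fix x y assume x: "x \<in> {a..b}" and y: "y \<in> {a..b}"
  \<comment> \<open>A pair is brought under the statement on three projections by repeating
    \<open>y\<close>.\<close>
  show "pair_index (chi (B y)) (chi (B x)) \<in> carrier (K0 J)"
    using close x y by (intro pair_index_additive(4)[OF chi[OF x] chi[OF y] chi[OF y]]) auto
  fix z assume z: "z \<in> {a..b}"
  have "pair_index (chi (B z)) (chi (B y)) \<otimes>\<^bsub>K0 J\<^esub> pair_index (chi (B y)) (chi (B x)) = pair_index (chi (B z)) (chi (B x))"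
    using close x y z by (intro pair_index_additive(7)[OF chi[OF x] chi[OF y] chi[OF z]]) auto
  moreover have "pair_index (chi (B y)) (chi (B x)) \<in> carrier (K0 J)" "pair_index (chi (B z)) (chi (B y)) \<in> carrier (K0 J)"
    using close x y z pair_index_additive(4,5)[OF chi[OF x] chi[OF y] chi[OF z]] by auto
  ultimately show "pair_index (chi (B y)) (chi (B x)) \<otimes>\<^bsub>K0 J\<^esub> pair_index (chi (B z)) (chi (B y)) = pair_index (chi (B z)) (chi (B x))"
    by (simp add: G.m_comm)
qed

text \<open>The path is controlled on \<open>{0..1}\<close> only, so the cells are first located
  inside it by monotonicity from both ends.\<close>

lemma sf_partition_additive_on:
  assumes path: "fredholm_path N J B" and t: "sf_partition N J B n t" and i: "i \<in> {1..n}"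
  shows "G.additive_on {t (i - 1)..t i} (\<lambda>x y. pair_index (chi (B y)) (chi (B x)))"
proof (rule pair_index_additive_on[OF path])
  have step: "t (k - 1) < t k" if "k \<in> {1..n}" for k
    using t that by (simp add: sf_partition_def)
  have "0 \<le> t k" if "k \<le> n" for k
    using that
  proof (induction k)
    case (Suc k)
    then show ?case
      using step[of "Suc k"] by simp
  qed (use t in \<open>simp add: sf_partition_def\<close>)
  then show "0 \<le> t (i - 1)"
    using i by auto
  have "t k \<le> 1" if "k \<le> n" for k
    using that
  proof (induction k rule: inc_induct)
    case (step k)
    then show ?case
      using \<open>\<And>k. k \<in> {1..n} \<Longrightarrow> t (k - 1) < t k\<close>[of "Suc k"] by simp
  qed (use t in \<open>simp add: sf_partition_def\<close>)
  then show "t i \<le> 1"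
    using i by auto
  show "\<forall>x\<in>{t (i - 1)..t i}. \<forall>y\<in>{t (i - 1)..t i}. quot_dist N J (chi (B x)) (chi (B y)) < 1 / 2"
    using t i by (simp add: sf_partition_def)
qed

lemma sf_eq_finprod:
  "sf J B n t = (\<Otimes>\<^bsub>K0 J\<^esub>i\<in>{1..n}. pair_index (chi (B (t i))) (chi (B (t (i - 1)))))"
  by (simp add: sf_def pair_index_def)

lemma sf_carrier:
  assumes "fredholm_path N J B" "sf_partition N J B n t"
  shows "sf J B n t \<in> carrier (K0 J)"
  unfolding sf_eq_finprod
proof (rule G.finprod_closed, rule Pi_I)
  fix i assume i: "i \<in> {1..n}"
  have "t (i - 1) < t i"
    using assms(2) i by (simp add: sf_partition_def)
  then show "pair_index (chi (B (t i))) (chi (B (t (i - 1)))) \<in> carrier (K0 J)"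
    by (intro G.additive_onD(1)[OF sf_partition_additive_on[OF assms i]]) auto
qed

lemma sf_independent:
  assumes path: "fredholm_path N J B" and t: "sf_partition N J B m t" and u: "sf_partition N J B n u"
  shows "sf J B m t = sf J B n u"
  unfolding sf_eq_finprod
proof (rule G.partition_sum_eq[where \<sigma> = "\<lambda>x y. pair_index (chi (B y)) (chi (B x))"])
  show "t 0 = 0" "t m = 1" "u 0 = 0" "u n = 1"
    using t u by (auto simp: sf_partition_def)
  show "t (i - 1) < t i" if "i \<in> {1..m}" for i
    using t that by (simp add: sf_partition_def)
  show "u (i - 1) < u i" if "i \<in> {1..n}" for i
    using u that by (simp add: sf_partition_def)
qed (rule sf_partition_additive_on[OF path t] sf_partition_additive_on[OF path u], assumption)+

end

theorem lemma3p8: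
  fixes N J :: "'a::hilbert_space bop set"
  assumes "von_neumann_algebra N"
    and "ideal J (op_ring N)"
    and "closed J"
  shows "(\<forall>p\<in>N. \<forall>q\<in>N. \<forall>r\<in>N.
            is_projection p \<longrightarrow> is_projection q \<longrightarrow> is_projection r \<longrightarrow>
            quot_dist N J p q < 1/2 \<longrightarrow> quot_dist N J q r < 1/2 \<longrightarrow> quot_dist N J r p < 1/2 \<longrightarrow>
            Ind N J r q (r * q) \<in> carrier (K0 J) \<and>
            Ind N J q p (q * p) \<in> carrier (K0 J) \<and>
            Ind N J r p (r * p) \<in> carrier (K0 J) \<and>
            Ind N J r q (r * q) \<otimes>\<^bsub>K0 J\<^esub> Ind N J q p (q * p) = Ind N J r p (r * p)) \<and>
         (\<forall>B m t n u. fredholm_path N J B \<longrightarrow>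
            sf_partition N J B m t \<longrightarrow> sf_partition N J B n u \<longrightarrow>
            sf J B m t \<in> carrier (K0 J) \<and> sf J B m t = sf J B n u)"
proof -
  interpret vn_ideal N J
    using assms by (rule vn_ideal.intro)
  have index: "Ind N J r q (r * q) \<in> carrier (K0 J) \<and> Ind N J q p (q * p) \<in> carrier (K0 J) \<and>
      Ind N J r p (r * p) \<in> carrier (K0 J) \<and>
      Ind N J r q (r * q) \<otimes>\<^bsub>K0 J\<^esub> Ind N J q p (q * p) = Ind N J r p (r * p)"
    if "p \<in> N" "q \<in> N" "r \<in> N" and P: "is_projection p" "is_projection q" "is_projection r"
      and "quot_dist N J p q < 1/2" "quot_dist N J r p < 1/2" for p q r
  proof -
    note * = pair_index_additive[OF P(1) that(1) P(2) that(2) P(3) that(3,7,8)]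
    show ?thesis
      unfolding Ind_eq_pair_index[OF P(1,2) *(1)] Ind_eq_pair_index[OF P(2,3) *(2)]
        Ind_eq_pair_index[OF P(1,3) *(3)]
      by (intro conjI *(4-7))
  qed
  have sf: "sf J B m t \<in> carrier (K0 J) \<and> sf J B m t = sf J B n u"
    if "fredholm_path N J B" "sf_partition N J B m t" "sf_partition N J B n u" for B m t n u
    by (intro conjI sf_carrier[OF that(1,2)] sf_independent[OF that])
  show ?thesis
    by (rule conjI; intro ballI allI impI) (rule index sf; assumption)+
qed

end
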